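(* Fix $r\in(1,\infty)$ and a $w$-moderate weight $m$, and assume: (a) $RC_K:f\mapsto f*K$ is well-defined and bounded on $L_{r,m}(G)$; (b) there is a continuous $W:G\to\mathbb C$ with $W*K=K$ and $\check M^\rho_QW\in L_{1,w}(G)\cap L_{1,w\Delta^{-1}}(G)$ for some compact unit neighbourhood $Q$. Let $U$ be a compact unit neighbourhood with $C_U\cdot\|RC_K\|_{L_{r,m}\to L_{r,m}}<1$, where $C_U=\max\{\|\mathrm{osc}_UW\|_{L_{1,w}},\|\mathrm{osc}_UW\|_{L_{1,w\Delta^{-1}}}\}$. Let $X=(x_i)_{i\in I}$ be a relatively separated family for which a $U$-BUPU with localizing family $X$ exists, and $(m_X)_i=m(x_i)$. Then: the synthesis operator $\mathrm{Synth}_{X,\mathrm{Co}}:\ell_{r,m_X}(I)\to\mathrm{Co}(L_{r,m})$, $(c_i)\mapsto\sum_{i\in I}c_i\pi(x_i)u$ (unconditionally convergent series), is well-defined and bounded, and there is a bounded linear operator $C_{\mathrm{Co}}:\mathrm{Co}(L_{r,m})\to\ell_{r,m_X}(I)$ with $\mathrm{Synth}_{X,\mathrm{Co}}\circ C_{\mathrm{Co}}=\mathrm{id}_{\mathrm{Co}(L_{r,m})}$. Moreover, $C_{\mathrm{Co}}$ can be chosen so that its action does not depend on $(r,m)$: if the hypotheses hold for $(r_1,m_1)$ and $(r_2,m_2)$, the corresponding operators satisfy $C_1f=C_2f$ for all $f\in\mathrm{Co}(L_{r_1,m_1})\cap\mathrm{Co}(L_{r_2,m_2})$.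
   Context: Setting. $G$ is a locally compact, second countable group with left Haar measure, identity $e$, modular function $\Delta$. $(f*g)(x)=\int_G f(y)g(y^{-1}x)\,dy$, $\lambda(x)f(y)=f(x^{-1}y)$. $w:G\to(0,\infty)$ is a continuous weight with $w(xy)\le w(x)w(y)$, $w(x)=w(x^{-1})$. $L_{p,v}(G)$: measurable $f$ with $\|f\|_{L_{p,v}}=\|vf\|_{L_p}<\infty$; $\ell_{p,\theta}(I)=\{c:(\theta_ic_i)\in\ell_p(I)\}$. A continuous $m:G\to(0,\infty)$ is $w$-moderate if $m(xy)\le w(x)m(y)$ and $m(xy)\le m(x)w(y)$. $\pi$ is a strongly continuous unitary representation on a separable Hilbert space $\mathcal H$, $u\in\mathcal H$ with $Vv(x)=\langle v,\pi(x)u\rangle_{\mathcal H}$ an isometry $\mathcal H\to L_2(G)$; $K(x)=\langle u,\pi(x)u\rangle_{\mathcal H}$; standing assumption $K\in L_{p,w}(G)$ for all $p\in(1,\infty)$. $\mathcal S_w=\{v\in\mathcal H:Vv\in L_{p,w}\ \forall p\in(1,\infty)\}$ (Fréchet), $\mathcal S_w'$ its anti-dual, $\mathcal H\hookrightarrow\mathcal S_w'$, $V_eT(x)=\langle T,\pi(x)u\rangle_{\mathcal S_w}$; $\mathrm{Co}(L_{r,m})=\{T\in\mathcal S_w':V_eT\in L_{r,m}\}$ with norm $\|V_eT\|_{L_{r,m}}$. Maximal function: $\check M^\rho_QW(x)=\|W\|_{L_\infty(Qx)}$. Oscillation: $\mathrm{osc}_UW(x)=\sup_{u\in U}|W(ux)-W(x)|$.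 Relatively separated: for every compact unit neighbourhood $Q$ there is $N$ with $\sum_i\chi_{x_iQ}\le N$ on $G$. A $U$-BUPU with localizing family $X$: measurable $\psi_i:G\to[0,1]$, $X$ relatively separated, $\psi_i\equiv0$ off $x_iU$, $\sum_i\psi_i\equiv1$. *)

theory Defs
  imports "HOL-Analysis.Analysis" "HOL-Probability.Essential_Supremum"
begin

text \<open>Conventions. The group G is a type 'g of class group_add (NOT assumed commutative),
written additively: x + y is the group product xy, -x the inverse, 0 the identity e.
The Hilbert space H is a type 'h with an explicit complex scalar multiplication sc and
inner product ip (linear in the first, conjugate-linear in the second argument).\<close>

definition lc_group :: "'g::{group_add,topological_space} itself \<Rightarrow> bool" where
  "lc_group _ \<longleftrightarrow>
     continuous_on UNIV (\<lambda>p::'g\<times>'g. fst p + snd p) \<and>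
     continuous_on UNIV (uminus :: 'g \<Rightarrow> 'g) \<and>
     (\<forall>x::'g. \<exists>K. compact K \<and> x \<in> interior K)"

definition left_haar :: "'g::{group_add,topological_space} measure \<Rightarrow> bool" where
  "left_haar \<mu> \<longleftrightarrow>
     sets \<mu> = sets borel \<and>
     (\<forall>x. \<forall>A\<in>sets borel. emeasure \<mu> ((\<lambda>y. x + y) ` A) = emeasure \<mu> A) \<and>
     (\<forall>K. compact K \<longrightarrow> emeasure \<mu> K < \<infinity>) \<and>
     (\<forall>S. open S \<and> S \<noteq> {} \<longrightarrow> emeasure \<mu> S > 0)"

definition modular :: "'g::{group_add,topological_space} measure \<Rightarrow> 'g \<Rightarrow> real" where
  "modular \<mu> x = (THE d. d > 0 \<and>
     (\<forall>A\<in>sets borel. emeasure \<mu> ((\<lambda>y. y + x) ` A) = ennreal d * emeasure \<mu> A))"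

definition unit_nbhd :: "'g::{group_add,topological_space} set \<Rightarrow> bool" where
  "unit_nbhd Q \<longleftrightarrow> compact Q \<and> 0 \<in> interior Q"

definition weight :: "('g::{group_add,topological_space} \<Rightarrow> real) \<Rightarrow> bool" where
  "weight w \<longleftrightarrow> continuous_on UNIV w \<and> (\<forall>x. w x > 0) \<and>
     (\<forall>x y. w (x + y) \<le> w x * w y) \<and> (\<forall>x. w (- x) = w x)"

definition moderate :: "('g::{group_add,topological_space} \<Rightarrow> real) \<Rightarrow> ('g \<Rightarrow> real) \<Rightarrow> bool" where
  "moderate w m \<longleftrightarrow> continuous_on UNIV m \<and> (\<forall>x. m x > 0) \<and>
     (\<forall>x y. m (x + y) \<le> w x * m y) \<and> (\<forall>x y. m (x + y) \<le> m x * w y)"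

definition Lpw :: "'g measure \<Rightarrow> real \<Rightarrow> ('g \<Rightarrow> real) \<Rightarrow> ('g \<Rightarrow> complex) set" where
  "Lpw \<mu> p v = {f. f \<in> borel_measurable \<mu> \<and> integrable \<mu> (\<lambda>x. (v x * cmod (f x)) powr p)}"

definition Lpw_norm :: "'g measure \<Rightarrow> real \<Rightarrow> ('g \<Rightarrow> real) \<Rightarrow> ('g \<Rightarrow> complex) \<Rightarrow> real" where
  "Lpw_norm \<mu> p v f = (\<integral>x. (v x * cmod (f x)) powr p \<partial>\<mu>) powr (1 / p)"

definition Lpw_enorm_p :: "'g measure \<Rightarrow> real \<Rightarrow> ('g \<Rightarrow> real) \<Rightarrow> ('g \<Rightarrow> real) \<Rightarrow> ennreal" where
  "Lpw_enorm_p \<mu> p v f = (\<integral>\<^sup>+x. ennreal ((v x * \<bar>f x\<bar>) powr p) \<partial>\<mu>)"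

definition conv :: "'g::group_add measure \<Rightarrow> ('g \<Rightarrow> complex) \<Rightarrow> ('g \<Rightarrow> complex) \<Rightarrow> 'g \<Rightarrow> complex" where
  "conv \<mu> f g x = (\<integral>y. f y * g (- y + x) \<partial>\<mu>)"

definition rc_bounded :: "'g::group_add measure \<Rightarrow> ('g \<Rightarrow> complex) \<Rightarrow> real \<Rightarrow> ('g \<Rightarrow> real) \<Rightarrow> bool" where
  "rc_bounded \<mu> K r m \<longleftrightarrow>
     (\<forall>f\<in>Lpw \<mu> r m. (AE x in \<mu>. integrable \<mu> (\<lambda>y. f y * K (- y + x))) \<and>
                     conv \<mu> f K \<in> Lpw \<mu> r m) \<and>
     (\<exists>C. \<forall>f\<in>Lpw \<mu> r m. Lpw_norm \<mu> r m (conv \<mu> f K) \<le> C * Lpw_norm \<mu> r m f)"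

definition rc_norm :: "'g::group_add measure \<Rightarrow> ('g \<Rightarrow> complex) \<Rightarrow> real \<Rightarrow> ('g \<Rightarrow> real) \<Rightarrow> real" where
  "rc_norm \<mu> K r m = Inf {C. 0 \<le> C \<and>
     (\<forall>f\<in>Lpw \<mu> r m. Lpw_norm \<mu> r m (conv \<mu> f K) \<le> C * Lpw_norm \<mu> r m f)}"

definition maxfun :: "'g::{group_add,topological_space} measure \<Rightarrow> 'g set \<Rightarrow> ('g \<Rightarrow> complex) \<Rightarrow> 'g \<Rightarrow> real" where
  "maxfun \<mu> Q W x = real_of_ereal
     (esssup (restrict_space \<mu> ((\<lambda>q. q + x) ` Q)) (\<lambda>y. ereal (cmod (W y))))"

definition osc :: "'g::group_add set \<Rightarrow> ('g \<Rightarrow> complex) \<Rightarrow> 'g \<Rightarrow> real" where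
  "osc U W x = (SUP u\<in>U. cmod (W (u + x) - W x))"

definition lw :: "real \<Rightarrow> ('i \<Rightarrow> real) \<Rightarrow> ('i \<Rightarrow> complex) set" where
  "lw r \<theta> = {c. (\<lambda>i. (\<theta> i * cmod (c i)) powr r) summable_on UNIV}"

definition lw_norm :: "real \<Rightarrow> ('i \<Rightarrow> real) \<Rightarrow> ('i \<Rightarrow> complex) \<Rightarrow> real" where
  "lw_norm r \<theta> c = (\<Sum>\<^sub>\<infinity>i. (\<theta> i * cmod (c i)) powr r) powr (1 / r)"

definition hnorm :: "('h \<Rightarrow> 'h \<Rightarrow> complex) \<Rightarrow> 'h \<Rightarrow> real" where
  "hnorm ip v = sqrt (Re (ip v v))"

definition hilbert :: "(complex \<Rightarrow> 'h::ab_group_add \<Rightarrow> 'h) \<Rightarrow> ('h \<Rightarrow> 'h \<Rightarrow> complex) \<Rightarrow> bool" where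
  "hilbert sc ip \<longleftrightarrow>
     (\<forall>a b v. sc a (sc b v) = sc (a * b) v) \<and> (\<forall>v. sc 1 v = v) \<and>
     (\<forall>a v v'. sc a (v + v') = sc a v + sc a v') \<and> (\<forall>a b v. sc (a + b) v = sc a v + sc b v) \<and>
     (\<forall>v v' z. ip (v + v') z = ip v z + ip v' z) \<and> (\<forall>a v z. ip (sc a v) z = a * ip v z) \<and>
     (\<forall>v z. ip z v = cnj (ip v z)) \<and>
     (\<forall>v. Im (ip v v) = 0 \<and> Re (ip v v) \<ge> 0) \<and> (\<forall>v. ip v v = 0 \<longrightarrow> v = 0) \<and>
     (\<forall>S::nat \<Rightarrow> 'h. (\<forall>e>0. \<exists>N. \<forall>n\<ge>N. \<forall>k\<ge>N. hnorm ip (S n - S k) < e) \<longrightarrow>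
         (\<exists>L. (\<lambda>n. hnorm ip (S n - L)) \<longlonglongrightarrow> 0)) \<and>
     (\<exists>D. countable D \<and> (\<forall>v e. e > 0 \<longrightarrow> (\<exists>d\<in>D. hnorm ip (v - d) < e)))"

definition unitary_rep :: "(complex \<Rightarrow> 'h::ab_group_add \<Rightarrow> 'h) \<Rightarrow> ('h \<Rightarrow> 'h \<Rightarrow> complex)
     \<Rightarrow> ('g::{group_add,topological_space} \<Rightarrow> 'h \<Rightarrow> 'h) \<Rightarrow> bool" where
  "unitary_rep sc ip \<pi> \<longleftrightarrow>
     (\<forall>x v v'. \<pi> x (v + v') = \<pi> x v + \<pi> x v') \<and> (\<forall>x a v. \<pi> x (sc a v) = sc a (\<pi> x v)) \<and>
     (\<forall>x v v'. ip (\<pi> x v) (\<pi> x v') = ip v v') \<and> (\<forall>x. surj (\<pi> x)) \<and>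
     \<pi> 0 = id \<and> (\<forall>x y. \<pi> (x + y) = \<pi> x \<circ> \<pi> y) \<and>
     (\<forall>v x0. ((\<lambda>x. hnorm ip (\<pi> x v - \<pi> x0 v)) \<longlongrightarrow> 0) (at x0))"

definition Vop :: "('h \<Rightarrow> 'h \<Rightarrow> complex) \<Rightarrow> ('g \<Rightarrow> 'h \<Rightarrow> 'h) \<Rightarrow> 'h \<Rightarrow> 'h \<Rightarrow> 'g \<Rightarrow> complex" where
  "Vop ip \<pi> u v = (\<lambda>x. ip v (\<pi> x u))"

definition admissible :: "'g measure \<Rightarrow> ('h \<Rightarrow> 'h \<Rightarrow> complex) \<Rightarrow> ('g \<Rightarrow> 'h \<Rightarrow> 'h) \<Rightarrow> 'h \<Rightarrow> bool" where
  "admissible \<mu> ip \<pi> u \<longleftrightarrow>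
     (\<forall>v. Vop ip \<pi> u v \<in> Lpw \<mu> 2 (\<lambda>_. 1) \<and>
          (\<integral>x. (cmod (Vop ip \<pi> u v x))\<^sup>2 \<partial>\<mu>) = (hnorm ip v)\<^sup>2)"

definition Kf :: "('h \<Rightarrow> 'h \<Rightarrow> complex) \<Rightarrow> ('g \<Rightarrow> 'h \<Rightarrow> 'h) \<Rightarrow> 'h \<Rightarrow> 'g \<Rightarrow> complex" where
  "Kf ip \<pi> u = (\<lambda>x. ip u (\<pi> x u))"

definition Sw :: "'g measure \<Rightarrow> ('h \<Rightarrow> 'h \<Rightarrow> complex) \<Rightarrow> ('g \<Rightarrow> 'h \<Rightarrow> 'h) \<Rightarrow> 'h \<Rightarrow> ('g \<Rightarrow> real) \<Rightarrow> 'h set" where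
  "Sw \<mu> ip \<pi> u w = {v. \<forall>p>1. Vop ip \<pi> u v \<in> Lpw \<mu> p w}"

text \<open>Continuous anti-linear functionals on the Frechet space S_w (topology given by the
seminorms v |-> ||V v||_{L_{p,w}}, 1<p<infinity). Elements are represented as functions on
'h vanishing outside S_w; the pairing <T, v>_{S_w} is T v.\<close>
definition antidual :: "'g measure \<Rightarrow> (complex \<Rightarrow> 'h::ab_group_add \<Rightarrow> 'h) \<Rightarrow> ('h \<Rightarrow> 'h \<Rightarrow> complex)
    \<Rightarrow> ('g \<Rightarrow> 'h \<Rightarrow> 'h) \<Rightarrow> 'h \<Rightarrow> ('g \<Rightarrow> real) \<Rightarrow> ('h \<Rightarrow> complex) set" where
  "antidual \<mu> sc ip \<pi> u w = {T.
     (\<forall>v. v \<notin> Sw \<mu> ip \<pi> u w \<longrightarrow> T v = 0) \<and>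
     (\<forall>v\<in>Sw \<mu> ip \<pi> u w. \<forall>v'\<in>Sw \<mu> ip \<pi> u w. T (v + v') = T v + T v') \<and>
     (\<forall>a. \<forall>v\<in>Sw \<mu> ip \<pi> u w. T (sc a v) = cnj a * T v) \<and>
     (\<exists>P C. finite P \<and> P \<subseteq> {1<..} \<and>
        (\<forall>v\<in>Sw \<mu> ip \<pi> u w. cmod (T v) \<le> C * (\<Sum>p\<in>P. Lpw_norm \<mu> p w (Vop ip \<pi> u v))))}"

definition Ve :: "('g \<Rightarrow> 'h \<Rightarrow> 'h) \<Rightarrow> 'h \<Rightarrow> ('h \<Rightarrow> complex) \<Rightarrow> 'g \<Rightarrow> complex" where
  "Ve \<pi> u T = (\<lambda>x. T (\<pi> x u))"

definition Co :: "'g measure \<Rightarrow> (complex \<Rightarrow> 'h::ab_group_add \<Rightarrow> 'h) \<Rightarrow> ('h \<Rightarrow> 'h \<Rightarrow> complex)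
    \<Rightarrow> ('g \<Rightarrow> 'h \<Rightarrow> 'h) \<Rightarrow> 'h \<Rightarrow> ('g \<Rightarrow> real) \<Rightarrow> real \<Rightarrow> ('g \<Rightarrow> real) \<Rightarrow> ('h \<Rightarrow> complex) set" where
  "Co \<mu> sc ip \<pi> u w r m = {T \<in> antidual \<mu> sc ip \<pi> u w. Ve \<pi> u T \<in> Lpw \<mu> r m}"

definition Co_norm :: "'g measure \<Rightarrow> ('g \<Rightarrow> 'h \<Rightarrow> 'h) \<Rightarrow> 'h \<Rightarrow> real \<Rightarrow> ('g \<Rightarrow> real) \<Rightarrow> ('h \<Rightarrow> complex) \<Rightarrow> real" where
  "Co_norm \<mu> \<pi> u r m T = Lpw_norm \<mu> r m (Ve \<pi> u T)"

text \<open>The series sum_i c_i pi(x_i) u (each term embedded into S_w' via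
v |-> <c_i pi(x_i) u, v>) converges unconditionally to T in Co(L_{r,m}).
Since V_e is linear, the Co-norm of T minus a finite partial sum over G is the
L_{r,m}-norm of the function below; its r-th power is measured in ennreal so that
a non-integrable difference counts as infinitely large.\<close>
definition synth_conv :: "'g measure \<Rightarrow> (complex \<Rightarrow> 'h::ab_group_add \<Rightarrow> 'h) \<Rightarrow> ('h \<Rightarrow> 'h \<Rightarrow> complex)
    \<Rightarrow> ('g \<Rightarrow> 'h \<Rightarrow> 'h) \<Rightarrow> 'h \<Rightarrow> ('g \<Rightarrow> real) \<Rightarrow> real \<Rightarrow> ('g \<Rightarrow> real)
    \<Rightarrow> ('i \<Rightarrow> 'g) \<Rightarrow> ('i \<Rightarrow> complex) \<Rightarrow> ('h \<Rightarrow> complex) \<Rightarrow> bool" where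
  "synth_conv \<mu> sc ip \<pi> u w r m X c T \<longleftrightarrow>
     T \<in> Co \<mu> sc ip \<pi> u w r m \<and>
     (\<forall>e>0. \<exists>F. finite F \<and> (\<forall>G. finite G \<and> F \<subseteq> G \<longrightarrow>
        Lpw_enorm_p \<mu> r m (\<lambda>x. cmod (T (\<pi> x u) - (\<Sum>i\<in>G. ip (sc (c i) (\<pi> (X i) u)) (\<pi> x u))))
          < ennreal e))"

definition rel_separated :: "('i \<Rightarrow> 'g::{group_add,topological_space}) \<Rightarrow> bool" where
  "rel_separated X \<longleftrightarrow> (\<forall>Q. unit_nbhd Q \<longrightarrow> (\<exists>N::nat. \<forall>x.
      finite {i. x \<in> (\<lambda>q. X i + q) ` Q} \<and> card {i. x \<in> (\<lambda>q. X i + q) ` Q} \<le> N))"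

definition bupu :: "'g::{group_add,topological_space} set \<Rightarrow> ('i \<Rightarrow> 'g) \<Rightarrow> ('i \<Rightarrow> 'g \<Rightarrow> real) \<Rightarrow> bool" where
  "bupu U X \<psi> \<longleftrightarrow> rel_separated X \<and>
     (\<forall>i. \<psi> i \<in> borel_measurable borel) \<and>
     (\<forall>i y. 0 \<le> \<psi> i y \<and> \<psi> i y \<le> 1) \<and>
     (\<forall>i y. y \<notin> (\<lambda>q. X i + q) ` U \<longrightarrow> \<psi> i y = 0) \<and>
     (\<forall>y. ((\<lambda>i. \<psi> i y) has_sum 1) UNIV)"

end

theory Submission
  imports Defs
begin

text \<open>Write \<open>V v\<close> for the voice transform and \<open>F = V\<^sub>e T\<close>. Although \<open>K\<close> need not be integrable,
  \<open>|K| * |K|\<close> lies in every \<open>L\<^sub>s\<^sub>,\<^sub>w\<close> with \<open>s > 1\<close> (Young), so all iterated convolutions with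
  \<open>K\<close> converge absolutely and \<open>K * K = K\<close> gives \<open>F * K * K = F * K\<close>. The reproducing formula
  \<open>F = F * K\<close> for \<open>T\<close> in the reservoir follows by approximating \<open>\<pi>(x)u\<close> in \<open>S\<^sub>w\<close> by Riemann sums
  of \<open>\<integral> V(\<pi>(x)u)(y) \<pi>(y)u dy\<close>; thus no duality theory is needed.

  With \<open>c i = \<integral> \<psi> i F\<close> one has \<open>|F * W - \<Sum> c i W(x\<^sub>i\<inverse> \<cdot>)| \<le> |F| * osc W\<close>. Convolving with \<open>K\<close>
  and using \<open>W * K = K\<close>, the residual \<open>F - \<Sum> c i K(x\<^sub>i\<inverse> \<cdot>)\<close> has norm at most
  \<open>C\<^sub>U \<cdot> \<parallel>RC\<^sub>K\<parallel> \<cdot> \<parallel>F\<parallel>\<close>. Iterating this contraction and summing the coefficients of the successive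
  residuals gives the coefficient operator; the formula does not mention \<open>(r, m)\<close>. In the other
  direction the functional \<open>v \<mapsto> \<integral> (\<Sum> c i K(x\<^sub>i\<inverse> \<cdot>)) cnj (V v)\<close> is the sum of the series.\<close>

section \<open>Real powers of extended nonnegative reals\<close>

text \<open>Norms enter as r-th powers in \<open>ennreal\<close>, so every estimate can be stated
  before finiteness is known. One Jensen inequality with a density,
  \<open>nn_integral_jensen\<close>, does the work of Hoelder, Young, Schur and Minkowski, over the
  group and over counting measures alike. The shape of C_U comes from Schur's test: integrating the
  kernel over y reflects the variable and produces the weight w/\<Delta>, integrating over x keeps
  w. The two weighted L_1 norms appear with exponents 1 - 1/r and 1/r, so their maximum bounds the
  product. \<open>modular\<close> is a definite description, hence uniqueness of Haar measure has to
  come first. Boundedness of RC_K controls f * K but not |f| * |K|. Therefore W carries the norm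
  estimates that need absolute values: continuity of translates, oscillation, convergence of the
  synthesized series. Convolution with K comes last. It also removes null sets: a function with F *
  K = F at every point is determined by its class, which turns almost-everywhere statements into
  identities of functions.\<close>

text \<open>Every exponent, negative ones included, fixes 0 and top. Hence multiplicativity and the
  exponent laws hold without side conditions, and a divergent integral keeps the value top after
  taking powers.\<close>

definition epow :: "real \<Rightarrow> ennreal \<Rightarrow> ennreal" where
  "epow r x = (if x = top then top else ennreal (enn2real x powr r))"

lemma epow_ennreal: "0 \<le> a \<Longrightarrow> epow r (ennreal a) = ennreal (a powr r)"
  by (simp add: epow_def)

lemma epow_0 [simp]: "epow r 0 = 0"
  by (simp add: epow_def)

lemma epow_top [simp]: "epow r top = top"
  by (simp add: epow_def)

lemma epow_one [simp]: "epow 1 x = x"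
  by (cases x) (simp_all add: epow_def)

lemma epow_eq_0_iff [simp]: "epow r x = 0 \<longleftrightarrow> x = 0"
  by (cases x) (simp_all add: epow_def)

lemma epow_eq_top_iff [simp]: "epow r x = top \<longleftrightarrow> x = top"
  by (cases x) (simp_all add: epow_def)

lemma epow_less_top_iff [simp]: "epow r x < top \<longleftrightarrow> x < top"
  by (simp add: less_top[symmetric])

lemma epow_mono: "0 \<le> r \<Longrightarrow> x \<le> y \<Longrightarrow> epow r x \<le> epow r y"
  by (cases x; cases y) (auto simp: epow_def top_unique intro!: ennreal_leI powr_mono2)

lemma epow_mult: "epow r (x * y) = epow r x * epow r y"
proof (cases x; cases y)
  fix a b assume "0 \<le> a" "x = ennreal a" "0 \<le> b" "y = ennreal b"
  then show ?thesis
    by (simp add: ennreal_mult[symmetric] epow_ennreal powr_mult)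
next
  fix a assume "0 \<le> a" "x = ennreal a" "y = top"
  then show ?thesis by (cases "a = 0") (auto simp: ennreal_mult_top epow_ennreal)
next
  fix a assume "0 \<le> a" "y = ennreal a" "x = top"
  then show ?thesis by (cases "a = 0") (auto simp: ennreal_top_mult epow_ennreal)
qed simp

lemma epow_epow: "epow s (epow r x) = epow (r * s) x"
  by (cases x) (simp_all add: epow_ennreal powr_powr)

lemma epow_add: "epow (r + s) x = epow r x * epow s x"
  by (cases x) (simp_all add: epow_ennreal powr_add ennreal_mult[symmetric])

lemma epow_pos: "0 < x \<Longrightarrow> 0 < epow r x"
  by (simp add: zero_less_iff_neq_zero)

lemma measurable_epow [measurable]:
  assumes [measurable]: "f \<in> borel_measurable M"
  shows "(\<lambda>x. epow r (f x)) \<in> borel_measurable M"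
proof -
  have [measurable]: "{x \<in> space M. f x = top} \<in> sets M"
    using measurable_sets[OF assms, of "{top}"] by (simp add: vimage_def Int_def conj_commute)
  have "(\<lambda>x. enn2real (f x) powr r) \<in> borel_measurable M" by measurable
  then show ?thesis
    unfolding epow_def by (intro measurable_If) auto
qed

text \<open>From x + y \<le> 2 max(x, y). The constant is harmless for finiteness, boundedness and
  limits; the contraction factor never passes through it.\<close>

lemma epow_add_le:
  assumes "0 < r" shows "epow r (x + y) \<le> ennreal (2 powr r) * (epow r x + epow r y)"
proof -
  have "x + y \<le> 2 * max x y"
    by (cases "x \<le> y") (auto simp: max_def mult_2 intro: add_mono)
  then have "epow r (x + y) \<le> epow r (2 * max x y)"
    using assms by (intro epow_mono) auto
  also have "\<dots> = ennreal (2 powr r) * epow r (max x y)"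
    using epow_ennreal[of 2 r] by (simp add: epow_mult)
  also have "\<dots> \<le> ennreal (2 powr r) * (epow r x + epow r y)"
    by (intro mult_left_mono) (auto simp: max_def)
  finally show ?thesis .
qed

lemma epow_add_AE_le:
  assumes "0 < r" "f \<in> borel_measurable M" "g \<in> borel_measurable M"
    and "AE x in M. h x \<le> f x + g x"
  shows "(\<integral>\<^sup>+x. epow r (h x) \<partial>M)
    \<le> ennreal (2 powr r) * ((\<integral>\<^sup>+x. epow r (f x) \<partial>M) + (\<integral>\<^sup>+x. epow r (g x) \<partial>M))"
proof -
  have "(\<integral>\<^sup>+x. epow r (h x) \<partial>M) \<le> (\<integral>\<^sup>+x. ennreal (2 powr r) * (epow r (f x) + epow r (g x)) \<partial>M)"
  proof (rule nn_integral_mono_AE, use assms(4) in eventually_elim)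
    case (elim x)
    have "epow r (h x) \<le> epow r (f x + g x)"
      using elim assms by (intro epow_mono) auto
    then show ?case using epow_add_le[OF assms(1)] order_trans by blast
  qed
  also have "\<dots> = ennreal (2 powr r) * ((\<integral>\<^sup>+x. epow r (f x) \<partial>M) + (\<integral>\<^sup>+x. epow r (g x) \<partial>M))"
    using assms by (simp add: nn_integral_cmult nn_integral_add)
  finally show ?thesis .
qed

lemma epow_tendsto_0:
  assumes "0 < r" "(f \<longlongrightarrow> 0) F" shows "((\<lambda>x. epow r (f x)) \<longlongrightarrow> 0) F"
proof (rule order_tendstoI)
  fix a :: ennreal assume "0 < a"
  then have "0 < epow (1/r) a" by (rule epow_pos)
  with assms(2) have "eventually (\<lambda>x. f x < epow (1/r) a) F"
    by (rule order_tendstoD)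
  then show "eventually (\<lambda>x. epow r (f x) < a) F"
  proof eventually_elim
    case (elim x)
    show ?case
    proof (rule ccontr)
      assume "\<not> epow r (f x) < a"
      then have "epow (1/r) a \<le> epow (1/r) (epow r (f x))"
        using assms by (intro epow_mono) auto
      with elim assms show False by (simp add: epow_epow)
    qed
  qed
qed simp

section \<open>Jensen's and Hoelder's inequalities in \<open>ennreal\<close>\<close>

text \<open>The tangent at t to the convex function h^r lies below its graph. The constant term
  stands on the right so that nothing is subtracted in \<open>ennreal\<close>; over the reals this
  is Young's inequality for a and t^(r-1).\<close>

lemma young_tangent:
  assumes r: "1 < r" and t: "0 < t"
  shows "ennreal (r * t powr (r - 1)) * h \<le> epow r h + ennreal ((r - 1) * t powr r)"
proof (cases h)
  case (real a)
  have "r * t powr (r - 1) * a \<le> a powr r + (r - 1) * t powr r"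
  proof (cases "a = 0")
    case True
    with r show ?thesis by simp
  next
    case False
    with real have a: "0 < a" by simp
    define q where "q = r / (r - 1)"
    have q: "1 < q" "1 / r + 1 / q = 1" "(r - 1) * q = r" "r / q = r - 1"
      using r by (auto simp: q_def field_simps)
    have "a * t powr (r - 1) \<le> a powr r / r + (t powr (r - 1)) powr q / q"
      using a t r q by (intro Youngs_inequality) auto
    also have "(t powr (r - 1)) powr q = t powr r"
      using q by (simp add: powr_powr)
    finally have "r * (a * t powr (r - 1)) \<le> r * (a powr r / r + t powr r / q)"
      using r by (intro mult_left_mono) auto
    also have "\<dots> = a powr r + (r / q) * t powr r" using r by (simp add: field_simps)
    finally show ?thesis using q by (simp add: mult_ac)
  qed
  then show ?thesis
    using real r by (simp add: epow_ennreal ennreal_mult[symmetric] ennreal_plus[symmetric] del: ennreal_plus)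
qed simp

text \<open>Integrate the tangent inequality at the point \<open>t\<close> with \<open>t\<^sup>r \<integral>k = \<integral>k h\<^sup>r\<close>.\<close>

lemma nn_integral_jensen:
  fixes k h :: "'a \<Rightarrow> ennreal"
  assumes r: "1 < r" and [measurable]: "k \<in> borel_measurable M" "h \<in> borel_measurable M"
  shows "epow r (\<integral>\<^sup>+x. k x * h x \<partial>M)
    \<le> epow (r - 1) (\<integral>\<^sup>+x. k x \<partial>M) * (\<integral>\<^sup>+x. k x * epow r (h x) \<partial>M)"
proof -
  define A where "A = (\<integral>\<^sup>+x. k x \<partial>M)"
  define B where "B = (\<integral>\<^sup>+x. k x * epow r (h x) \<partial>M)"
  have zero: "(\<integral>\<^sup>+x. k x * h x \<partial>M) = 0" if "A = 0 \<or> B = 0"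
    using that
  proof
    assume "A = 0"
    then have "AE x in M. k x = 0" unfolding A_def by (simp add: nn_integral_0_iff_AE)
    then have "AE x in M. k x * h x = 0" by eventually_elim simp
    then show ?thesis by (simp add: nn_integral_0_iff_AE)
  next
    assume "B = 0"
    then have "AE x in M. k x * epow r (h x) = 0" unfolding B_def by (simp add: nn_integral_0_iff_AE)
    then have "AE x in M. k x * h x = 0" by eventually_elim auto
    then show ?thesis by (simp add: nn_integral_0_iff_AE)
  qed
  \<comment> \<open>In the second case neither factor on the right vanishes and one is top, so the
    bound is trivial. Only finite positive A and B admit a tangent point t.\<close>
  consider "A = 0 \<or> B = 0" | "A \<noteq> 0" "B \<noteq> 0" "A = top \<or> B = top" | "A \<noteq> 0" "B \<noteq> 0" "A \<noteq> top" "B \<noteq> top"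
    by blast
  then show ?thesis
  proof cases
    case 1
    with zero show ?thesis by simp
  next
    case 2
    then have "epow (r - 1) A * B = top"
      by (auto simp: ennreal_mult_eq_top_iff)
    then show ?thesis by (simp add: A_def B_def)
  next
    case 3
    then obtain a b where ab: "A = ennreal a" "B = ennreal b" "0 < a" "0 < b"
      by (cases A; cases B) (auto simp: order.strict_iff_order)
    define t where "t = (b / a) powr (1 / r)"
    have t: "0 < t" "t powr r * a = b"
      using ab r by (auto simp: t_def powr_powr)
    have "ennreal (r * t powr (r - 1)) * (\<integral>\<^sup>+x. k x * h x \<partial>M)
        = (\<integral>\<^sup>+x. k x * (ennreal (r * t powr (r - 1)) * h x) \<partial>M)"
      by (subst nn_integral_cmult[symmetric]) (auto intro!: nn_integral_cong simp: mult_ac)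
    also have "\<dots> \<le> (\<integral>\<^sup>+x. k x * (epow r (h x) + ennreal ((r - 1) * t powr r)) \<partial>M)"
      by (intro nn_integral_mono mult_left_mono young_tangent r t) auto
    also have "\<dots> = B + ennreal ((r - 1) * t powr r) * A"
      unfolding A_def B_def
      by (subst nn_integral_cmult[symmetric], simp, subst nn_integral_add[symmetric])
         (auto intro!: nn_integral_cong simp: distrib_left mult_ac)
    also have "\<dots> = ennreal (r * b)"
      using ab r t(2)
      by (simp add: ennreal_mult[symmetric] ennreal_plus[symmetric] mult.assoc del: ennreal_plus)
         (simp add: algebra_simps)
    finally have *: "ennreal (r * t powr (r - 1)) * (\<integral>\<^sup>+x. k x * h x \<partial>M) \<le> ennreal (r * b)" .
    obtain c where c: "(\<integral>\<^sup>+x. k x * h x \<partial>M) = ennreal c" "0 \<le> c"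
    proof (cases "\<integral>\<^sup>+x. k x * h x \<partial>M")
      case top
      with * r t have False by (auto simp: ennreal_mult_top top_unique)
      then show ?thesis ..
    qed (use that in auto)
    from * c r have "r * t powr (r - 1) * c \<le> r * b"
      using ab by (simp add: ennreal_mult[symmetric])
    then have "t powr (r - 1) * c \<le> b" using r by simp
    also have "b = t powr (r - 1) * (t * a)"
      using t by (simp add: powr_mult_base mult.assoc[symmetric] mult.commute powr_diff)
    finally have "c \<le> t * a" using t by simp
    then have "c powr r \<le> (t * a) powr r" using c r by (intro powr_mono2) auto
    also have "\<dots> = a powr (r - 1) * b"
      using t ab by (simp add: powr_mult powr_diff field_simps)
    finally show ?thesis
      unfolding A_def[symmetric] B_def[symmetric]
      using c ab by (simp add: epow_ennreal ennreal_mult[symmetric])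
  qed
qed

text \<open>Jensen for the density g^q and the function f g^(1-q), where q + r(1-q) = 0 cancels g on
  the right. Where g = 0 both sides contribute 0 or the right one is larger, because
  \<open>0 powr z = 0\<close> for every z.\<close>

lemma nn_integral_holder:
  fixes f g :: "'a \<Rightarrow> real"
  assumes r: "1 < r" and [measurable]: "f \<in> borel_measurable M" "g \<in> borel_measurable M"
    and nonneg: "\<And>x. 0 \<le> f x" "\<And>x. 0 \<le> g x"
  shows "epow r (\<integral>\<^sup>+x. ennreal (f x * g x) \<partial>M)
    \<le> epow (r - 1) (\<integral>\<^sup>+x. ennreal (g x powr (r / (r - 1))) \<partial>M) * (\<integral>\<^sup>+x. ennreal (f x powr r) \<partial>M)"
proof -
  define q where "q = r / (r - 1)"
  have q: "q + r * (1 - q) = 0" "q > 1" using r by (auto simp: q_def field_simps)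
  have 1: "ennreal (g x powr q) * ennreal (f x * g x powr (1 - q)) = ennreal (f x * g x)" for x
    using nonneg[of x] by (cases "g x = 0") (auto simp: ennreal_mult[symmetric] powr_diff)
  have 2: "ennreal (g x powr q) * epow r (ennreal (f x * g x powr (1 - q))) \<le> ennreal (f x powr r)" for x
  proof (cases "g x = 0")
    case False
    then have "g x powr q * (f x * g x powr (1 - q)) powr r = f x powr r * g x powr (q + r * (1 - q))"
      using nonneg[of x] by (simp add: powr_mult powr_powr powr_add mult.commute)
    then show ?thesis using nonneg[of x] False by (simp add: epow_ennreal ennreal_mult[symmetric] q)
  qed simp
  have "epow r (\<integral>\<^sup>+x. ennreal (g x powr q) * ennreal (f x * g x powr (1 - q)) \<partial>M)
    \<le> epow (r - 1) (\<integral>\<^sup>+x. ennreal (g x powr q) \<partial>M)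
       * (\<integral>\<^sup>+x. ennreal (g x powr q) * epow r (ennreal (f x * g x powr (1 - q))) \<partial>M)"
    by (rule nn_integral_jensen[OF r]) measurable
  also have "\<dots> \<le> epow (r - 1) (\<integral>\<^sup>+x. ennreal (g x powr q) \<partial>M) * (\<integral>\<^sup>+x. ennreal (f x powr r) \<partial>M)"
    by (intro mult_left_mono nn_integral_mono 2) auto
  finally show ?thesis unfolding 1 by (simp add: q_def)
qed

section \<open>Haar measure\<close>

lemma image_add_right: "(\<lambda>y. y + x) ` A = {y. y - x \<in> (A :: 'a::group_add set)}"
proof (intro set_eqI iffI)
  fix y assume "y \<in> {y. y - x \<in> A}"
  then show "y \<in> (\<lambda>y. y + x) ` A" by (intro image_eqI[of _ _ "y - x"]) auto
qed auto

lemma image_diff_right: "(\<lambda>y. y - x) ` A = {y. y + x \<in> (A :: 'a::group_add set)}"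
  using image_add_right[of "- x" A] by simp

lemma ennreal_divide_mult_cancel:
  fixes a b c :: ennreal
  assumes "a \<noteq> 0" "a \<noteq> top" shows "b / a * (a * c) = b * c"
proof -
  have "a * inverse a = 1"
    using assms ennreal_divide_self[of a] by (simp add: divide_ennreal_def less_top)
  moreover have "b / a * (a * c) = (a * inverse a) * (b * c)"
    by (simp add: divide_ennreal_def mult_ac)
  ultimately show ?thesis by simp
qed

locale haar_group =
  fixes \<mu> :: "'g::{group_add, topological_space, t2_space, second_countable_topology} measure"
  assumes lc: "lc_group TYPE('g)" and haar: "left_haar \<mu>"
begin

lemma continuous_on_plus [continuous_intros]:
  fixes f g :: "'a::topological_space \<Rightarrow> 'g"
  assumes "continuous_on S f" "continuous_on S g"
  shows "continuous_on S (\<lambda>x. f x + g x)"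
proof -
  have "continuous_on UNIV (\<lambda>p::'g\<times>'g. fst p + snd p)"
    using lc by (simp add: lc_group_def)
  from continuous_on_compose2[OF this continuous_on_Pair[OF assms]] show ?thesis by simp
qed

lemma continuous_on_uminus [continuous_intros]:
  fixes f :: "'a::topological_space \<Rightarrow> 'g"
  assumes "continuous_on S f"
  shows "continuous_on S (\<lambda>x. - f x)"
proof -
  have "continuous_on UNIV (uminus :: 'g \<Rightarrow> 'g)"
    using lc by (simp add: lc_group_def)
  from continuous_on_compose2[OF this assms] show ?thesis by simp
qed

text \<open>Second countability identifies the Borel sets of the product space with the product
  sigma-algebra, so the jointly continuous operation is measurable in the sense that Fubini
  requires.\<close>

lemma measurable_plus [measurable]:
  fixes f g :: "'a \<Rightarrow> 'g"
  assumes [measurable]: "f \<in> borel_measurable M" "g \<in> borel_measurable M"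
  shows "(\<lambda>x. f x + g x) \<in> borel_measurable M"
proof -
  have "(\<lambda>p::'g\<times>'g. fst p + snd p) \<in> borel_measurable borel"
    by (intro borel_measurable_continuous_onI continuous_intros)
  from measurable_compose[OF _ this, of "\<lambda>x. (f x, g x)" M]
  show ?thesis by (simp add: borel_prod[symmetric])
qed

lemma measurable_uminus [measurable]:
  fixes f :: "'a \<Rightarrow> 'g"
  assumes [measurable]: "f \<in> borel_measurable M"
  shows "(\<lambda>x. - f x) \<in> borel_measurable M"
proof -
  have "(uminus :: 'g \<Rightarrow> 'g) \<in> borel_measurable borel"
    by (intro borel_measurable_continuous_onI continuous_intros)
  from measurable_compose[OF assms this] show ?thesis .
qed

lemma measurable_minus [measurable]:
  fixes f g :: "'a \<Rightarrow> 'g"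
  assumes [measurable]: "f \<in> borel_measurable M" "g \<in> borel_measurable M"
  shows "(\<lambda>x. f x - g x) \<in> borel_measurable M"
  unfolding diff_conv_add_uminus by measurable

lemma sets_mu [measurable_cong, simp]: "sets \<mu> = sets borel"
  using haar by (simp add: left_haar_def)

lemma space_mu [simp]: "space \<mu> = UNIV"
  using sets_eq_imp_space_eq[OF sets_mu] by simp

lemma emeasure_left:
  assumes "A \<in> sets borel" shows "emeasure \<mu> {y. x + y \<in> A} = emeasure \<mu> A"
proof -
  have "{y. x + y \<in> A} = (\<lambda>y. - x + y) ` A"
    by (force simp: image_iff add.assoc[symmetric] intro: bexI[of _ "x + y" for y])
  then show ?thesis using haar assms by (simp add: left_haar_def)
qed

lemma distr_left: "distr \<mu> borel (\<lambda>y. x + y) = \<mu>"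
proof (rule measure_eqI)
  fix A assume "A \<in> sets (distr \<mu> borel (\<lambda>y. x + y))"
  then show "emeasure (distr \<mu> borel (\<lambda>y. x + y)) A = emeasure \<mu> A"
    using emeasure_left[of A x] by (simp add: emeasure_distr vimage_def)
qed simp

lemma nn_integral_left:
  assumes [measurable]: "f \<in> borel_measurable borel"
  shows "(\<integral>\<^sup>+y. f (x + y) \<partial>\<mu>) = (\<integral>\<^sup>+y. f y \<partial>\<mu>)"
proof -
  have "(\<integral>\<^sup>+y. f y \<partial>\<mu>) = (\<integral>\<^sup>+y. f y \<partial>distr \<mu> borel (\<lambda>y. x + y))"
    by (simp only: distr_left)
  also have "\<dots> = (\<integral>\<^sup>+y. f (x + y) \<partial>\<mu>)" by (rule nn_integral_distr) measurable
  finally show ?thesis by simp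
qed

lemma integral_left:
  fixes f :: "'g \<Rightarrow> 'b::{banach, second_countable_topology}"
  assumes [measurable]: "f \<in> borel_measurable borel"
  shows "(\<integral>y. f (x + y) \<partial>\<mu>) = (\<integral>y. f y \<partial>\<mu>)"
proof -
  have "(\<integral>y. f y \<partial>\<mu>) = (\<integral>y. f y \<partial>distr \<mu> borel (\<lambda>y. x + y))"
    by (simp only: distr_left)
  also have "\<dots> = (\<integral>y. f (x + y) \<partial>\<mu>)" by (rule integral_distr) measurable
  finally show ?thesis by simp
qed

lemma compact_borel [measurable, simp]: "compact K \<Longrightarrow> (K::'g set) \<in> sets borel"
  by (simp add: borel_closed compact_imp_closed)

lemma emeasure_compact: "compact K \<Longrightarrow> emeasure \<mu> K < top"
  using haar by (simp add: left_haar_def)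

lemma emeasure_open: "open S \<Longrightarrow> S \<noteq> {} \<Longrightarrow> 0 < emeasure \<mu> S"
  using haar by (simp add: left_haar_def)

text \<open>Interiors of compact sets cover the group by local compactness; Lindelof extracts a
  countable cover and finite unions make it increasing. The sequence yields sigma-finiteness here
  and the domains of the Riemann sums later.\<close>

lemma compact_exhaustion:
  obtains D :: "nat \<Rightarrow> 'g set" where "\<And>n. compact (D n)" "incseq D" "(\<Union>n. D n) = UNIV"
proof -
  let ?F = "{interior K | K::'g set. compact K}"
  obtain F' where F': "F' \<subseteq> ?F" "countable F'" "\<Union>F' = \<Union>?F"
    using Lindelof[of ?F] by auto
  have U: "\<Union>?F = UNIV" using lc unfolding lc_group_def by blast
  with F' have "F' \<noteq> {}" by auto
  define S where "S = from_nat_into F'"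
  have S: "range S = F'" using F' \<open>F' \<noteq> {}\<close> by (simp add: S_def)
  have "\<forall>n. \<exists>K. compact K \<and> S n \<subseteq> K"
  proof
    fix n
    have "S n \<in> ?F" using S F'(1) by blast
    then obtain K where "S n = interior K" "compact K" by blast
    then show "\<exists>K. compact K \<and> S n \<subseteq> K" using interior_subset by blast
  qed
  then obtain C where C: "\<And>n. compact (C n)" "\<And>n. S n \<subseteq> C n" by metis
  show ?thesis
  proof (rule that[of "\<lambda>n. \<Union>k\<le>n. C k"])
    show "compact (\<Union>k\<le>n. C k)" for n using C by (intro compact_UN) auto
    show "incseq (\<lambda>n. \<Union>k\<le>n. C k)" by (auto simp: incseq_def) (meson atMost_iff order_trans)
    have "UNIV = (\<Union>n. S n)" using S F' U by simp
    also have "\<dots> \<subseteq> (\<Union>n. \<Union>k\<le>n. C k)" using C by blast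
    finally show "(\<Union>n. \<Union>k\<le>n. C k) = UNIV" by blast
  qed
qed

sublocale sigma_finite_measure \<mu>
proof
  obtain D :: "nat \<Rightarrow> 'g set" where "\<And>n. compact (D n)" "incseq D" "(\<Union>n. D n) = UNIV"
    by (blast intro: compact_exhaustion)
  then show "\<exists>A. countable A \<and> A \<subseteq> sets \<mu> \<and> \<Union>A = space \<mu> \<and> (\<forall>a\<in>A. emeasure \<mu> a \<noteq> \<infinity>)"
    using emeasure_compact by (intro exI[of _ "range D"]) (auto simp: less_top)
qed

lemma unit_nbhd_exists: obtains A :: "'g set" where "unit_nbhd A"
  using lc unfolding lc_group_def unit_nbhd_def by metis

text \<open>Integrate \<open>f x \<cdot> \<chi>\<^sub>A (y x) / G x\<close> over the product, substitute
  \<open>x \<mapsto> y\<inverse>x\<close> in the inner and then \<open>y \<mapsto> xy\<close> in the outer variable: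
  the value of \<open>\<mu>\<close> on \<open>f\<close> is \<open>\<mu> A\<close> times a quantity depending on \<open>\<nu>\<close> only.\<close>

lemma haar_uniqueness:
  fixes \<nu> :: "'g measure"
  assumes \<nu>: "left_haar \<nu>" and A: "unit_nbhd A" and [measurable]: "f \<in> borel_measurable borel"
  shows "(\<integral>\<^sup>+x. f x \<partial>\<mu>) = emeasure \<mu> A * (\<integral>\<^sup>+y. f (- y) / emeasure \<nu> {t. t - y \<in> A} \<partial>\<nu>)"
proof -
  interpret N: haar_group \<nu> using lc \<nu> by unfold_locales
  interpret P: pair_sigma_finite \<mu> \<nu> ..
  have [measurable]: "A \<in> sets borel" and cA: "compact A" using A by (auto simp: unit_nbhd_def)
  define g where "g x = emeasure \<nu> {t. t + x \<in> A}" for x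
  have g_eq: "g x = (\<integral>\<^sup>+t. indicator A (t + x) \<partial>\<nu>)" for x
  proof -
    have "(\<integral>\<^sup>+t. indicator A (t + x) \<partial>\<nu>) = (\<integral>\<^sup>+t. indicator {t. t + x \<in> A} t \<partial>\<nu>)"
      by (intro nn_integral_cong) (simp add: indicator_def)
    also have "\<dots> = g x" unfolding g_def by (rule nn_integral_indicator) measurable
    finally show ?thesis by simp
  qed
  have [measurable]: "g \<in> borel_measurable borel"
    unfolding g_eq by measurable
  \<comment> \<open>The set measured by \<open>g x\<close> is a right translate of A, compact with
    nonempty interior, so dividing by \<open>g x\<close> is legitimate.\<close>
  have g: "g x \<noteq> 0" "g x \<noteq> top" for x
  proof -
    have eq: "{t. t + x \<in> A} = (\<lambda>a. a - x) ` A"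
      by (auto simp: image_diff_right)
    have "compact ((\<lambda>a. a + (- x)) ` A)"
      by (intro compact_continuous_image continuous_intros cA)
    then show "g x \<noteq> top" unfolding g_def eq using N.emeasure_compact by (auto simp: less_top)
    have "open ((\<lambda>t. t + x) -` interior A)"
      by (intro open_vimage continuous_intros) auto
    moreover have "- x \<in> (\<lambda>t. t + x) -` interior A" using A by (simp add: unit_nbhd_def)
    ultimately have "0 < emeasure \<nu> ((\<lambda>t. t + x) -` interior A)"
      by (intro N.emeasure_open) blast+
    also have "\<dots> \<le> g x" unfolding g_def
    proof (rule emeasure_mono)
      show "(\<lambda>t. t + x) -` interior A \<subseteq> {t. t + x \<in> A}" using interior_subset by auto
    qed measurable
    finally show "g x \<noteq> 0" by simp
  qed
  have "(\<integral>\<^sup>+x. f x \<partial>\<mu>) = (\<integral>\<^sup>+x. \<integral>\<^sup>+y. f x * indicator A (y + x) / g x \<partial>\<nu> \<partial>\<mu>)"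
  proof (rule nn_integral_cong)
    fix x
    have "(\<integral>\<^sup>+y. f x * indicator A (y + x) / g x \<partial>\<nu>) = (\<integral>\<^sup>+y. (f x / g x) * indicator A (y + x) \<partial>\<nu>)"
      by (intro nn_integral_cong) (simp add: divide_ennreal_def mult_ac)
    also have "\<dots> = (f x / g x) * g x"
      unfolding g_eq by (rule nn_integral_cmult) measurable
    also have "\<dots> = f x" using g[of x] by (simp add: ennreal_divide_times ennreal_divide_self less_top)
    finally show "f x = (\<integral>\<^sup>+y. f x * indicator A (y + x) / g x \<partial>\<nu>)" by simp
  qed
  also have "\<dots> = (\<integral>\<^sup>+y. \<integral>\<^sup>+x. f x * indicator A (y + x) / g x \<partial>\<mu> \<partial>\<nu>)"
    by (rule P.Fubini'[symmetric]) measurable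
  also have "\<dots> = (\<integral>\<^sup>+y. \<integral>\<^sup>+x. f (- y + x) * indicator A x / g (- y + x) \<partial>\<mu> \<partial>\<nu>)"
  proof (rule nn_integral_cong)
    fix y
    show "(\<integral>\<^sup>+x. f x * indicator A (y + x) / g x \<partial>\<mu>) = (\<integral>\<^sup>+x. f (- y + x) * indicator A x / g (- y + x) \<partial>\<mu>)"
      using nn_integral_left[of "\<lambda>x. f (- y + x) * indicator A x / g (- y + x)" y]
      by (simp add: add.assoc[symmetric])
  qed
  also have "\<dots> = (\<integral>\<^sup>+x. \<integral>\<^sup>+y. f (- y + x) * indicator A x / g (- y + x) \<partial>\<nu> \<partial>\<mu>)"
    by (rule P.Fubini') measurable
  also have "\<dots> = (\<integral>\<^sup>+x. indicator A x * (\<integral>\<^sup>+y. f (- y) / g (- y) \<partial>\<nu>) \<partial>\<mu>)"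
  proof (rule nn_integral_cong)
    fix x
    have "(\<integral>\<^sup>+y. f (- y + x) * indicator A x / g (- y + x) \<partial>\<nu>)
        = (\<integral>\<^sup>+y. f (- y) * indicator A x / g (- y) \<partial>\<nu>)"
      using N.nn_integral_left[of "\<lambda>y. f (- y + x) * indicator A x / g (- y + x)" x]
      by (simp add: minus_add add.assoc)
    also have "\<dots> = (\<integral>\<^sup>+y. indicator A x * (f (- y) / g (- y)) \<partial>\<nu>)"
      by (intro nn_integral_cong) (simp add: divide_ennreal_def mult_ac)
    also have "\<dots> = indicator A x * (\<integral>\<^sup>+y. f (- y) / g (- y) \<partial>\<nu>)"
      by (rule nn_integral_cmult) measurable
    finally show "(\<integral>\<^sup>+y. f (- y + x) * indicator A x / g (- y + x) \<partial>\<nu>) = \<dots>" .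
  qed
  also have "\<dots> = emeasure \<mu> A * (\<integral>\<^sup>+y. f (- y) / g (- y) \<partial>\<nu>)"
    by (subst nn_integral_multc) auto
  finally show ?thesis by (simp add: g_def)
qed

section \<open>The modular function\<close>

text \<open>Right translations commute with left translations, so left invariance survives the
  push-forward. Comparing the result with \<open>\<mu>\<close> produces the modular
  function.\<close>

lemma left_haar_right_translate: "left_haar (distr \<mu> borel (\<lambda>y. y - x))"
  unfolding left_haar_def
proof (intro conjI allI ballI impI)
  show "sets (distr \<mu> borel (\<lambda>y. y - x)) = sets borel" by simp
  fix z and A :: "'g set" assume [measurable]: "A \<in> sets borel"
  have im: "(\<lambda>y. z + y) ` A = {y. - z + y \<in> A}"
    by (force simp: image_iff add.assoc[symmetric] intro: bexI[of _ "- z + y" for y])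
  have "emeasure \<mu> {y. - z + y \<in> {y. y - x \<in> A}} = emeasure \<mu> {y. y - x \<in> A}"
    by (rule emeasure_left) measurable
  then show "emeasure (distr \<mu> borel (\<lambda>y. y - x)) ((\<lambda>y. z + y) ` A) = emeasure (distr \<mu> borel (\<lambda>y. y - x)) A"
    unfolding im by (simp add: emeasure_distr vimage_def diff_conv_add_uminus add.assoc del: add_uminus_conv_diff)
next
  fix K :: "'g set" assume K: "compact K"
  have eq: "(\<lambda>y. y - x) -` K = (\<lambda>y. y + x) ` K"
    by (auto simp: image_add_right)
  have "compact ((\<lambda>y. y + x) ` K)" by (intro compact_continuous_image continuous_intros K)
  then show "emeasure (distr \<mu> borel (\<lambda>y. y - x)) K < \<infinity>"
    using K emeasure_compact by (simp add: emeasure_distr eq)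
next
  fix S :: "'g set" assume S: "open S \<and> S \<noteq> {}"
  then have [measurable]: "S \<in> sets borel" by auto
  have "open ((\<lambda>y. y + - x) -` S)" using S by (intro open_vimage continuous_intros) auto
  moreover obtain s where "s \<in> S" using S by auto
  then have "s + x \<in> (\<lambda>y. y + - x) -` S" by simp
  ultimately have "0 < emeasure \<mu> ((\<lambda>y. y + - x) -` S)" by (intro emeasure_open) blast+
  then show "0 < emeasure (distr \<mu> borel (\<lambda>y. y - x)) S"
    by (simp add: emeasure_distr)
qed

text \<open>\<open>haar_uniqueness\<close> is applied to \<open>\<mu>\<close> and to its right
  translate, with \<open>\<mu>\<close> as common reference measure. Both values are multiples of the
  same integral \<open>J\<close>, so their ratio does not depend on the set and equals the ratio on
  a unit neighbourhood C. The three facts share one proof because the description defining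
  \<open>modular\<close> must first be shown to denote.\<close>

lemma modular_pos: "0 < modular \<mu> x"
  and emeasure_right: "A \<in> sets borel \<Longrightarrow>
    emeasure \<mu> ((\<lambda>y. y + x) ` A) = ennreal (modular \<mu> x) * emeasure \<mu> A"
  and modular_unique: "0 < d \<Longrightarrow> (\<And>A. A \<in> sets borel \<Longrightarrow>
    emeasure \<mu> ((\<lambda>y. y + x) ` A) = ennreal d * emeasure \<mu> A) \<Longrightarrow> modular \<mu> x = d"
proof -
  obtain C :: "'g set" where C: "unit_nbhd C" by (rule unit_nbhd_exists)
  have C0: "emeasure \<mu> C \<noteq> top" "emeasure \<mu> C \<noteq> 0" if "left_haar \<mu>" for \<mu> :: "'g measure"
  proof -
    interpret haar_group \<mu> using lc that by unfold_locales
    show "emeasure \<mu> C \<noteq> top" using C emeasure_compact by (auto simp: unit_nbhd_def less_top)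
    have "0 < emeasure \<mu> (interior C)" using C by (intro emeasure_open) (auto simp: unit_nbhd_def)
    also have "\<dots> \<le> emeasure \<mu> C"
      using C interior_subset by (intro emeasure_mono) (auto simp: unit_nbhd_def)
    finally show "emeasure \<mu> C \<noteq> 0" by simp
  qed
  define \<nu> where "\<nu> = distr \<mu> borel (\<lambda>y. y - x)"
  have \<nu>: "left_haar \<nu>" unfolding \<nu>_def by (rule left_haar_right_translate)
  interpret N: haar_group \<nu> using lc \<nu> by unfold_locales
  have \<nu>_image: "emeasure \<nu> A = emeasure \<mu> ((\<lambda>y. y + x) ` A)" if "A \<in> sets borel" for A
  proof -
    have eq: "(\<lambda>y. y - x) -` A = (\<lambda>y. y + x) ` A"
      by (auto simp: image_add_right)
    from that show ?thesis by (simp add: \<nu>_def emeasure_distr eq)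
  qed
  define d where "d = enn2real (emeasure \<nu> C / emeasure \<mu> C)"
  have d0: "emeasure \<nu> C / emeasure \<mu> C \<noteq> top" "emeasure \<nu> C / emeasure \<mu> C \<noteq> 0"
    using C0[OF haar] C0[OF \<nu>] by (auto simp: ennreal_divide_eq_top_iff ennreal_divide_eq_0_iff)
  have d: "ennreal d = emeasure \<nu> C / emeasure \<mu> C" "0 < d"
    using d0 by (auto simp: d_def enn2real_positive_iff less_top zero_less_iff_neq_zero)
  have spec: "emeasure \<mu> ((\<lambda>y. y + x) ` A) = ennreal d * emeasure \<mu> A" if [measurable]: "A \<in> sets borel" for A
  proof -
    define J where "J = (\<integral>\<^sup>+y. indicator A (- y) / emeasure \<mu> {t. t - y \<in> C} \<partial>\<mu>)"
    have "emeasure \<nu> A = emeasure \<nu> C * J"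
      using N.haar_uniqueness[OF haar C, of "indicator A"] by (simp add: J_def)
    moreover have "emeasure \<mu> A = emeasure \<mu> C * J"
      using haar_uniqueness[OF haar C, of "indicator A"] by (simp add: J_def)
    moreover have "emeasure \<nu> C / emeasure \<mu> C * (emeasure \<mu> C * J) = emeasure \<nu> C * J"
      using C0[OF haar] by (intro ennreal_divide_mult_cancel) auto
    ultimately show ?thesis using d(1) \<nu>_image[OF that] by simp
  qed
  have uniq: "d' = d" if "0 < d'" "\<And>A. A \<in> sets borel \<Longrightarrow> emeasure \<mu> ((\<lambda>y. y + x) ` A) = ennreal d' * emeasure \<mu> A" for d'
  proof -
    have "ennreal d' * emeasure \<mu> C = ennreal d * emeasure \<mu> C"
      using that(2)[of C] spec[of C] C by (simp add: unit_nbhd_def)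
    then have "ennreal d' = ennreal d" 
      using C0[OF haar] by (metis ennreal_mult_divide_eq)
    with that d(2) show ?thesis by (simp only: ennreal_inj less_imp_le)
  qed
  have eq: "modular \<mu> x = d"
    unfolding modular_def
  proof (rule the_equality)
    show "0 < d \<and> (\<forall>A\<in>sets borel. emeasure \<mu> ((\<lambda>y. y + x) ` A) = ennreal d * emeasure \<mu> A)"
      using d(2) spec by blast
  qed (rule uniq, blast+)
  show "0 < modular \<mu> x" using d eq by simp
  show "emeasure \<mu> ((\<lambda>y. y + x) ` A) = ennreal (modular \<mu> x) * emeasure \<mu> A" if "A \<in> sets borel"
    using that spec eq by simp
  show "modular \<mu> x = d'" if "0 < d'" "\<And>A. A \<in> sets borel \<Longrightarrow> emeasure \<mu> ((\<lambda>y. y + x) ` A) = ennreal d' * emeasure \<mu> A" for d'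
    using uniq[OF that] eq by simp
qed

lemma modular_plus: "modular \<mu> (x + y) = modular \<mu> x * modular \<mu> y"
proof (rule modular_unique)
  show "0 < modular \<mu> x * modular \<mu> y" by (simp add: modular_pos)
  fix A :: "'g set" assume A: "A \<in> sets borel"
  have eq: "(\<lambda>z. z + x) ` A = (\<lambda>z. z + - x) -` A"
    by (auto simp: image_add_right)
  have "(\<lambda>z. z + - x) -` A \<inter> space borel \<in> sets borel"
    by (rule measurable_sets[OF _ A]) measurable
  then have m: "(\<lambda>z. z + x) ` A \<in> sets borel" by (simp add: eq)
  have "(\<lambda>z. z + (x + y)) ` A = (\<lambda>z. z + y) ` (\<lambda>z. z + x) ` A"
    by (simp add: image_image add.assoc)
  then show "emeasure \<mu> ((\<lambda>z. z + (x + y)) ` A) = ennreal (modular \<mu> x * modular \<mu> y) * emeasure \<mu> A"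
    using emeasure_right[OF m, of y] emeasure_right[OF A, of x] modular_pos
    by (simp add: ennreal_mult less_imp_le mult_ac)
qed

text \<open>\<Delta>(x) is the ratio of the measures of C x and C; written as the integral of
  \<open>indicator C (y - x)\<close>, the numerator depends measurably on x by Tonelli.\<close>

lemma measurable_modular [measurable]: "modular \<mu> \<in> borel_measurable borel"
proof -
  obtain C :: "'g set" where C: "unit_nbhd C" by (rule unit_nbhd_exists)
  then have [measurable]: "C \<in> sets borel" by (simp add: unit_nbhd_def)
  have C0: "emeasure \<mu> C \<noteq> top" using C emeasure_compact by (auto simp: unit_nbhd_def less_top)
  have "0 < emeasure \<mu> (interior C)" using C by (intro emeasure_open) (auto simp: unit_nbhd_def)
  also have "\<dots> \<le> emeasure \<mu> C" using interior_subset by (intro emeasure_mono) auto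
  finally have C1: "emeasure \<mu> C \<noteq> 0" by simp
  have "modular \<mu> x = enn2real ((\<integral>\<^sup>+y. indicator C (y - x) \<partial>\<mu>) / emeasure \<mu> C)" for x
  proof -
    have eq: "(\<lambda>y. y + x) ` C = {y. y - x \<in> C}"
      by (auto simp: image_add_right)
    have "(\<integral>\<^sup>+y. indicator C (y - x) \<partial>\<mu>) = (\<integral>\<^sup>+y. indicator {y. y - x \<in> C} y \<partial>\<mu>)"
      by (intro nn_integral_cong) (simp add: indicator_def)
    also have "\<dots> = emeasure \<mu> {y. y - x \<in> C}" by (rule nn_integral_indicator) measurable
    also have "\<dots> = ennreal (modular \<mu> x) * emeasure \<mu> C"
      using emeasure_right[of C x] by (simp add: eq)
    finally show ?thesis
      using C0 C1 modular_pos[of x] by (simp add: ennreal_mult_divide_eq)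
  qed
  then have "modular \<mu> = (\<lambda>x. enn2real ((\<integral>\<^sup>+y. indicator C (y - x) \<partial>\<mu>) / emeasure \<mu> C))" by blast
  also have "\<dots> \<in> borel_measurable borel" by measurable
  finally show ?thesis .
qed

text \<open>Uniqueness of Haar measure with both measures equal to \<open>\<mu>\<close>, applied to
  the reflected function: the denominator is the measure of C y, that is \<Delta>(y) times the
  measure of C.\<close>

lemma nn_integral_inverse:
  assumes [measurable]: "f \<in> borel_measurable borel"
  shows "(\<integral>\<^sup>+y. f (- y) \<partial>\<mu>) = (\<integral>\<^sup>+y. f y * ennreal (1 / modular \<mu> y) \<partial>\<mu>)"
proof -
  obtain C :: "'g set" where C: "unit_nbhd C" by (rule unit_nbhd_exists)
  then have [measurable]: "C \<in> sets borel" by (simp add: unit_nbhd_def)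
  have C0: "emeasure \<mu> C \<noteq> top" using C emeasure_compact by (auto simp: unit_nbhd_def less_top)
  have "0 < emeasure \<mu> (interior C)" using C by (intro emeasure_open) (auto simp: unit_nbhd_def)
  also have "\<dots> \<le> emeasure \<mu> C" using interior_subset by (intro emeasure_mono) auto
  finally have C1: "emeasure \<mu> C \<noteq> 0" by simp
  have eq: "f y / emeasure \<mu> {t. t - y \<in> C} = f y * ennreal (1 / modular \<mu> y) / emeasure \<mu> C" for y
  proof -
    have im: "{t. t - y \<in> C} = (\<lambda>t. t + y) ` C"
      by (auto simp: image_add_right)
    have "inverse (ennreal (modular \<mu> y)) = ennreal (1 / modular \<mu> y)"
      by (simp add: inverse_ennreal modular_pos divide_inverse)
    moreover have "inverse (ennreal (modular \<mu> y) * emeasure \<mu> C)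
        = inverse (ennreal (modular \<mu> y)) * inverse (emeasure \<mu> C)"
      using C0 C1 modular_pos[of y] by (intro ennreal_inverse_mult) (auto simp: less_top)
    ultimately show ?thesis
      using emeasure_right[of C y] by (simp add: divide_ennreal_def im mult_ac)
  qed
  have "(\<integral>\<^sup>+y. f (- y) \<partial>\<mu>) = emeasure \<mu> C * (\<integral>\<^sup>+y. f y / emeasure \<mu> {t. t - y \<in> C} \<partial>\<mu>)"
    using haar_uniqueness[OF haar C, of "\<lambda>y. f (- y)"] by simp
  also have "\<dots> = emeasure \<mu> C * ((\<integral>\<^sup>+y. f y * ennreal (1 / modular \<mu> y) \<partial>\<mu>) / emeasure \<mu> C)"
    unfolding eq by (subst nn_integral_divide) auto
  also have "\<dots> = (\<integral>\<^sup>+y. f y * ennreal (1 / modular \<mu> y) \<partial>\<mu>)"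
    using ennreal_divide_mult_cancel[OF C1 C0, of _ 1] by (simp add: mult.commute)
  finally show ?thesis .
qed

end

section \<open>Weighted convolution inequalities\<close>

abbreviation cnorm :: "('a \<Rightarrow> complex) \<Rightarrow> 'a \<Rightarrow> ennreal" where
  "cnorm f \<equiv> \<lambda>x. ennreal (cmod (f x))"

text \<open>Valid for every f, since a divergent Bochner integral has the value 0.\<close>

lemma ennreal_norm_integral_le:
  fixes f :: "'a \<Rightarrow> complex"
  shows "ennreal (cmod (\<integral>x. f x \<partial>M)) \<le> (\<integral>\<^sup>+x. cnorm f x \<partial>M)"
  by (cases "integrable M f") (auto simp: not_integrable_integral_eq intro: integral_norm_bound_ennreal)

lemma integrable_iff_cnorm:
  fixes f :: "'a \<Rightarrow> complex"
  assumes "f \<in> borel_measurable M"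
  shows "integrable M f \<longleftrightarrow> (\<integral>\<^sup>+x. cnorm f x \<partial>M) < top"
  using assms by (simp add: integrable_iff_bounded)

text \<open>Young's inequality with the factors 1/r and 1/q enlarged to 1; it serves finiteness and
  boundedness.\<close>

lemma ennreal_mult_le_epow:
  fixes a b :: ennreal
  assumes r: "1 < r" shows "a * b \<le> epow r a + epow (r / (r - 1)) b"
proof (cases a; cases b)
  fix x y assume xy: "0 \<le> x" "a = ennreal x" "0 \<le> y" "b = ennreal y"
  define q where "q = r / (r - 1)"
  have q: "1 < q" "1 / r + 1 / q = 1" using r by (auto simp: q_def field_simps)
  have "x * y \<le> x powr r / r + y powr q / q"
    using xy q r by (intro Youngs_inequality) auto
  also have "\<dots> \<le> x powr r + y powr q"
    using r q by (intro add_mono) (auto simp: divide_le_eq mult_le_cancel_left1)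
  finally show ?thesis
    using xy by (simp add: epow_ennreal ennreal_mult[symmetric] ennreal_plus[symmetric] q_def del: ennreal_plus)
qed auto

context haar_group
begin

text \<open>Applied to moduli, its finiteness at x expresses absolute convergence of
  \<open>conv\<close> at x.\<close>

definition nconv :: "('g \<Rightarrow> ennreal) \<Rightarrow> ('g \<Rightarrow> ennreal) \<Rightarrow> 'g \<Rightarrow> ennreal" where
  "nconv f g x = (\<integral>\<^sup>+y. f y * g (- y + x) \<partial>\<mu>)"

text \<open>The p-th power of the weighted norm, equal to top for functions outside the space.
  Leaving out the root lets Tonelli act directly.\<close>

definition enr :: "real \<Rightarrow> ('g \<Rightarrow> real) \<Rightarrow> ('g \<Rightarrow> ennreal) \<Rightarrow> ennreal" where
  "enr p v h = (\<integral>\<^sup>+x. epow p (ennreal (v x) * h x) \<partial>\<mu>)"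

lemma measurable_nconv [measurable]:
  assumes [measurable]: "f \<in> borel_measurable borel" "g \<in> borel_measurable borel"
  shows "nconv f g \<in> borel_measurable borel"
  unfolding nconv_def by measurable

lemma measurable_conv [measurable]:
  assumes [measurable]: "f \<in> borel_measurable borel" "g \<in> borel_measurable borel"
  shows "conv \<mu> f g \<in> borel_measurable borel"
  unfolding conv_def by measurable

lemma enr_mono:
  assumes "0 < p" "\<And>x. g x \<le> h x" shows "enr p v g \<le> enr p v h"
  unfolding enr_def using assms
  by (intro nn_integral_mono epow_mono mult_left_mono) auto

lemma enr_mono_AE:
  assumes "0 < p" "AE x in \<mu>. g x \<le> h x" shows "enr p v g \<le> enr p v h"
  unfolding enr_def
proof (rule nn_integral_mono_AE, use assms(2) in eventually_elim)
  case (elim x)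
  then show ?case using assms by (intro epow_mono mult_left_mono) auto
qed

lemma enr_cmult:
  assumes [measurable]: "v \<in> borel_measurable borel" "h \<in> borel_measurable borel"
  shows "enr p v (\<lambda>x. c * h x) = epow p c * enr p v h"
proof -
  have "ennreal (v x) * (c * h x) = c * (ennreal (v x) * h x)" for x by (simp add: mult_ac)
  then show ?thesis unfolding enr_def by (simp add: epow_mult nn_integral_cmult)
qed

lemma enr_add_le:
  assumes "0 < p" and [measurable]: "v \<in> borel_measurable borel" "f \<in> borel_measurable borel" "g \<in> borel_measurable borel"
    and "AE x in \<mu>. h x \<le> f x + g x"
  shows "enr p v h \<le> ennreal (2 powr p) * (enr p v f + enr p v g)"
  unfolding enr_def
proof (rule epow_add_AE_le)
  show "AE x in \<mu>. ennreal (v x) * h x \<le> ennreal (v x) * f x + ennreal (v x) * g x"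
    using assms(5) by eventually_elim (simp add: distrib_left[symmetric] mult_left_mono)
qed (use assms in measurable)

lemma Lpw_iff:
  assumes [measurable]: "v \<in> borel_measurable borel" and v: "\<And>x. 0 \<le> v x"
  shows "f \<in> Lpw \<mu> p v \<longleftrightarrow> f \<in> borel_measurable borel \<and> enr p v (cnorm f) < top"
proof -
  have m: "f \<in> borel_measurable \<mu> \<longleftrightarrow> f \<in> borel_measurable borel"
    by (simp add: measurable_def)
  show ?thesis
  proof (cases "f \<in> borel_measurable borel")
    case True
    note [measurable] = True
    have "integrable \<mu> (\<lambda>x. (v x * cmod (f x)) powr p) \<longleftrightarrow> enr p v (cnorm f) < top"
      unfolding enr_def integrable_iff_bounded
      using v by (simp add: epow_ennreal ennreal_mult[symmetric])
    then show ?thesis using True by (simp add: Lpw_def m)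
  qed (simp add: Lpw_def m)
qed

lemma Lpw_norm_eq:
  assumes [measurable]: "v \<in> borel_measurable borel" "f \<in> borel_measurable borel" and v: "\<And>x. 0 \<le> v x"
  shows "Lpw_norm \<mu> p v f = enn2real (enr p v (cnorm f)) powr (1 / p)"
proof -
  have "(\<integral>x. (v x * cmod (f x)) powr p \<partial>\<mu>) = enn2real (enr p v (cnorm f))"
    unfolding enr_def using v
    by (subst integral_eq_nn_integral) (auto simp: epow_ennreal ennreal_mult[symmetric])
  then show ?thesis by (simp add: Lpw_norm_def)
qed

lemma Lpw_enorm_p_eq:
  assumes "\<And>x. 0 \<le> v x"
  shows "Lpw_enorm_p \<mu> p v f = enr p v (\<lambda>x. ennreal \<bar>f x\<bar>)"
  unfolding Lpw_enorm_p_def enr_def using assms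
  by (simp add: epow_ennreal ennreal_mult[symmetric])

lemma nconv_assoc:
  assumes [measurable]: "f \<in> borel_measurable borel" "g \<in> borel_measurable borel" "h \<in> borel_measurable borel"
  shows "nconv (nconv f g) h x = nconv f (nconv g h) x"
proof -
  interpret P: pair_sigma_finite \<mu> \<mu> ..
  have "nconv (nconv f g) h x = (\<integral>\<^sup>+z. \<integral>\<^sup>+y. f y * g (- y + z) * h (- z + x) \<partial>\<mu> \<partial>\<mu>)"
    unfolding nconv_def by (intro nn_integral_cong nn_integral_multc[symmetric]) measurable
  also have "\<dots> = (\<integral>\<^sup>+y. \<integral>\<^sup>+z. f y * g (- y + z) * h (- z + x) \<partial>\<mu> \<partial>\<mu>)"
    by (rule P.Fubini'[symmetric]) measurable
  also have "\<dots> = nconv f (nconv g h) x"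
    unfolding nconv_def
  proof (rule nn_integral_cong)
    fix y
    have "(\<integral>\<^sup>+z. f y * g (- y + z) * h (- z + x) \<partial>\<mu>) = (\<integral>\<^sup>+z. f y * (g (- y + z) * h (- z + x)) \<partial>\<mu>)"
      by (simp add: mult.assoc)
    also have "\<dots> = f y * (\<integral>\<^sup>+z. g (- y + z) * h (- z + x) \<partial>\<mu>)"
      by (rule nn_integral_cmult) measurable
    also have "(\<integral>\<^sup>+z. g (- y + z) * h (- z + x) \<partial>\<mu>) = (\<integral>\<^sup>+z. g z * h (- z + (- y + x)) \<partial>\<mu>)"
      using nn_integral_left[of "\<lambda>z. g (- y + z) * h (- z + x)" y]
      by (simp add: add.assoc[symmetric] minus_add)
    finally show "(\<integral>\<^sup>+z. f y * g (- y + z) * h (- z + x) \<partial>\<mu>) = f y * (\<integral>\<^sup>+z. g z * h (- z + (- y + x)) \<partial>\<mu>)" .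
  qed
  finally show ?thesis .
qed

text \<open>Fubini needs absolute convergence only at the point x in question, so the identity is
  available pointwise wherever the threefold convolution of moduli is finite.\<close>

lemma conv_assoc:
  assumes [measurable]: "f \<in> borel_measurable borel" "g \<in> borel_measurable borel" "h \<in> borel_measurable borel"
    and fin: "nconv (nconv (cnorm f) (cnorm g)) (cnorm h) x < top"
  shows "conv \<mu> (conv \<mu> f g) h x = conv \<mu> f (conv \<mu> g h) x"
proof -
  interpret P: pair_sigma_finite \<mu> \<mu> ..
  let ?F = "\<lambda>z y. f y * g (- y + z) * h (- z + x)"
  have "(\<integral>\<^sup>+z. \<integral>\<^sup>+y. cnorm (?F z) y \<partial>\<mu> \<partial>\<mu>) = nconv (nconv (cnorm f) (cnorm g)) (cnorm h) x"
    unfolding nconv_def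
    by (simp add: norm_mult ennreal_mult nn_integral_multc)
  then have int: "integrable (\<mu> \<Otimes>\<^sub>M \<mu>) (\<lambda>(z, y). ?F z y)"
    using fin by (subst integrable_iff_cnorm) (auto simp: nn_integral_fst[symmetric] split_beta')
  have "conv \<mu> (conv \<mu> f g) h x = (\<integral>z. \<integral>y. ?F z y \<partial>\<mu> \<partial>\<mu>)"
    unfolding conv_def by simp
  also have "\<dots> = (\<integral>y. \<integral>z. ?F z y \<partial>\<mu> \<partial>\<mu>)"
    by (rule P.Fubini_integral[OF int, symmetric])
  also have "\<dots> = conv \<mu> f (conv \<mu> g h) x"
    unfolding conv_def
  proof (rule Bochner_Integration.integral_cong[OF refl])
    fix y
    have "(\<integral>z. ?F z y \<partial>\<mu>) = f y * (\<integral>z. g (- y + z) * h (- z + x) \<partial>\<mu>)"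
      by (simp add: mult.assoc)
    also have "(\<integral>z. g (- y + z) * h (- z + x) \<partial>\<mu>) = (\<integral>z. g z * h (- z + (- y + x)) \<partial>\<mu>)"
      using integral_left[of "\<lambda>z. g (- y + z) * h (- z + x)" y]
      by (simp add: add.assoc[symmetric] minus_add)
    finally show "(\<integral>z. ?F z y \<partial>\<mu>) = f y * (\<integral>z. g z * h (- z + (- y + x)) \<partial>\<mu>)" .
  qed
  finally show ?thesis .
qed

lemma cnorm_conv_le: "cnorm (conv \<mu> f g) x \<le> nconv (cnorm f) (cnorm g) x"
  unfolding conv_def nconv_def
  using ennreal_norm_integral_le[of \<mu> "\<lambda>y. f y * g (- y + x)"] by (simp add: norm_mult ennreal_mult)

text \<open>A left translation removes x, and what remains is inversion. This is where 1/\<Delta>,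
  and with it the second weighted norm in C_U, arises.\<close>

lemma nn_integral_reflect:
  assumes [measurable]: "f \<in> borel_measurable borel"
  shows "(\<integral>\<^sup>+y. f (- y + x) \<partial>\<mu>) = (\<integral>\<^sup>+y. f y * ennreal (1 / modular \<mu> y) \<partial>\<mu>)"
  using nn_integral_left[of "\<lambda>y. f (- y + x)" x] nn_integral_inverse[of f]
  by (simp add: minus_add add.assoc)

end

section \<open>Weights, Young's inequality and Schur's test\<close>

locale weighted_group = haar_group \<mu>
  for \<mu> :: "'g::{group_add, topological_space, t2_space, second_countable_topology} measure" +
  fixes w :: "'g \<Rightarrow> real"
  assumes wt: "weight w"
begin

lemma measurable_w [measurable]: "w \<in> borel_measurable borel"
  using wt by (auto simp: weight_def intro: borel_measurable_continuous_onI)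

lemma w_pos: "0 < w x" and w_plus: "w (x + y) \<le> w x * w y" and w_minus [simp]: "w (- x) = w x"
  using wt by (auto simp: weight_def)

lemma w_nonneg [simp]: "0 \<le> w x"
  using w_pos[of x] by simp

text \<open>1 \<le> w(e) \<le> w(x) w(x^{-1}) = w(x)^2 by submultiplicativity and symmetry. Weighted
  norms therefore dominate unweighted ones.\<close>

lemma w_ge_1: "1 \<le> w x"
proof -
  have "w (0 + 0) \<le> w 0 * w 0" by (rule w_plus)
  then have 0: "1 \<le> w 0" using w_pos[of 0] by simp
  also have "w 0 \<le> w x * w x" using w_plus[of x "- x"] by simp
  finally show ?thesis
    using w_pos[of x] by (metis less_le_not_le linorder_not_le mult_le_one mult_less_cancel_left_pos
        order.strict_trans1 mult.right_neutral)
qed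

lemma w_split: "w x \<le> w y * w (- y + x)"
  using w_plus[of y "- y + x"] by (simp add: add.assoc[symmetric])

context
  fixes m assumes m: "moderate w m"
begin

lemma measurable_moderate [measurable]: "m \<in> borel_measurable borel"
  using m by (auto simp: moderate_def intro: borel_measurable_continuous_onI)

lemma moderate_pos: "0 < m x"
  and moderate_le_right: "m (x + y) \<le> m x * w y"
  using m by (auto simp: moderate_def)

lemma moderate_nonneg [simp]: "0 \<le> m x"
  using moderate_pos[of x] by simp

lemma moderate_split: "m x \<le> m y * w (- y + x)"
  using moderate_le_right[of y "- y + x"] by (simp add: add.assoc[symmetric])

text \<open>From m(e) \<le> m(x) w(x^{-1}). The dual weight 1/m is thus dominated by a multiple of
  w, so elements of S_w can be paired with L_{r,m} for every moderate m.\<close>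

lemma inverse_moderate_le: "1 / m x \<le> w x / m 0"
  using moderate_le_right[of x "- x"] moderate_pos[of x] moderate_pos[of 0] by (simp add: field_simps)

end

text \<open>Jensen in y with density w f, after splitting w(x) \<le> w(y) w(y^{-1} x). The
  integrable factor stands on the left, so only left invariance enters and no \<Delta>
  appears.\<close>

lemma young_left:
  assumes p: "1 < p" and [measurable]: "f \<in> borel_measurable borel" "g \<in> borel_measurable borel"
  shows "enr p w (nconv f g) \<le> epow p (\<integral>\<^sup>+y. ennreal (w y) * f y \<partial>\<mu>) * enr p w g"
proof -
  interpret P: pair_sigma_finite \<mu> \<mu> ..
  define A where "A = (\<integral>\<^sup>+y. ennreal (w y) * f y \<partial>\<mu>)"
  let ?k = "\<lambda>y. ennreal (w y) * f y" and ?h = "\<lambda>y. ennreal (w y) * g y"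
  have "epow p (ennreal (w x) * nconv f g x)
      \<le> epow (p - 1) A * (\<integral>\<^sup>+y. ?k y * epow p (?h (- y + x)) \<partial>\<mu>)" for x
  proof -
    have "ennreal (w x) * nconv f g x = (\<integral>\<^sup>+y. ennreal (w x) * (f y * g (- y + x)) \<partial>\<mu>)"
      unfolding nconv_def by (rule nn_integral_cmult[symmetric]) measurable
    also have "\<dots> \<le> (\<integral>\<^sup>+y. ?k y * ?h (- y + x) \<partial>\<mu>)"
    proof (rule nn_integral_mono)
      fix y
      have "ennreal (w x) \<le> ennreal (w y) * ennreal (w (- y + x))"
        using w_split[of x y] by (simp add: ennreal_mult[symmetric])
      from mult_right_mono[OF this, of "f y * g (- y + x)"]
      show "ennreal (w x) * (f y * g (- y + x)) \<le> ?k y * ?h (- y + x)" by (simp add: mult_ac)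
    qed
    finally have "epow p (ennreal (w x) * nconv f g x) \<le> epow p (\<integral>\<^sup>+y. ?k y * ?h (- y + x) \<partial>\<mu>)"
      using p by (intro epow_mono) auto
    also have "\<dots> \<le> epow (p - 1) A * (\<integral>\<^sup>+y. ?k y * epow p (?h (- y + x)) \<partial>\<mu>)"
      unfolding A_def by (rule nn_integral_jensen[OF p]) measurable
    finally show ?thesis .
  qed
  then have "enr p w (nconv f g) \<le> (\<integral>\<^sup>+x. epow (p - 1) A * (\<integral>\<^sup>+y. ?k y * epow p (?h (- y + x)) \<partial>\<mu>) \<partial>\<mu>)"
    unfolding enr_def by (intro nn_integral_mono)
  also have "\<dots> = epow (p - 1) A * (\<integral>\<^sup>+x. \<integral>\<^sup>+y. ?k y * epow p (?h (- y + x)) \<partial>\<mu> \<partial>\<mu>)"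
    by (rule nn_integral_cmult) measurable
  also have "(\<integral>\<^sup>+x. \<integral>\<^sup>+y. ?k y * epow p (?h (- y + x)) \<partial>\<mu> \<partial>\<mu>)
      = (\<integral>\<^sup>+y. \<integral>\<^sup>+x. ?k y * epow p (?h (- y + x)) \<partial>\<mu> \<partial>\<mu>)"
    by (rule P.Fubini'[symmetric]) measurable
  also have "\<dots> = (\<integral>\<^sup>+y. ?k y * enr p w g \<partial>\<mu>)"
  proof (rule nn_integral_cong)
    fix y
    have "(\<integral>\<^sup>+x. ?k y * epow p (?h (- y + x)) \<partial>\<mu>) = ?k y * (\<integral>\<^sup>+x. epow p (?h (- y + x)) \<partial>\<mu>)"
      by (rule nn_integral_cmult) measurable
    also have "(\<integral>\<^sup>+x. epow p (?h (- y + x)) \<partial>\<mu>) = enr p w g"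
      unfolding enr_def by (rule nn_integral_left) measurable
    finally show "(\<integral>\<^sup>+x. ?k y * epow p (?h (- y + x)) \<partial>\<mu>) = ?k y * enr p w g" .
  qed
  also have "\<dots> = A * enr p w g" unfolding A_def by (rule nn_integral_multc) measurable
  also have "epow (p - 1) A * (A * enr p w g) = epow p A * enr p w g"
    using epow_add[of "p - 1" 1 A] by (simp add: mult.assoc)
  finally show ?thesis by (simp add: A_def)
qed

text \<open>Schur's test for the kernel (w g)(y^{-1} x). Its integral in y is A by reflection, with
  1/\<Delta>; its integral in x is B by left invariance. After an r-th root the constant is
  A^(1-1/r) B^(1/r), which C_U dominates when g is the oscillation.\<close>

lemma schur_right:
  assumes r: "1 < r" and m: "moderate w m"
    and [measurable]: "f \<in> borel_measurable borel" "g \<in> borel_measurable borel"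
  shows "enr r m (nconv f g) \<le> epow (r - 1) (\<integral>\<^sup>+y. ennreal (w y / modular \<mu> y) * g y \<partial>\<mu>)
    * (\<integral>\<^sup>+y. ennreal (w y) * g y \<partial>\<mu>) * enr r m f"
proof -
  interpret P: pair_sigma_finite \<mu> \<mu> ..
  note [measurable] = measurable_moderate[OF m]
  note [simp] = moderate_nonneg[OF m]
  define A where "A = (\<integral>\<^sup>+y. ennreal (w y / modular \<mu> y) * g y \<partial>\<mu>)"
  define B where "B = (\<integral>\<^sup>+y. ennreal (w y) * g y \<partial>\<mu>)"
  let ?k = "\<lambda>y. ennreal (w y) * g y" and ?h = "\<lambda>y. ennreal (m y) * f y"
  have A_eq: "(\<integral>\<^sup>+y. ?k (- y + x) \<partial>\<mu>) = A" for x
  proof -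
    have "(\<integral>\<^sup>+y. ?k (- y + x) \<partial>\<mu>) = (\<integral>\<^sup>+y. ?k y * ennreal (1 / modular \<mu> y) \<partial>\<mu>)"
      by (rule nn_integral_reflect) measurable
    also have "\<dots> = A" unfolding A_def
      using modular_pos by (intro nn_integral_cong) (simp add: mult_ac less_imp_le ennreal_mult'[symmetric])
    finally show ?thesis .
  qed
  have "epow r (ennreal (m x) * nconv f g x)
      \<le> epow (r - 1) A * (\<integral>\<^sup>+y. ?k (- y + x) * epow r (?h y) \<partial>\<mu>)" for x
  proof -
    have "ennreal (m x) * nconv f g x = (\<integral>\<^sup>+y. ennreal (m x) * (f y * g (- y + x)) \<partial>\<mu>)"
      unfolding nconv_def by (rule nn_integral_cmult[symmetric]) measurable
    also have "\<dots> \<le> (\<integral>\<^sup>+y. ?k (- y + x) * ?h y \<partial>\<mu>)"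
    proof (rule nn_integral_mono)
      fix y
      have "ennreal (m x) \<le> ennreal (m y) * ennreal (w (- y + x))"
        using moderate_split[OF m, of x y] by (simp add: ennreal_mult[symmetric])
      from mult_right_mono[OF this, of "f y * g (- y + x)"]
      show "ennreal (m x) * (f y * g (- y + x)) \<le> ?k (- y + x) * ?h y" by (simp add: mult_ac)
    qed
    finally have "epow r (ennreal (m x) * nconv f g x) \<le> epow r (\<integral>\<^sup>+y. ?k (- y + x) * ?h y \<partial>\<mu>)"
      using r by (intro epow_mono) auto
    also have "\<dots> \<le> epow (r - 1) (\<integral>\<^sup>+y. ?k (- y + x) \<partial>\<mu>) * (\<integral>\<^sup>+y. ?k (- y + x) * epow r (?h y) \<partial>\<mu>)"
      by (rule nn_integral_jensen[OF r]) measurable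
    finally show ?thesis by (simp only: A_eq)
  qed
  then have "enr r m (nconv f g) \<le> (\<integral>\<^sup>+x. epow (r - 1) A * (\<integral>\<^sup>+y. ?k (- y + x) * epow r (?h y) \<partial>\<mu>) \<partial>\<mu>)"
    unfolding enr_def by (intro nn_integral_mono)
  also have "\<dots> = epow (r - 1) A * (\<integral>\<^sup>+x. \<integral>\<^sup>+y. ?k (- y + x) * epow r (?h y) \<partial>\<mu> \<partial>\<mu>)"
    by (rule nn_integral_cmult) measurable
  also have "(\<integral>\<^sup>+x. \<integral>\<^sup>+y. ?k (- y + x) * epow r (?h y) \<partial>\<mu> \<partial>\<mu>)
      = (\<integral>\<^sup>+y. \<integral>\<^sup>+x. ?k (- y + x) * epow r (?h y) \<partial>\<mu> \<partial>\<mu>)"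
    by (rule P.Fubini'[symmetric]) measurable
  also have "\<dots> = (\<integral>\<^sup>+y. B * epow r (?h y) \<partial>\<mu>)"
  proof (rule nn_integral_cong)
    fix y
    have "(\<integral>\<^sup>+x. ?k (- y + x) * epow r (?h y) \<partial>\<mu>) = (\<integral>\<^sup>+x. ?k (- y + x) \<partial>\<mu>) * epow r (?h y)"
      by (rule nn_integral_multc) measurable
    also have "(\<integral>\<^sup>+x. ?k (- y + x) \<partial>\<mu>) = B"
      unfolding B_def by (rule nn_integral_left) measurable
    finally show "(\<integral>\<^sup>+x. ?k (- y + x) * epow r (?h y) \<partial>\<mu>) = B * epow r (?h y)" .
  qed
  also have "\<dots> = B * enr r m f" unfolding enr_def by (rule nn_integral_cmult) measurable
  finally show ?thesis by (simp add: A_def B_def mult.assoc)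
qed

text \<open>Young's inequality with exponents \<open>1/a + 1/a = 1 + 1/s\<close>: for \<open>P = G(y) G(y\<inverse>x)\<close>
  apply Jensen to \<open>P = P\<^bsup>a/2\<^esup> P\<^bsup>1 - a/2\<^esup>\<close>, where \<open>a/2 + s (1 - a/2) = a\<close>.\<close>

lemma young_self:
  assumes s: "1 < s" and [measurable]: "g \<in> borel_measurable borel"
    and sym: "\<And>x. g (- x) = g x" and fin: "enr (2 * s / (s + 1)) w g < top"
  shows "enr s w (nconv g g) < top"
proof -
  interpret P: pair_sigma_finite \<mu> \<mu> ..
  define a where "a = 2 * s / (s + 1)"
  have as: "a * s + a = 2 * s"
  proof -
    have "a * (s + 1) = 2 * s" using s by (simp add: a_def)
    then show ?thesis by (simp add: distrib_left)
  qed
  then have a: "a / 2 + s * (1 - a / 2) = a" by (simp add: algebra_simps)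
  define E where "E = enr a w g"
  have E: "E < top" using fin by (simp add: E_def a_def)
  let ?G = "\<lambda>y. ennreal (w y) * g y"
  let ?P = "\<lambda>x y. ?G y * ?G (- y + x)"
  have G_sym: "?G (- x) = ?G x" for x by (simp add: sym)
  \<comment> \<open>Symmetry of g and w turns the reflected argument into a left translate, so the
    integral is E with no modular factor.\<close>
  have Gint: "(\<integral>\<^sup>+y. epow a (?G (- y + x)) \<partial>\<mu>) = E" for x
  proof -
    have "?G (- y + x) = ?G (- x + y)" for y
      using G_sym[of "- y + x"] by (simp add: minus_add)
    then have "(\<integral>\<^sup>+y. epow a (?G (- y + x)) \<partial>\<mu>) = (\<integral>\<^sup>+y. epow a (?G (- x + y)) \<partial>\<mu>)" by simp
    also have "\<dots> = E" unfolding E_def enr_def by (rule nn_integral_left) measurable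
    finally show ?thesis .
  qed
  \<comment> \<open>P^(a/2) is a product of two factors whose squares both have integral E; p q
    \<le> p^2 + q^2 bounds its integral uniformly in x.\<close>
  have k: "(\<integral>\<^sup>+y. epow (a / 2) (?P x y) \<partial>\<mu>) \<le> E + E" for x
  proof -
    have "epow (a / 2) (?P x y) \<le> epow a (?G y) + epow a (?G (- y + x))" for y
    proof -
      have "epow (a / 2) (?G y) * epow (a / 2) (?G (- y + x)) \<le>
         epow 2 (epow (a / 2) (?G y)) + epow (2 / (2 - 1)) (epow (a / 2) (?G (- y + x)))"
        by (rule ennreal_mult_le_epow) simp
      then show ?thesis by (simp add: epow_mult epow_epow)
    qed
    then have "(\<integral>\<^sup>+y. epow (a / 2) (?P x y) \<partial>\<mu>) \<le> (\<integral>\<^sup>+y. epow a (?G y) + epow a (?G (- y + x)) \<partial>\<mu>)"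
      by (intro nn_integral_mono)
    also have "\<dots> = E + E"
      by (subst nn_integral_add) (auto simp: Gint, simp add: E_def enr_def)
    finally show ?thesis .
  qed
  have "epow s (ennreal (w x) * nconv g g x) \<le> epow (s - 1) (E + E) * (\<integral>\<^sup>+y. epow a (?P x y) \<partial>\<mu>)" for x
  proof -
    have "ennreal (w x) * nconv g g x = (\<integral>\<^sup>+y. ennreal (w x) * (g y * g (- y + x)) \<partial>\<mu>)"
      unfolding nconv_def by (rule nn_integral_cmult[symmetric]) measurable
    also have "\<dots> \<le> (\<integral>\<^sup>+y. ?P x y \<partial>\<mu>)"
    proof (rule nn_integral_mono)
      fix y
      have "ennreal (w x) \<le> ennreal (w y) * ennreal (w (- y + x))"
        using w_split[of x y] by (simp add: ennreal_mult[symmetric])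
      from mult_right_mono[OF this, of "g y * g (- y + x)"]
      show "ennreal (w x) * (g y * g (- y + x)) \<le> ?P x y" by (simp add: mult_ac)
    qed
    also have "\<dots> = (\<integral>\<^sup>+y. epow (a / 2) (?P x y) * epow (1 - a / 2) (?P x y) \<partial>\<mu>)"
      by (simp add: epow_add[symmetric])
    finally have "epow s (ennreal (w x) * nconv g g x) \<le>
        epow s (\<integral>\<^sup>+y. epow (a / 2) (?P x y) * epow (1 - a / 2) (?P x y) \<partial>\<mu>)"
      using s by (intro epow_mono) auto
    also have "\<dots> \<le> epow (s - 1) (\<integral>\<^sup>+y. epow (a / 2) (?P x y) \<partial>\<mu>)
        * (\<integral>\<^sup>+y. epow (a / 2) (?P x y) * epow s (epow (1 - a / 2) (?P x y)) \<partial>\<mu>)"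
      by (rule nn_integral_jensen[OF s]) measurable
    also have "(\<lambda>y. epow (a / 2) (?P x y) * epow s (epow (1 - a / 2) (?P x y))) = (\<lambda>y. epow a (?P x y))"
      using a(1) by (simp add: epow_epow epow_add[symmetric] mult.commute)
    also have "epow (s - 1) (\<integral>\<^sup>+y. epow (a / 2) (?P x y) \<partial>\<mu>) \<le> epow (s - 1) (E + E)"
      using s k by (intro epow_mono) auto
    finally show ?thesis by (simp add: mult_right_mono)
  qed
  then have "enr s w (nconv g g) \<le> (\<integral>\<^sup>+x. epow (s - 1) (E + E) * (\<integral>\<^sup>+y. epow a (?P x y) \<partial>\<mu>) \<partial>\<mu>)"
    unfolding enr_def by (intro nn_integral_mono)
  also have "\<dots> = epow (s - 1) (E + E) * (\<integral>\<^sup>+x. \<integral>\<^sup>+y. epow a (?P x y) \<partial>\<mu> \<partial>\<mu>)"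
    by (rule nn_integral_cmult) measurable
  also have "(\<integral>\<^sup>+x. \<integral>\<^sup>+y. epow a (?P x y) \<partial>\<mu> \<partial>\<mu>) = (\<integral>\<^sup>+y. \<integral>\<^sup>+x. epow a (?P x y) \<partial>\<mu> \<partial>\<mu>)"
    by (rule P.Fubini'[symmetric]) measurable
  also have "\<dots> = (\<integral>\<^sup>+y. epow a (?G y) * E \<partial>\<mu>)"
  proof (rule nn_integral_cong)
    fix y
    have "(\<integral>\<^sup>+x. epow a (?P x y) \<partial>\<mu>) = epow a (?G y) * (\<integral>\<^sup>+x. epow a (?G (- y + x)) \<partial>\<mu>)"
      by (subst nn_integral_cmult[symmetric]) (auto simp: epow_mult)
    also have "(\<integral>\<^sup>+x. epow a (?G (- y + x)) \<partial>\<mu>) = E"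
      unfolding E_def enr_def by (rule nn_integral_left) measurable
    finally show "(\<integral>\<^sup>+x. epow a (?P x y) \<partial>\<mu>) = epow a (?G y) * E" .
  qed
  also have "\<dots> = E * E" by (subst nn_integral_multc) (auto simp: E_def enr_def)
  finally show ?thesis
    using E by (auto simp: ennreal_mult_less_top intro: le_less_trans)
qed

lemma enr_left_translate:
  assumes p: "0 < p" and [measurable]: "g \<in> borel_measurable borel"
  shows "enr p w (\<lambda>y. g (- x + y)) \<le> epow p (ennreal (w x)) * enr p w g"
proof -
  have "enr p w (\<lambda>y. g (- x + y)) \<le> (\<integral>\<^sup>+y. epow p (ennreal (w x)) * epow p (ennreal (w (- x + y)) * g (- x + y)) \<partial>\<mu>)"
    unfolding enr_def
  proof (rule nn_integral_mono)
    fix y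
    have "ennreal (w y) \<le> ennreal (w x) * ennreal (w (- x + y))"
      using w_split[of y x] by (simp add: ennreal_mult[symmetric])
    from mult_right_mono[OF this, of "g (- x + y)"]
    show "epow p (ennreal (w y) * g (- x + y)) \<le> epow p (ennreal (w x)) * epow p (ennreal (w (- x + y)) * g (- x + y))"
      using p by (subst epow_mult[symmetric]) (auto intro!: epow_mono simp: mult.assoc)
  qed
  also have "\<dots> = epow p (ennreal (w x)) * (\<integral>\<^sup>+y. epow p (ennreal (w (- x + y)) * g (- x + y)) \<partial>\<mu>)"
    by (rule nn_integral_cmult) measurable
  also have "(\<integral>\<^sup>+y. epow p (ennreal (w (- x + y)) * g (- x + y)) \<partial>\<mu>) = enr p w g"
    unfolding enr_def by (rule nn_integral_left) measurable
  finally show ?thesis .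
qed

text \<open>Young's inequality for the factors m f and h/m, the latter dominated by a multiple of w
  h. This is the duality between L_{r,m} and the spaces defining S_w, in the qualitative form that
  integrability claims use.\<close>

lemma pairing_finite:
  assumes r: "1 < r" and m: "moderate w m"
    and [measurable]: "f \<in> borel_measurable borel" "h \<in> borel_measurable borel"
    and f: "enr r m f < top" and h: "enr (r / (r - 1)) w h < top"
  shows "(\<integral>\<^sup>+y. f y * h y \<partial>\<mu>) < top"
proof -
  note [measurable] = measurable_moderate[OF m]
  note m0 = moderate_pos[OF m]
  define q where "q = r / (r - 1)"
  have q: "1 < q" using r by (simp add: q_def)
  have "f y * h y \<le> epow r (ennreal (m y) * f y) + epow q (ennreal (1 / m 0)) * epow q (ennreal (w y) * h y)" for y
  proof -
    have "ennreal (m y) * ennreal (1 / m y) = 1"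
      using m0[of y] by (simp add: ennreal_mult'[symmetric])
    then have "f y * h y = (ennreal (m y) * f y) * (ennreal (1 / m y) * h y)"
      by (metis mult.assoc mult.commute mult.left_neutral)
    also have "\<dots> \<le> epow r (ennreal (m y) * f y) + epow q (ennreal (1 / m y) * h y)"
      unfolding q_def by (rule ennreal_mult_le_epow[OF r])
    also have "epow q (ennreal (1 / m y) * h y) \<le> epow q (ennreal (1 / m 0) * (ennreal (w y) * h y))"
    proof (rule epow_mono)
      have "ennreal (1 / m y) \<le> ennreal (1 / m 0) * ennreal (w y)"
        using inverse_moderate_le[OF m, of y] m0[of 0] by (simp add: ennreal_mult[symmetric] ennreal_leI less_imp_le)
      from mult_right_mono[OF this, of "h y"]
      show "ennreal (1 / m y) * h y \<le> ennreal (1 / m 0) * (ennreal (w y) * h y)" by (simp add: mult.assoc)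
    qed (use q in simp)
    finally show ?thesis by (simp add: epow_mult)
  qed
  then have "(\<integral>\<^sup>+y. f y * h y \<partial>\<mu>) \<le>
     (\<integral>\<^sup>+y. epow r (ennreal (m y) * f y) + epow q (ennreal (1 / m 0)) * epow q (ennreal (w y) * h y) \<partial>\<mu>)"
    by (intro nn_integral_mono)
  also have "\<dots> = enr r m f + epow q (ennreal (1 / m 0)) * enr q w h"
    unfolding enr_def by (simp add: nn_integral_add nn_integral_cmult)
  also have "\<dots> < top" using f h by (simp add: q_def ennreal_mult_less_top)
  finally show ?thesis .
qed

text \<open>Symmetry of g makes g(y^{-1} x) a left translate of g, which stays in the dual space at
  the cost of a factor w(x). Hence the convolution is finite at every x, not merely almost
  everywhere.\<close>

lemma nconv_finite:
  assumes r: "1 < r" and m: "moderate w m"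
    and [measurable]: "f \<in> borel_measurable borel" "g \<in> borel_measurable borel"
    and f: "enr r m f < top" and g: "enr (r / (r - 1)) w g < top" and sym: "\<And>x. g (- x) = g x"
  shows "nconv f g x < top"
proof -
  have "g (- y + x) = g (- x + y)" for y using sym[of "- y + x"] by (simp add: minus_add)
  then have "nconv f g x = (\<integral>\<^sup>+y. f y * g (- x + y) \<partial>\<mu>)" by (simp add: nconv_def)
  also have "\<dots> < top"
  proof (rule pairing_finite[OF r m])
    have "enr (r / (r - 1)) w (\<lambda>y. g (- x + y)) \<le> epow (r / (r - 1)) (ennreal (w x)) * enr (r / (r - 1)) w g"
      using r by (intro enr_left_translate) auto
    also have "\<dots> < top" using g by (simp add: ennreal_mult_less_top)
    finally show "enr (r / (r - 1)) w (\<lambda>y. g (- x + y)) < top" .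
  qed (use f in measurable)
  finally show ?thesis .
qed

lemma nconv_symmetric:
  assumes [measurable]: "g \<in> borel_measurable borel" and sym: "\<And>x. g (- x) = g x"
  shows "nconv g g (- x) = nconv g g x"
proof -
  have "nconv g g (- x) = (\<integral>\<^sup>+y. g y * g (- (- x + (x + y)) + - x) \<partial>\<mu>)"
    by (simp add: nconv_def add.assoc[symmetric])
  also have "\<dots> = (\<integral>\<^sup>+y. g (x + y) * g y \<partial>\<mu>)"
  proof (rule nn_integral_cong)
    fix y
    have "g (- y + - x) = g (x + y)" using sym[of "x + y"] by (simp add: minus_add)
    then show "g y * g (- (- x + (x + y)) + - x) = g (x + y) * g y"
      by (simp add: add.assoc[symmetric] mult.commute)
  qed
  also have "\<dots> = (\<integral>\<^sup>+y. g y * g (- x + y) \<partial>\<mu>)"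
    using nn_integral_left[of "\<lambda>y. g y * g (- x + y)" x] by (simp add: add.assoc[symmetric])
  also have "\<dots> = nconv g g x"
  proof -
    have "g (- y + x) = g (- x + y)" for y using sym[of "- y + x"] by (simp add: minus_add)
    then show ?thesis by (simp add: nconv_def)
  qed
  finally show ?thesis .
qed

end

section \<open>The reproducing kernel and the control kernel\<close>

lemma borel_measurable_cnj [measurable]:
  "f \<in> borel_measurable M \<Longrightarrow> (\<lambda>x. cnj (f x)) \<in> borel_measurable M"
  by (rule measurable_compose[OF _ borel_measurable_continuous_onI]) (auto intro!: continuous_intros)

locale coorbit = weighted_group \<mu> w
  for \<mu> :: "'g::{group_add, topological_space, t2_space, second_countable_topology} measure"
    and w :: "'g \<Rightarrow> real" +
  fixes sc :: "complex \<Rightarrow> 'h::ab_group_add \<Rightarrow> 'h"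
    and ip :: "'h \<Rightarrow> 'h \<Rightarrow> complex"
    and \<pi> :: "'g \<Rightarrow> 'h \<Rightarrow> 'h"
    and u :: 'h
    and W :: "'g \<Rightarrow> complex"
    and U :: "'g set"
  assumes H: "hilbert sc ip"
    and rep: "unitary_rep sc ip \<pi>"
    and adm: "admissible \<mu> ip \<pi> u"
    and K_int: "\<forall>p>1. Kf ip \<pi> u \<in> Lpw \<mu> p w"
    and W_cont: "continuous_on UNIV W"
    and W_repr: "conv \<mu> W (Kf ip \<pi> u) = Kf ip \<pi> u"
    and W_max: "\<exists>Q. unit_nbhd Q \<and> maxfun \<mu> Q W \<in> Lpw \<mu> 1 w \<and>
                    maxfun \<mu> Q W \<in> Lpw \<mu> 1 (\<lambda>x. w x / modular \<mu> x)"
    and U: "unit_nbhd U"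
begin

section \<open>The local maximal function and the oscillation of W\<close>

text \<open>A true supremum over the given U, whereas the hypothesis concerns an essential supremum
  over some unrelated Q; \<open>maxW_integrable_aux\<close> passes from one to the other. It
  dominates W at sample points as well as nearby translates of W.\<close>

definition maxW :: "'g \<Rightarrow> real" where
  "maxW x = (SUP q\<in>U. cmod (W (q + x)))"

lemma compact_U: "compact U" and zero_in_U: "0 \<in> U" and U_nonempty: "U \<noteq> {}"
  using U interior_subset by (auto simp: unit_nbhd_def)

lemma measurable_U [measurable]: "U \<in> sets borel"
  by (simp add: compact_U)

lemma measurable_W [measurable]: "W \<in> borel_measurable borel"
  by (rule borel_measurable_continuous_onI[OF W_cont])

lemma continuous_on_W [continuous_intros]:
  "continuous_on S f \<Longrightarrow> continuous_on S (\<lambda>x. W (f x))"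
  using continuous_on_compose2[OF W_cont] by blast

text \<open>Compactness of U bounds the family in q, so the real-valued \<open>SUP\<close> is
  meaningful. Superlevel sets are unions over q of open sets, which gives measurability even when U
  is uncountable.\<close>

lemma sup_over_compact:
  fixes F :: "'g \<Rightarrow> 'g \<Rightarrow> real"
  assumes "\<And>q. continuous_on UNIV (F q)" "\<And>x. continuous_on UNIV (\<lambda>q. F q x)"
  shows le_sup_over_compact: "\<And>q x. q \<in> U \<Longrightarrow> F q x \<le> (SUP q\<in>U. F q x)"
    and measurable_sup_over_compact: "(\<lambda>x. SUP q\<in>U. F q x) \<in> borel_measurable borel"
proof -
  have bdd: "bdd_above ((\<lambda>q. F q x) ` U)" for x
    by (intro bounded_imp_bdd_above compact_imp_bounded compact_continuous_image compact_U
        continuous_on_subset[OF assms(2)]) auto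
  then show "F q x \<le> (SUP q\<in>U. F q x)" if "q \<in> U" for q x
    using that by (intro cSUP_upper)
  show "(\<lambda>x. SUP q\<in>U. F q x) \<in> borel_measurable borel"
  proof (rule borel_measurableI_greater)
    fix a
    have "{x \<in> space borel. a < (SUP q\<in>U. F q x)} = (\<Union>q\<in>U. {x. a < F q x})"
      using less_cSUP_iff[OF U_nonempty bdd] by auto
    moreover have "open (\<Union>q\<in>U. {x. a < F q x})"
      by (intro open_UN ballI open_Collect_less assms continuous_on_const)
    ultimately show "{x \<in> space borel. a < (SUP q\<in>U. F q x)} \<in> sets borel" by simp
  qed
qed

lemma W_le_maxW: "q \<in> U \<Longrightarrow> cmod (W (q + x)) \<le> maxW x"
  unfolding maxW_def
  by (rule le_sup_over_compact) (auto intro!: continuous_intros)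

lemma measurable_maxW [measurable]: "maxW \<in> borel_measurable borel"
  unfolding maxW_def
  by (rule measurable_sup_over_compact) (auto intro!: continuous_intros)

lemma W_le_maxW_self: "cmod (W x) \<le> maxW x"
  using W_le_maxW[OF zero_in_U, of x] by simp

lemma maxW_nonneg [simp]: "0 \<le> maxW x"
  using W_le_maxW_self[of x] norm_ge_zero order_trans by blast

lemma le_osc: "q \<in> U \<Longrightarrow> cmod (W (q + x) - W x) \<le> osc U W x"
  unfolding osc_def
  by (rule le_sup_over_compact) (auto intro!: continuous_intros)

lemma measurable_osc [measurable]: "osc U W \<in> borel_measurable borel"
  unfolding osc_def
  by (rule measurable_sup_over_compact) (auto intro!: continuous_intros)

lemma osc_nonneg [simp]: "0 \<le> osc U W x"
  using le_osc[OF zero_in_U, of x] by simp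

text \<open>An essential supremum over \<open>Qx\<close> dominates a continuous function on the interior,
  since nonempty open sets are not null.\<close>

lemma W_le_maxfun:
  assumes Q: "unit_nbhd Q" and q: "q \<in> interior Q"
  shows "cmod (W (q + x)) \<le> maxfun \<mu> Q W x"
proof -
  define S where "S = (\<lambda>q. q + x) ` Q"
  have cS: "compact S" unfolding S_def
    using Q by (intro compact_continuous_image continuous_intros) (auto simp: unit_nbhd_def)
  then have [measurable]: "S \<in> sets borel" by simp
  define E where "E = esssup (restrict_space \<mu> S) (\<lambda>y. ereal (cmod (W y)))"
  have "AE y in restrict_space \<mu> S. ereal (cmod (W y)) \<le> E"
    unfolding E_def by (rule esssup_AE)
  then have AE: "AE y in \<mu>. y \<in> S \<longrightarrow> ereal (cmod (W y)) \<le> E"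
    by (subst (asm) AE_restrict_space_iff) auto
  have le: "ereal (cmod (W (q + x))) \<le> E"
  proof (rule ccontr)
    assume "\<not> ereal (cmod (W (q + x))) \<le> E"
    define V where "V = ((\<lambda>y. y + - x) -` interior Q) \<inter> {y. E < ereal (cmod (W y))}"
    have "open V" unfolding V_def
      by (intro open_Int open_vimage open_Collect_less continuous_intros) auto
    moreover have "q + x \<in> V"
      using q \<open>\<not> _\<close> by (simp add: V_def add.assoc del: add_uminus_conv_diff)
    ultimately have "0 < emeasure \<mu> V" by (intro emeasure_open) auto
    have "V \<subseteq> S"
      using interior_subset[of Q] by (auto simp: V_def S_def image_add_right)
    with AE have "AE y in \<mu>. y \<notin> V"
      by (auto elim!: eventually_mono simp: V_def not_less)
    moreover have [measurable]: "V \<in> sets borel" using \<open>open V\<close> by simp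
    ultimately have "emeasure \<mu> V = 0"
      using AE_iff_measurable[of V \<mu> "\<lambda>y. y \<notin> V"] by simp
    with \<open>0 < emeasure \<mu> V\<close> show False by simp
  qed
  \<comment> \<open>\<open>real_of_ereal\<close> sends infinity to 0, so the bound transfers only
    once E is known to be finite; compactness of the translate of Q supplies this.\<close>
  have "bounded ((\<lambda>y. cmod (W y)) ` S)"
    by (intro compact_imp_bounded compact_continuous_image cS continuous_intros)
  then obtain c where c: "\<And>y. y \<in> S \<Longrightarrow> cmod (W y) \<le> c"
    unfolding bounded_iff by auto
  have "E \<le> ereal c"
    unfolding E_def
  proof (rule esssup_I)
    show "AE y in restrict_space \<mu> S. ereal (cmod (W y)) \<le> ereal c"
      using c by (intro AE_I2) (simp add: space_restrict_space)
    show "(\<lambda>y. ereal (cmod (W y))) \<in> borel_measurable (restrict_space \<mu> S)"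
      by (intro measurable_restrict_space1) measurable
  qed
  with le have "cmod (W (q + x)) \<le> real_of_ereal E"
    by (cases E) auto
  then show ?thesis by (simp add: maxfun_def E_def S_def)
qed

text \<open>Finitely many translates of the interior of Q cover U, so \<open>maxW\<close> is at most
  a finite sum of translates of the maximal function over Q. By \<open>shift\<close> a translation
  costs a constant factor, a property shared by w and w/\<Delta>.\<close>

lemma maxW_integrable_aux:
  fixes v :: "'g \<Rightarrow> real"
  assumes Q: "unit_nbhd Q" and L: "maxfun \<mu> Q W \<in> Lpw \<mu> 1 v"
    and [measurable]: "v \<in> borel_measurable borel" and v: "\<And>x. 0 \<le> v x"
    and shift: "\<And>a. \<exists>C\<ge>0. \<forall>x. v (- a + x) \<le> C * v x"
  shows "(\<integral>\<^sup>+x. ennreal (v x) * ennreal (maxW x) \<partial>\<mu>) < top"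
proof -
  let ?M = "maxfun \<mu> Q W"
  have M0: "0 \<le> ?M x" for x
  proof -
    have "cmod (W (0 + x)) \<le> ?M x"
      using Q by (intro W_le_maxfun) (auto simp: unit_nbhd_def)
    then show ?thesis by (meson norm_ge_zero order_trans)
  qed
  have "(\<lambda>x. complex_of_real (?M x)) \<in> borel_measurable borel"
    and fin: "enr 1 v (cnorm (\<lambda>x. complex_of_real (?M x))) < top"
    using L v by (auto simp: Lpw_iff comp_def)
  from measurable_compose[OF this(1) borel_measurable_Re] have [measurable]: "?M \<in> borel_measurable borel" by simp
  have fin: "(\<integral>\<^sup>+x. ennreal (v x) * ennreal (?M x) \<partial>\<mu>) < top"
    using fin M0 by (simp add: enr_def)
  have op: "open {q. q + - a \<in> interior Q}" for a
  proof -
    have "open ((\<lambda>q. q + - a) -` interior Q)"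
      by (intro open_vimage continuous_intros) auto
    then show ?thesis by (simp add: vimage_def)
  qed
  have "U \<subseteq> (\<Union>a\<in>U. {q. q + - a \<in> interior Q})"
    using Q by (auto simp: unit_nbhd_def)
  then obtain A where A: "finite A" "U \<subseteq> (\<Union>a\<in>A. {q. q + - a \<in> interior Q})"
    by (rule compactE_image[OF compact_U op])
  have le: "maxW x \<le> (\<Sum>a\<in>A. ?M (a + x))" for x
    unfolding maxW_def
  proof (rule cSUP_least[OF U_nonempty])
    fix q assume "q \<in> U"
    with A(2) have "q \<in> (\<Union>a\<in>A. {q. q + - a \<in> interior Q})" by (rule subsetD)
    then obtain a where "a \<in> A" "q + - a \<in> interior Q" by blast
    then have a: "a \<in> A" "q - a \<in> interior Q" by simp_all
    have "q + x = (q - a) + (a + x)" by (simp add: add.assoc[symmetric])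
    then have "cmod (W (q + x)) \<le> ?M (a + x)" using W_le_maxfun[OF Q a(2)] by metis
    also have "\<dots> \<le> (\<Sum>a\<in>A. ?M (a + x))" using a A M0 by (intro member_le_sum) auto
    finally show "cmod (W (q + x)) \<le> (\<Sum>a\<in>A. ?M (a + x))" .
  qed
  have one: "(\<integral>\<^sup>+x. ennreal (v x) * ennreal (?M (a + x)) \<partial>\<mu>) < top" for a
  proof -
    obtain C where C: "0 \<le> C" "\<And>x. v (- a + x) \<le> C * v x" using shift by blast
    have "(\<integral>\<^sup>+x. ennreal (v x) * ennreal (?M (a + x)) \<partial>\<mu>) = (\<integral>\<^sup>+x. ennreal (v (- a + x)) * ennreal (?M x) \<partial>\<mu>)"
      using nn_integral_left[of "\<lambda>x. ennreal (v (- a + x)) * ennreal (?M x)" a] by (simp add: add.assoc[symmetric])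
    also have "\<dots> \<le> (\<integral>\<^sup>+x. ennreal C * (ennreal (v x) * ennreal (?M x)) \<partial>\<mu>)"
    proof (rule nn_integral_mono)
      fix x
      have "ennreal (v (- a + x)) \<le> ennreal C * ennreal (v x)"
        using C v by (simp add: ennreal_mult[symmetric] ennreal_leI)
      from mult_right_mono[OF this, of "ennreal (?M x)"]
      show "ennreal (v (- a + x)) * ennreal (?M x) \<le> ennreal C * (ennreal (v x) * ennreal (?M x))"
        by (simp add: mult.assoc)
    qed
    also have "\<dots> = ennreal C * (\<integral>\<^sup>+x. ennreal (v x) * ennreal (?M x) \<partial>\<mu>)"
      by (rule nn_integral_cmult) measurable
    also have "\<dots> < top" using fin by (simp add: ennreal_mult_less_top)
    finally show ?thesis .
  qed
  have "(\<integral>\<^sup>+x. ennreal (v x) * ennreal (maxW x) \<partial>\<mu>) \<le> (\<integral>\<^sup>+x. (\<Sum>a\<in>A. ennreal (v x) * ennreal (?M (a + x))) \<partial>\<mu>)"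
  proof (rule nn_integral_mono)
    fix x
    have "ennreal (maxW x) \<le> (\<Sum>a\<in>A. ennreal (?M (a + x)))"
      using le[of x] M0 by (simp add: sum_ennreal ennreal_leI)
    from mult_left_mono[OF this, of "ennreal (v x)"]
    show "ennreal (v x) * ennreal (maxW x) \<le> (\<Sum>a\<in>A. ennreal (v x) * ennreal (?M (a + x)))"
      by (simp add: sum_distrib_left)
  qed
  also have "\<dots> = (\<Sum>a\<in>A. \<integral>\<^sup>+x. ennreal (v x) * ennreal (?M (a + x)) \<partial>\<mu>)"
    by (rule nn_integral_sum) measurable
  also have "\<dots> < top" using A one by (simp add: ennreal_sum_less_top)
  finally show ?thesis .
qed

lemma maxW_integrable: "(\<integral>\<^sup>+x. ennreal (w x) * ennreal (maxW x) \<partial>\<mu>) < top"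
proof -
  obtain Q where Q: "unit_nbhd Q" "maxfun \<mu> Q W \<in> Lpw \<mu> 1 w" using W_max by auto
  show ?thesis
  proof (rule maxW_integrable_aux[OF Q])
    show "\<exists>C\<ge>0. \<forall>x. w (- a + x) \<le> C * w x" for a
      using w_plus[of "- a"] by (intro exI[of _ "w a"]) auto
  qed auto
qed

lemma maxW_integrable_modular: "(\<integral>\<^sup>+x. ennreal (w x / modular \<mu> x) * ennreal (maxW x) \<partial>\<mu>) < top"
proof -
  obtain Q where Q: "unit_nbhd Q" "maxfun \<mu> Q W \<in> Lpw \<mu> 1 (\<lambda>x. w x / modular \<mu> x)" using W_max by auto
  show ?thesis
  proof (rule maxW_integrable_aux[OF Q])
    show "\<exists>C\<ge>0. \<forall>x. w (- a + x) / modular \<mu> (- a + x) \<le> C * (w x / modular \<mu> x)" for a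
    proof (intro exI[of _ "w a / modular \<mu> (- a)"] conjI allI)
      fix x
      have "w (- a + x) / modular \<mu> (- a + x) \<le> w a * w x / modular \<mu> (- a + x)"
        using w_plus[of "- a" x] modular_pos[of "- a + x"] by (intro divide_right_mono) auto
      then show "w (- a + x) / modular \<mu> (- a + x) \<le> w a / modular \<mu> (- a) * (w x / modular \<mu> x)"
        by (simp add: modular_plus)
    qed (simp add: modular_pos less_imp_le)
  qed (use modular_pos in \<open>auto simp: less_imp_le\<close>)
qed

lemma W_integrable: "(\<integral>\<^sup>+x. ennreal (w x) * cnorm W x \<partial>\<mu>) < top"
  by (rule le_less_trans[OF nn_integral_mono maxW_integrable])
     (auto intro!: mult_left_mono ennreal_leI W_le_maxW_self)

lemma W_integrable_modular: "(\<integral>\<^sup>+x. ennreal (w x / modular \<mu> x) * cnorm W x \<partial>\<mu>) < top"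
  by (rule le_less_trans[OF nn_integral_mono maxW_integrable_modular])
     (auto intro!: mult_left_mono ennreal_leI W_le_maxW_self)

section \<open>The voice transform and its reproducing kernel\<close>

abbreviation K :: "'g \<Rightarrow> complex" where "K \<equiv> Kf ip \<pi> u"
abbreviation V :: "'h \<Rightarrow> 'g \<Rightarrow> complex" where "V \<equiv> Vop ip \<pi> u"

lemmas hilbert_conjuncts = H[unfolded hilbert_def]

lemmas sc_one = hilbert_conjuncts[THEN conjunct2, THEN conjunct1, rule_format]
lemmas sc_add_left = hilbert_conjuncts[THEN conjunct2, THEN conjunct2, THEN conjunct2, THEN conjunct1, rule_format]
lemmas ip_add = hilbert_conjuncts[THEN conjunct2, THEN conjunct2, THEN conjunct2, THEN conjunct2, THEN conjunct1, rule_format]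
lemmas ip_sc = hilbert_conjuncts[THEN conjunct2, THEN conjunct2, THEN conjunct2, THEN conjunct2, THEN conjunct2, THEN conjunct1, rule_format]
lemmas ip_cnj = hilbert_conjuncts[THEN conjunct2, THEN conjunct2, THEN conjunct2, THEN conjunct2, THEN conjunct2, THEN conjunct2, THEN conjunct1, rule_format]
lemmas ip_nonneg = hilbert_conjuncts[THEN conjunct2, THEN conjunct2, THEN conjunct2, THEN conjunct2, THEN conjunct2, THEN conjunct2, THEN conjunct2, THEN conjunct1, rule_format, THEN conjunct2]

lemma ip_add_right: "ip z (v + v') = ip z v + ip z v'"
proof -
  have "ip z (v + v') = cnj (ip v z) + cnj (ip v' z)"
    using ip_cnj[of z "v + v'"] by (simp add: ip_add)
  then show ?thesis by (simp only: ip_cnj[symmetric])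
qed

lemma ip_pi: "ip (\<pi> x v) (\<pi> x v') = ip v v'" and pi_zero: "\<pi> 0 v = v"
  and pi_plus: "\<pi> (x + y) v = \<pi> x (\<pi> y v)"
  using rep unfolding unitary_rep_def by auto

lemma sc_zero: "sc 0 v = 0"
  using sc_add_left[of 0 0 v] by simp

lemma V_add: "V (v + v') x = V v x + V v' x" and V_sc: "V (sc a v) x = a * V v x"
  by (simp_all add: Vop_def ip_add ip_sc)

lemma V_zero: "V 0 x = 0"
  using V_sc[of 0 0 x] by (simp add: sc_zero)

lemma sc_minus_one: "sc (- 1) v = - v"
  using sc_add_left[of 1 "- 1" v] by (simp add: sc_one sc_zero eq_neg_iff_add_eq_0 add.commute)

lemma ip_pi_pi: "ip (\<pi> y u) (\<pi> x u) = K (- y + x)"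
proof -
  have "\<pi> x u = \<pi> y (\<pi> (- y + x) u)" by (simp add: pi_plus[symmetric] add.assoc[symmetric])
  then show ?thesis by (simp add: ip_pi Kf_def)
qed

lemma V_pi: "V (\<pi> x u) y = K (- x + y)"
  by (simp add: Vop_def ip_pi_pi)

text \<open>Unitarity moves \<pi>(x^{-1}) to the other side of the inner product. The modulus of K
  is therefore symmetric, as \<open>nconv_finite\<close> and \<open>young_self\<close>
  require.\<close>

lemma K_minus: "K (- x) = cnj (K x)"
  using ip_pi_pi[of x 0] ip_cnj[of "\<pi> x u" "\<pi> 0 u"] by (simp add: pi_zero Kf_def)

lemma K_reflect: "K (- y + x) = cnj (K (- x + y))"
  using K_minus[of "- x + y"] by (simp add: minus_add)

lemma K_sym: "cmod (K (- x)) = cmod (K x)"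
  by (simp add: K_minus)

lemma K_reflect_norm: "cmod (K (- y + x)) = cmod (K (- x + y))"
  by (subst K_reflect) simp

lemma measurable_V [measurable]: "V v \<in> borel_measurable borel"
  using adm Lpw_iff[of "\<lambda>_. 1" "V v" 2] by (auto simp: admissible_def)

lemma measurable_K [measurable]: "K \<in> borel_measurable borel"
  using K_int Lpw_iff[of w K 2] by auto

lemma enr_K: "1 < p \<Longrightarrow> enr p w (cnorm K) < top"
  using K_int Lpw_iff[of w K p] by auto

lemma V_square_integrable: "integrable \<mu> (\<lambda>x. (cmod (V v x))\<^sup>2)"
proof -
  have "V v \<in> Lpw \<mu> 2 (\<lambda>_. 1)" using adm by (simp add: admissible_def)
  then have "integrable \<mu> (\<lambda>x. cmod (V v x) powr 2)" by (simp add: Lpw_def)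
  then show ?thesis by simp
qed

lemma V_product_integrable: "integrable \<mu> (\<lambda>x. V v x * cnj (V z x))"
proof (rule Bochner_Integration.integrable_bound)
  show "integrable \<mu> (\<lambda>x. (cmod (V v x))\<^sup>2 + (cmod (V z x))\<^sup>2)"
    by (intro Bochner_Integration.integrable_add V_square_integrable)
  show "AE x in \<mu>. norm (V v x * cnj (V z x)) \<le> norm ((cmod (V v x))\<^sup>2 + (cmod (V z x))\<^sup>2)"
  proof (rule AE_I2)
    fix x
    have "0 \<le> (cmod (V v x) - cmod (V z x))\<^sup>2 + (cmod (V v x))\<^sup>2 + (cmod (V z x))\<^sup>2" by simp
    then have "2 * (cmod (V v x) * cmod (V z x)) \<le> 2 * ((cmod (V v x))\<^sup>2 + (cmod (V z x))\<^sup>2)"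
      by (simp add: power2_diff)
    then show "norm (V v x * cnj (V z x)) \<le> norm ((cmod (V v x))\<^sup>2 + (cmod (V z x))\<^sup>2)"
      by (simp add: norm_mult)
  qed
qed measurable

text \<open>Polarization of the isometry: expanding the norm of v + z gives real parts, and
  replacing v by -i v gives imaginary parts.\<close>

lemma V_parseval: "(\<integral>x. V v x * cnj (V z x) \<partial>\<mu>) = ip v z"
proof -
  have sq: "(\<integral>x. (cmod (V v x))\<^sup>2 \<partial>\<mu>) = Re (ip v v)" for v
    using adm ip_nonneg[of v] by (simp add: admissible_def hnorm_def)
  have Re: "Re (\<integral>x. V v x * cnj (V z x) \<partial>\<mu>) = Re (ip v z)" for v z
  proof -
    have "(cmod (V (v + z) x))\<^sup>2 = (cmod (V v x))\<^sup>2 + (cmod (V z x))\<^sup>2 + 2 * Re (V v x * cnj (V z x))" for x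
      unfolding V_add cmod_power2 by (simp add: power2_eq_square algebra_simps)
    then have "(\<integral>x. (cmod (V (v + z) x))\<^sup>2 \<partial>\<mu>) =
        (\<integral>x. (cmod (V v x))\<^sup>2 + (cmod (V z x))\<^sup>2 + 2 * Re (V v x * cnj (V z x)) \<partial>\<mu>)" by simp
    also have "\<dots> = (\<integral>x. (cmod (V v x))\<^sup>2 \<partial>\<mu>) + (\<integral>x. (cmod (V z x))\<^sup>2 \<partial>\<mu>)
        + 2 * (\<integral>x. Re (V v x * cnj (V z x)) \<partial>\<mu>)"
      by (subst Bochner_Integration.integral_add)
         (auto intro!: V_square_integrable V_product_integrable Bochner_Integration.integrable_add
            Bochner_Integration.integral_add integrable_Re simp del: times_complex.sel)
    also have "(\<integral>x. Re (V v x * cnj (V z x)) \<partial>\<mu>) = Re (\<integral>x. V v x * cnj (V z x) \<partial>\<mu>)"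
      by (rule integral_Re[OF V_product_integrable])
    finally have "Re (ip (v + z) (v + z)) = Re (ip v v) + Re (ip z z) + 2 * Re (\<integral>x. V v x * cnj (V z x) \<partial>\<mu>)"
      unfolding sq .
    moreover have "ip (v + z) (v + z) = ip v v + ip z z + ip v z + cnj (ip v z)"
      using ip_cnj[of z v] by (simp add: ip_add ip_add_right)
    ultimately show ?thesis by simp
  qed
  have "Re (\<integral>x. V (sc (- \<i>) v) x * cnj (V z x) \<partial>\<mu>) = Re (ip (sc (- \<i>) v) z)" by (rule Re)
  moreover have "(\<integral>x. V (sc (- \<i>) v) x * cnj (V z x) \<partial>\<mu>) = - \<i> * (\<integral>x. V v x * cnj (V z x) \<partial>\<mu>)"
    by (subst Bochner_Integration.integral_mult_right_zero[symmetric])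
       (simp add: V_sc mult.assoc)
  ultimately have "Im (\<integral>x. V v x * cnj (V z x) \<partial>\<mu>) = Im (ip v z)"
    by (simp add: ip_sc)
  with Re show ?thesis by (simp add: complex_eq_iff)
qed

text \<open>K is the voice transform of u, and K(y^{-1} x) is the conjugate of the transform of
  \<pi>(x)u at y; Parseval evaluates the convolution as an inner product.\<close>

lemma conv_K_K: "conv \<mu> K K = K"
proof
  fix x
  have "conv \<mu> K K x = (\<integral>y. V u y * cnj (V (\<pi> x u) y) \<partial>\<mu>)"
    unfolding conv_def
  proof (rule Bochner_Integration.integral_cong[OF refl])
    fix y
    show "K y * K (- y + x) = V u y * cnj (V (\<pi> x u) y)"
      using K_reflect[of y x] by (simp add: V_pi) (simp add: Vop_def Kf_def)
  qed
  also have "\<dots> = K x" unfolding V_parseval by (simp add: Kf_def)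
  finally show "conv \<mu> K K x = K x" .
qed

abbreviation KK :: "'g \<Rightarrow> ennreal" where "KK \<equiv> nconv (cnorm K) (cnorm K)"

lemma enr_KK: "1 < s \<Longrightarrow> enr s w KK < top"
proof (rule young_self)
  assume s: "1 < s"
  then have "1 < 2 * s / (s + 1)" by (simp add: field_simps)
  then show "enr (2 * s / (s + 1)) w (cnorm K) < top" by (rule enr_K)
qed (auto simp: K_sym)

lemma KK_sym: "KK (- x) = KK x"
  by (rule nconv_symmetric) (auto simp: K_sym)

text \<open>|K| = |K * K| \<le> |K| * |K|, and the latter is at most twice the squared L_{2,w} norm
  of K, uniformly in x. Together with integrability of W this makes W * K converge absolutely
  everywhere.\<close>

lemma K_bounded: "\<exists>B. \<forall>x. cmod (K x) \<le> B"
proof -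
  have fin: "enr 2 w (cnorm K) < top" by (rule enr_K) simp
  have le: "(\<integral>\<^sup>+y. epow 2 (cnorm K y) \<partial>\<mu>) \<le> enr 2 w (cnorm K)"
    unfolding enr_def
  proof (intro nn_integral_mono epow_mono)
    fix y
    have "1 * cnorm K y \<le> ennreal (w y) * cnorm K y" using w_ge_1 by (intro mult_right_mono) auto
    then show "cnorm K y \<le> ennreal (w y) * cnorm K y" by simp
  qed auto
  have "cnorm K x \<le> enr 2 w (cnorm K) + enr 2 w (cnorm K)" for x
  proof -
    have "cnorm K x \<le> KK x" using cnorm_conv_le[of K K x] by (simp add: conv_K_K)
    also have "\<dots> = (\<integral>\<^sup>+y. cnorm K y * cnorm K (- x + y) \<partial>\<mu>)"
      unfolding nconv_def by (intro nn_integral_cong) (subst K_reflect_norm, simp)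
    also have "\<dots> \<le> (\<integral>\<^sup>+y. epow 2 (cnorm K y) + epow 2 (cnorm K (- x + y)) \<partial>\<mu>)"
      using ennreal_mult_le_epow[of 2] by (intro nn_integral_mono) simp
    also have "\<dots> = (\<integral>\<^sup>+y. epow 2 (cnorm K y) \<partial>\<mu>) + (\<integral>\<^sup>+y. epow 2 (cnorm K (- x + y)) \<partial>\<mu>)"
      by (rule nn_integral_add) measurable
    also have "(\<integral>\<^sup>+y. epow 2 (cnorm K (- x + y)) \<partial>\<mu>) = (\<integral>\<^sup>+y. epow 2 (cnorm K y) \<partial>\<mu>)"
      by (rule nn_integral_left) measurable
    finally show ?thesis using le by (meson add_mono order_trans)
  qed
  moreover obtain b where "enr 2 w (cnorm K) + enr 2 w (cnorm K) = ennreal b" "0 \<le> b"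
    using fin by (cases "enr 2 w (cnorm K) + enr 2 w (cnorm K)") auto
  ultimately show ?thesis by (intro exI[of _ b]) simp
qed

lemma W_norm_finite: "(\<integral>\<^sup>+x. cnorm W x \<partial>\<mu>) < top"
proof (rule le_less_trans[OF nn_integral_mono W_integrable])
  fix x
  have "1 * cnorm W x \<le> ennreal (w x) * cnorm W x" using w_ge_1 by (intro mult_right_mono) auto
  then show "cnorm W x \<le> ennreal (w x) * cnorm W x" by simp
qed

lemma nconv_W_K_finite: "nconv (cnorm W) (cnorm K) x < top"
proof -
  obtain B where B: "\<And>x. cmod (K x) \<le> B" using K_bounded by blast
  have "nconv (cnorm W) (cnorm K) x \<le> (\<integral>\<^sup>+y. cnorm W y * ennreal B \<partial>\<mu>)"
    unfolding nconv_def by (intro nn_integral_mono mult_left_mono ennreal_leI B) auto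
  also have "\<dots> = (\<integral>\<^sup>+y. cnorm W y \<partial>\<mu>) * ennreal B" by (rule nn_integral_multc) measurable
  also have "\<dots> < top" using W_norm_finite by (simp add: ennreal_mult_less_top)
  finally show ?thesis .
qed

lemma integrable_conv:
  assumes [measurable]: "f \<in> borel_measurable borel" "g \<in> borel_measurable borel"
    and "nconv (cnorm f) (cnorm g) x < top"
  shows "integrable \<mu> (\<lambda>y. f y * g (- y + x))"
  using assms(3) by (subst integrable_iff_cnorm) (auto simp: nconv_def norm_mult ennreal_mult)

lemma conv_translate:
  assumes [measurable]: "f \<in> borel_measurable borel" "g \<in> borel_measurable borel"
  shows "conv \<mu> (\<lambda>y. f (- d + y)) g x = conv \<mu> f g (- d + x)"
  unfolding conv_def using integral_left[of "\<lambda>y. f (- d + y) * g (- y + x)" d]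
  by (simp add: add.assoc[symmetric] minus_add)

lemma nconv_translate:
  assumes [measurable]: "f \<in> borel_measurable borel" "g \<in> borel_measurable borel"
  shows "nconv (\<lambda>y. f (- d + y)) g x = nconv f g (- d + x)"
  unfolding nconv_def using nn_integral_left[of "\<lambda>y. f (- d + y) * g (- y + x)" d]
  by (simp add: add.assoc[symmetric] minus_add)

lemma conv_W_translate: "conv \<mu> (\<lambda>y. W (- d + y)) K x = K (- d + x)"
  using conv_translate[of W K d x] by (simp add: W_repr)

section \<open>Right convolution with K and W on L_{r,m}\<close>

context
  fixes r :: real and m :: "'g \<Rightarrow> real"
  assumes r: "1 < r" and m: "moderate w m"
begin

lemma conjugate_exponent: "1 < r / (r - 1)"
  using r by simp

lemma nconv_K_finite:
  assumes "f \<in> borel_measurable borel" "enr r m f < top"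
  shows "nconv f (cnorm K) x < top"
  by (rule nconv_finite[OF r m]) (use assms enr_K[OF conjugate_exponent] in \<open>auto simp: K_sym\<close>)

lemma nconv_KK_finite:
  assumes "f \<in> borel_measurable borel" "enr r m f < top"
  shows "nconv f KK x < top"
  by (rule nconv_finite[OF r m]) (use assms enr_KK[OF conjugate_exponent] in \<open>auto simp: KK_sym\<close>)

lemma conv_K_integrable:
  assumes [measurable]: "f \<in> borel_measurable borel" and "enr r m (cnorm f) < top"
  shows "integrable \<mu> (\<lambda>y. f y * K (- y + x))"
  using assms by (intro integrable_conv nconv_K_finite) auto

text \<open>The moduli are grouped as |f| * (|K| * |K|), since |f| * |K| is not known to lie in
  L_{r,m}; |K| * |K| is symmetric and lies in the dual space.\<close>

lemma conv_conv_K: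
  assumes [measurable]: "f \<in> borel_measurable borel" and "enr r m (cnorm f) < top"
  shows "conv \<mu> (conv \<mu> f K) K = conv \<mu> f K"
proof
  fix x
  have "nconv (nconv (cnorm f) (cnorm K)) (cnorm K) x < top"
    using assms(2) nconv_KK_finite[of "cnorm f" x] by (simp add: nconv_assoc)
  then show "conv \<mu> (conv \<mu> f K) K x = conv \<mu> f K x"
    using conv_assoc[of f K K x] by (simp add: conv_K_K)
qed

lemma enr_nconv_W:
  assumes [measurable]: "f \<in> borel_measurable borel" and "enr r m f < top"
  shows "enr r m (nconv f (cnorm W)) < top"
proof -
  have "enr r m (nconv f (cnorm W)) \<le> epow (r - 1) (\<integral>\<^sup>+y. ennreal (w y / modular \<mu> y) * cnorm W y \<partial>\<mu>)
    * (\<integral>\<^sup>+y. ennreal (w y) * cnorm W y \<partial>\<mu>) * enr r m f"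
    by (rule schur_right[OF r m]) measurable
  also have "\<dots> < top"
    using assms(2) W_integrable W_integrable_modular by (simp add: ennreal_mult_less_top)
  finally show ?thesis .
qed

text \<open>Here the other grouping works: |f| * |W| lies in L_{r,m} by Schur's test and is then
  paired with a translate of |K|.\<close>

lemma conv_conv_W_K:
  assumes [measurable]: "f \<in> borel_measurable borel" and "enr r m (cnorm f) < top"
  shows "conv \<mu> (conv \<mu> f W) K = conv \<mu> f K"
proof
  fix x
  have "nconv (nconv (cnorm f) (cnorm W)) (cnorm K) x < top"
    using assms(2) by (intro nconv_K_finite enr_nconv_W) auto
  then show "conv \<mu> (conv \<mu> f W) K x = conv \<mu> f K x"
    using conv_assoc[of f W K x] by (simp add: W_repr)
qed

end

end

section \<open>The reproducing formula on the reservoir\<close>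

context haar_group
begin

text \<open>Minkowski's integral inequality in the form that Jensen gives for p-th powers; the total
  mass of k carries the remaining exponent p - 1.\<close>

lemma enr_integral_le:
  assumes p: "1 < p" and [measurable]: "v \<in> borel_measurable borel" "k \<in> borel_measurable borel"
    "(\<lambda>(y, z). h y z) \<in> borel_measurable (borel \<Otimes>\<^sub>M borel)"
  shows "enr p v (\<lambda>z. \<integral>\<^sup>+y. k y * h y z \<partial>\<mu>)
    \<le> epow (p - 1) (\<integral>\<^sup>+y. k y \<partial>\<mu>) * (\<integral>\<^sup>+y. k y * enr p v (h y) \<partial>\<mu>)"
proof -
  interpret P: pair_sigma_finite \<mu> \<mu> ..
  have "epow p (ennreal (v z) * (\<integral>\<^sup>+y. k y * h y z \<partial>\<mu>)) \<le>
      epow (p - 1) (\<integral>\<^sup>+y. k y \<partial>\<mu>) * (\<integral>\<^sup>+y. k y * epow p (ennreal (v z) * h y z) \<partial>\<mu>)" for z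
  proof -
    have "ennreal (v z) * (\<integral>\<^sup>+y. k y * h y z \<partial>\<mu>) = (\<integral>\<^sup>+y. ennreal (v z) * (k y * h y z) \<partial>\<mu>)"
      by (rule nn_integral_cmult[symmetric]) measurable
    also have "\<dots> = (\<integral>\<^sup>+y. k y * (ennreal (v z) * h y z) \<partial>\<mu>)"
      by (simp add: mult_ac)
    finally show ?thesis
      using nn_integral_jensen[OF p, of k \<mu> "\<lambda>y. ennreal (v z) * h y z"] by simp
  qed
  then have "enr p v (\<lambda>z. \<integral>\<^sup>+y. k y * h y z \<partial>\<mu>)
     \<le> (\<integral>\<^sup>+z. epow (p - 1) (\<integral>\<^sup>+y. k y \<partial>\<mu>) * (\<integral>\<^sup>+y. k y * epow p (ennreal (v z) * h y z) \<partial>\<mu>) \<partial>\<mu>)"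
    unfolding enr_def by (rule nn_integral_mono)
  also have "\<dots> = epow (p - 1) (\<integral>\<^sup>+y. k y \<partial>\<mu>) * (\<integral>\<^sup>+z. \<integral>\<^sup>+y. k y * epow p (ennreal (v z) * h y z) \<partial>\<mu> \<partial>\<mu>)"
    by (rule nn_integral_cmult) measurable
  also have "(\<integral>\<^sup>+z. \<integral>\<^sup>+y. k y * epow p (ennreal (v z) * h y z) \<partial>\<mu> \<partial>\<mu>)
      = (\<integral>\<^sup>+y. \<integral>\<^sup>+z. k y * epow p (ennreal (v z) * h y z) \<partial>\<mu> \<partial>\<mu>)"
    by (rule P.Fubini'[symmetric]) measurable
  also have "\<dots> = (\<integral>\<^sup>+y. k y * enr p v (h y) \<partial>\<mu>)"
    unfolding enr_def by (intro nn_integral_cong nn_integral_cmult) measurable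
  finally show ?thesis .
qed

lemma Lpw_norm_le:
  assumes "0 < p" and [measurable]: "v \<in> borel_measurable borel" "f \<in> borel_measurable borel" "g \<in> borel_measurable borel"
    and v: "\<And>x. 0 \<le> v x"
    and B: "0 \<le> B" and le: "enr p v (cnorm f) \<le> ennreal B * enr p v (cnorm g)" and fin: "enr p v (cnorm g) < top"
  shows "Lpw_norm \<mu> p v f \<le> B powr (1 / p) * Lpw_norm \<mu> p v g"
proof -
  have "enn2real (enr p v (cnorm f)) \<le> enn2real (ennreal B * enr p v (cnorm g))"
    using le fin by (intro enn2real_mono) (auto simp: ennreal_mult_less_top)
  also have "\<dots> = B * enn2real (enr p v (cnorm g))" using B by (simp add: enn2real_mult)
  finally have "enn2real (enr p v (cnorm f)) powr (1 / p) \<le> (B * enn2real (enr p v (cnorm g))) powr (1 / p)"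
    using assms(1) by (intro powr_mono2) auto
  then show ?thesis using B v by (simp add: Lpw_norm_eq powr_mult)
qed

end

text \<open>Compactness leaves finitely many centres, and the induction assigns each point to the
  last inserted neighbourhood containing it. The pieces are Borel and finite in number, so integrals
  against the selection are finite sums. Off the cover the value is arbitrary.\<close>

lemma finite_range_selection:
  fixes D :: "'a::t2_space set"
  assumes D: "compact D" and P: "\<And>y'. y' \<in> D \<Longrightarrow> \<exists>S. open S \<and> y' \<in> S \<and> (\<forall>y\<in>S. P y y')"
  obtains s :: "'a \<Rightarrow> 'a" where "finite (range s)" "s \<in> measurable borel (count_space UNIV)"
    "\<And>y. y \<in> D \<Longrightarrow> P y (s y)"
proof -
  obtain S where S: "\<And>y'. y' \<in> D \<Longrightarrow> open (S y')" "\<And>y'. y' \<in> D \<Longrightarrow> y' \<in> S y'"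
      "\<And>y y'. y' \<in> D \<Longrightarrow> y \<in> S y' \<Longrightarrow> P y y'"
    using P by metis
  have "D \<subseteq> (\<Union>y'\<in>D. S y')" using S(2) by blast
  then obtain A where A: "A \<subseteq> D" "finite A" "D \<subseteq> (\<Union>y'\<in>A. S y')"
    using compactE_image[OF D, of D S] S(1) by blast
  have "\<exists>s::'a \<Rightarrow> 'a. finite (range s) \<and> s \<in> measurable borel (count_space UNIV) \<and> (\<forall>y\<in>\<Union>y'\<in>A. S y'. P y (s y))"
    using A(2,1)
  proof (induction A)
    case empty
    show ?case by (intro exI[of _ "\<lambda>_. undefined"]) auto
  next
    case (insert a A)
    then obtain s :: "'a \<Rightarrow> 'a" where s: "finite (range s)" "s \<in> measurable borel (count_space UNIV)"
      "\<forall>y\<in>\<Union>y'\<in>A. S y'. P y (s y)" by auto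
    have [measurable]: "S a \<in> sets borel" using insert.prems S(1) by auto
    let ?s = "\<lambda>y. if y \<in> S a then a else s y"
    have "finite (range ?s)"
      by (rule finite_subset[of _ "insert a (range s)"]) (use s(1) in auto)
    moreover have "?s \<in> measurable borel (count_space UNIV)"
      using s(2) by (intro measurable_If) auto
    moreover have "\<forall>y\<in>\<Union>y'\<in>insert a A. S y'. P y (?s y)"
    proof
      fix y assume "y \<in> (\<Union>y'\<in>insert a A. S y')"
      then show "P y (?s y)"
        using s(3) S(3)[of a y] insert.prems by (cases "y \<in> S a") auto
    qed
    ultimately show ?case by blast
  qed
  then obtain s :: "'a \<Rightarrow> 'a" where "finite (range s)" "s \<in> measurable borel (count_space UNIV)"
    "\<forall>y\<in>\<Union>y'\<in>A. S y'. P y (s y)" by blast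
  with A(3) show ?thesis by (intro that[of s]) auto
qed

text \<open>Writes a Riemann sum as the integral of a function frozen at the selected nodes, which
  can then be compared with the original integral under one integral sign. It is used once for the
  kernel and once for V_e T.\<close>

lemma integral_finite_range:
  fixes g \<phi> :: "_ \<Rightarrow> complex"
  assumes s: "finite (range s)" and [measurable]: "s \<in> measurable M (count_space UNIV)"
    and g: "integrable M g"
  shows "(\<Sum>d\<in>range s. (\<integral>y. of_bool (s y = d) * g y \<partial>M) * \<phi> d) = (\<integral>y. g y * \<phi> (s y) \<partial>M)"
    and "integrable M (\<lambda>y. g y * \<phi> (s y))"
proof -
  have int: "integrable M (\<lambda>y. of_bool (s y = d) * g y * \<phi> d)" for d
  proof (intro integrable_mult_left Bochner_Integration.integrable_bound[OF g])
    note [measurable] = borel_measurable_integrable[OF g]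
    have [measurable]: "Measurable.pred M (\<lambda>y. s y = d)" by measurable
    have "(\<lambda>y. (if s y = d then 1 else 0) * g y) \<in> borel_measurable M" by measurable
    then show "(\<lambda>y. of_bool (s y = d) * g y) \<in> borel_measurable M"
      by (simp add: of_bool_def)
    show "AE y in M. cmod (of_bool (s y = d) * g y) \<le> cmod (g y)"
      by (auto simp: norm_mult)
  qed
  have eq: "(\<Sum>d\<in>range s. of_bool (s y = d) * g y * \<phi> d) = g y * \<phi> (s y)" for y
  proof -
    have "(\<Sum>d\<in>range s. of_bool (s y = d) * g y * \<phi> d) = (\<Sum>d\<in>range s. if s y = d then g y * \<phi> d else 0)"
      by (intro sum.cong) auto
    also have "\<dots> = g y * \<phi> (s y)" using s by (subst sum.delta') auto
    finally show ?thesis .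
  qed
  have "integrable M (\<lambda>y. \<Sum>d\<in>range s. of_bool (s y = d) * g y * \<phi> d)"
    by (intro Bochner_Integration.integrable_sum int)
  then show "integrable M (\<lambda>y. g y * \<phi> (s y))" by (simp only: eq)
  have "(\<Sum>d\<in>range s. (\<integral>y. of_bool (s y = d) * g y \<partial>M) * \<phi> d) = (\<Sum>d\<in>range s. \<integral>y. of_bool (s y = d) * g y * \<phi> d \<partial>M)"
    by simp
  also have "\<dots> = (\<integral>y. (\<Sum>d\<in>range s. of_bool (s y = d) * g y * \<phi> d) \<partial>M)"
    by (rule Bochner_Integration.integral_sum[symmetric]) (rule int)
  finally show "(\<Sum>d\<in>range s. (\<integral>y. of_bool (s y = d) * g y \<partial>M) * \<phi> d) = (\<integral>y. g y * \<phi> (s y) \<partial>M)"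
    by (simp only: eq)
qed

section \<open>Continuity of the orbit of u in S_w\<close>

context coorbit
begin

text \<open>The L_{1,w} distance of two translates of W. By W * K = K and \<open>young_left\<close>
  this single number controls the distance of \<pi>(y)u and \<pi>(y')u in all seminorms of S_w at
  once, although K need not be integrable.\<close>

definition shiftdist :: "'g \<Rightarrow> 'g \<Rightarrow> ennreal" where
  "shiftdist y y' = (\<integral>\<^sup>+z. ennreal (w z) * cnorm (\<lambda>z. W (- y + z) - W (- y' + z)) z \<partial>\<mu>)"

text \<open>Dominated convergence: for y near y' one has y^{-1} y' in U, so the translates of W are
  bounded by a translate of \<open>maxW\<close>, which is integrable against w.\<close>

lemma shiftdist_tendsto: "((\<lambda>y. shiftdist y y') \<longlongrightarrow> 0) (at y')"
  unfolding tendsto_at_iff_sequentially comp_def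
proof (intro allI impI)
  fix X :: "nat \<Rightarrow> 'g" assume "X \<longlonglongrightarrow> y'"
  have iU: "open ((\<lambda>y. - y + y') -` interior U)"
    by (intro open_vimage continuous_intros) auto
  have "eventually (\<lambda>i. X i \<in> (\<lambda>y. - y + y') -` interior U) sequentially"
    using \<open>X \<longlonglongrightarrow> y'\<close> iU by (rule topological_tendstoD) (use U in \<open>auto simp: unit_nbhd_def\<close>)
  then have ev: "eventually (\<lambda>i. - X i + y' \<in> U) sequentially"
    by eventually_elim (use interior_subset in auto)
  \<comment> \<open>The guard makes the domination valid for all indices; it is eventually
    true.\<close>
  let ?f = "\<lambda>i z. if - X i + y' \<in> U then ennreal (w z) * cnorm (\<lambda>z. W (- X i + z) - W (- y' + z)) z else 0"
  have "(\<lambda>i. \<integral>\<^sup>+z. ?f i z \<partial>\<mu>) \<longlonglongrightarrow> (\<integral>\<^sup>+z. 0 \<partial>\<mu>)"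
  proof (rule nn_integral_dominated_convergence[where w = "\<lambda>z. ennreal (w z) * (2 * ennreal (maxW (- y' + z)))"])
    show "AE z in \<mu>. ?f i z \<le> ennreal (w z) * (2 * ennreal (maxW (- y' + z)))" for i
    proof (rule AE_I2)
      fix z
      show "?f i z \<le> ennreal (w z) * (2 * ennreal (maxW (- y' + z)))"
      proof (cases "- X i + y' \<in> U")
        case True
        have "(- X i + y') + (- y' + z) = - X i + z" by (simp add: add.assoc)
        then have "cmod (W (- X i + z)) \<le> maxW (- y' + z)"
          using W_le_maxW[OF True, of "- y' + z"] by simp
        moreover have "cmod (W (- y' + z)) \<le> maxW (- y' + z)" by (rule W_le_maxW_self)
        ultimately have "cmod (W (- X i + z) - W (- y' + z)) \<le> 2 * maxW (- y' + z)"
          using norm_triangle_ineq4[of "W (- X i + z)" "W (- y' + z)"] by simp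
        then have "ennreal (cmod (W (- X i + z) - W (- y' + z))) \<le> 2 * ennreal (maxW (- y' + z))"
          using ennreal_mult[of 2 "maxW (- y' + z)"] by (metis ennreal_leI ennreal_numeral maxW_nonneg zero_le_numeral)
        then show ?thesis using True by (simp add: mult_left_mono)
      qed simp
    qed
    have "(\<integral>\<^sup>+z. ennreal (w z) * (2 * ennreal (maxW (- y' + z))) \<partial>\<mu>)
        = (\<integral>\<^sup>+z. ennreal (w (y' + z)) * (2 * ennreal (maxW z)) \<partial>\<mu>)"
      using nn_integral_left[of "\<lambda>z. ennreal (w z) * (2 * ennreal (maxW (- y' + z)))" y']
      by (simp add: add.assoc[symmetric])
    also have "\<dots> \<le> (\<integral>\<^sup>+z. (ennreal (w y') * 2) * (ennreal (w z) * ennreal (maxW z)) \<partial>\<mu>)"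
    proof (rule nn_integral_mono)
      fix z
      have "ennreal (w (y' + z)) \<le> ennreal (w y') * ennreal (w z)"
        using w_plus[of y' z] by (simp add: ennreal_mult[symmetric])
      from mult_right_mono[OF this, of "2 * ennreal (maxW z)"]
      show "ennreal (w (y' + z)) * (2 * ennreal (maxW z)) \<le> (ennreal (w y') * 2) * (ennreal (w z) * ennreal (maxW z))"
        by (simp add: mult_ac)
    qed
    also have "\<dots> = (ennreal (w y') * 2) * (\<integral>\<^sup>+z. ennreal (w z) * ennreal (maxW z) \<partial>\<mu>)"
      by (rule nn_integral_cmult) measurable
    also have "\<dots> < \<infinity>" using maxW_integrable by (simp add: ennreal_mult_less_top)
    finally show "(\<integral>\<^sup>+z. ennreal (w z) * (2 * ennreal (maxW (- y' + z))) \<partial>\<mu>) < \<infinity>" .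
    show "AE z in \<mu>. (\<lambda>i. ?f i z) \<longlonglongrightarrow> 0"
    proof (rule AE_I2)
      fix z
      have "continuous_on UNIV (\<lambda>y. W (- y + z))" by (intro continuous_intros)
      then have "isCont (\<lambda>y. W (- y + z)) y'" by (simp add: continuous_on_eq_continuous_at)
      then have "(\<lambda>i. W (- X i + z)) \<longlonglongrightarrow> W (- y' + z)"
        using \<open>X \<longlonglongrightarrow> y'\<close> by (rule isCont_tendsto_compose)
      then have "(\<lambda>i. cmod (W (- X i + z) - W (- y' + z))) \<longlonglongrightarrow> 0"
        by (intro tendsto_norm_zero) (simp add: LIM_zero)
      then have "(\<lambda>i. w z * cmod (W (- X i + z) - W (- y' + z))) \<longlonglongrightarrow> 0"
        by (rule tendsto_mult_right_zero)
      then have "(\<lambda>i. ennreal (w z * cmod (W (- X i + z) - W (- y' + z)))) \<longlonglongrightarrow> ennreal 0"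
        by (rule tendsto_ennrealI)
      then have "(\<lambda>i. ennreal (w z) * cnorm (\<lambda>z. W (- X i + z) - W (- y' + z)) z) \<longlonglongrightarrow> 0"
        by (simp add: ennreal_mult)
      then show "(\<lambda>i. ?f i z) \<longlonglongrightarrow> 0"
        by (rule Lim_transform_eventually) (use ev in \<open>eventually_elim, simp\<close>)
    qed
  qed measurable
  then have "(\<lambda>i. \<integral>\<^sup>+z. ?f i z \<partial>\<mu>) \<longlonglongrightarrow> 0" by simp
  then show "(\<lambda>i. shiftdist (X i) y') \<longlonglongrightarrow> 0"
    by (rule Lim_transform_eventually) (use ev in \<open>eventually_elim, simp add: shiftdist_def\<close>)
qed

lemma shiftdist_nbhd:
  assumes "0 < e" shows "\<exists>S. open S \<and> y' \<in> S \<and> (\<forall>y\<in>S. shiftdist y y' \<le> e)"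
proof -
  have "eventually (\<lambda>y. shiftdist y y' < e) (at y')"
    using shiftdist_tendsto assms by (rule order_tendstoD)
  then obtain S where S: "open S" "y' \<in> S" "\<And>y. y \<in> S \<Longrightarrow> y \<noteq> y' \<Longrightarrow> shiftdist y y' < e"
    unfolding eventually_at_topological by auto
  have "shiftdist y' y' \<le> e" by (simp add: shiftdist_def)
  with S show ?thesis by (metis less_imp_le)
qed

text \<open>The difference of translates of K is the corresponding difference for W convolved with
  K, so Young's inequality applies with the integrable factor on the left.\<close>

lemma enr_K_diff:
  assumes p: "1 < p"
  shows "enr p w (cnorm (\<lambda>z. K (- y + z) - K (- y' + z))) \<le> epow p (shiftdist y y') * enr p w (cnorm K)"
proof -
  let ?F = "\<lambda>t. W (- y + t) - W (- y' + t)"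
  have eq: "K (- y + z) - K (- y' + z) = conv \<mu> ?F K z" for z
  proof -
    have "nconv (cnorm (\<lambda>t. W (- d + t))) (cnorm K) z < top" for d
      using nconv_translate[of "cnorm W" "cnorm K" d z] nconv_W_K_finite by simp
    then have int: "integrable \<mu> (\<lambda>t. W (- d + t) * K (- t + z))" for d
      by (intro integrable_conv) auto
    have "conv \<mu> ?F K z = (\<integral>t. W (- y + t) * K (- t + z) - W (- y' + t) * K (- t + z) \<partial>\<mu>)"
      by (simp add: conv_def left_diff_distrib)
    also have "\<dots> = conv \<mu> (\<lambda>t. W (- y + t)) K z - conv \<mu> (\<lambda>t. W (- y' + t)) K z"
      unfolding conv_def by (intro Bochner_Integration.integral_diff int)
    finally show ?thesis by (simp add: conv_W_translate)
  qed
  have "enr p w (cnorm (\<lambda>z. K (- y + z) - K (- y' + z))) \<le> enr p w (nconv (cnorm ?F) (cnorm K))"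
    unfolding eq using p by (intro enr_mono cnorm_conv_le) auto
  also have "\<dots> \<le> epow p (shiftdist y y') * enr p w (cnorm K)"
    unfolding shiftdist_def by (rule young_left[OF p]) measurable
  finally show ?thesis .
qed

abbreviation S :: "'h set" where "S \<equiv> Sw \<mu> ip \<pi> u w"

lemma mem_S_iff: "v \<in> S \<longleftrightarrow> (\<forall>p>1. enr p w (cnorm (V v)) < top)"
  using Lpw_iff[of w "V v"] by (auto simp: Sw_def)

lemma S_add:
  assumes "v \<in> S" "v' \<in> S" shows "v + v' \<in> S"
  unfolding mem_S_iff
proof (intro allI impI)
  fix p :: real assume p: "1 < p"
  have "enr p w (cnorm (V (v + v'))) \<le> ennreal (2 powr p) * (enr p w (cnorm (V v)) + enr p w (cnorm (V v')))"
    using p by (intro enr_add_le) (auto simp: V_add ennreal_plus[symmetric] norm_triangle_ineq simp del: ennreal_plus)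
  also have "\<dots> < top" using assms p by (simp add: mem_S_iff ennreal_mult_less_top)
  finally show "enr p w (cnorm (V (v + v'))) < top" .
qed

lemma S_sc:
  assumes "v \<in> S" shows "sc a v \<in> S"
  unfolding mem_S_iff
proof (intro allI impI)
  fix p :: real assume p: "1 < p"
  have "enr p w (cnorm (V (sc a v))) = epow p (ennreal (cmod a)) * enr p w (cnorm (V v))"
    by (subst enr_cmult[symmetric]) (auto simp: V_sc norm_mult ennreal_mult)
  also have "\<dots> < top" using assms p by (simp add: mem_S_iff ennreal_mult_less_top)
  finally show "enr p w (cnorm (V (sc a v))) < top" .
qed

lemma S_zero: "0 \<in> S"
  by (simp add: mem_S_iff V_zero enr_def)

lemma S_pi: "\<pi> x u \<in> S"
  unfolding mem_S_iff
proof (intro allI impI)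
  fix p :: real assume p: "1 < p"
  have "enr p w (\<lambda>y. cnorm K (- x + y)) \<le> epow p (ennreal (w x)) * enr p w (cnorm K)"
    using p by (intro enr_left_translate) auto
  also have "\<dots> < top" using enr_K[OF p] by (simp add: ennreal_mult_less_top)
  finally show "enr p w (cnorm (V (\<pi> x u))) < top" by (simp add: V_pi)
qed

lemma S_diff: "v \<in> S \<Longrightarrow> v' \<in> S \<Longrightarrow> v - v' \<in> S"
  using S_add[OF _ S_sc[of v' "- 1"], of v] by (simp add: sc_minus_one)

lemma S_sum: "(\<And>d. d \<in> A \<Longrightarrow> f d \<in> S) \<Longrightarrow> (\<Sum>d\<in>A. f d) \<in> S"
  by (induction A rule: infinite_finite_induct) (auto simp: S_zero intro: S_add)

lemma V_diff: "V (v - v') x = V v x - V v' x"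
  using V_add[of v "- v'" x] V_sc[of "- 1" v' x] by (simp add: sc_minus_one)

lemma V_sum: "V (\<Sum>d\<in>A. f d) x = (\<Sum>d\<in>A. V (f d) x)"
  by (induction A rule: infinite_finite_induct) (auto simp: V_zero V_add)

context
  fixes T assumes T: "T \<in> antidual \<mu> sc ip \<pi> u w"
begin

lemma T_add: "v \<in> S \<Longrightarrow> v' \<in> S \<Longrightarrow> T (v + v') = T v + T v'"
  and T_sc: "v \<in> S \<Longrightarrow> T (sc a v) = cnj a * T v"
  using T unfolding antidual_def by auto

lemma T_zero: "T 0 = 0"
  using T_sc[OF S_zero, of 0] by (simp add: sc_zero)

lemma T_diff: "v \<in> S \<Longrightarrow> v' \<in> S \<Longrightarrow> T (v - v') = T v - T v'"
  using T_add[OF _ S_sc[of v' "- 1"], of v] T_sc[of v' "- 1"] by (simp add: sc_minus_one)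

lemma T_sum: "(\<And>d. d \<in> A \<Longrightarrow> f d \<in> S) \<Longrightarrow> T (\<Sum>d\<in>A. f d) = (\<Sum>d\<in>A. T (f d))"
  by (induction A rule: infinite_finite_induct) (auto simp: T_zero T_add S_sum)

lemma T_bound:
  obtains P C where "finite P" "P \<subseteq> {1<..}" "0 \<le> C"
    "\<And>v. v \<in> S \<Longrightarrow> cmod (T v) \<le> C * (\<Sum>p\<in>P. Lpw_norm \<mu> p w (V v))"
proof -
  obtain P C where PC: "finite P" "P \<subseteq> {1<..}"
     "\<And>v. v \<in> S \<Longrightarrow> cmod (T v) \<le> C * (\<Sum>p\<in>P. Lpw_norm \<mu> p w (V v))"
    using T unfolding antidual_def mem_Collect_eq by blast
  show ?thesis
  proof (rule that[of P "max C 0"])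
    fix v assume "v \<in> S"
    have "0 \<le> (\<Sum>p\<in>P. Lpw_norm \<mu> p w (V v))"
      by (intro sum_nonneg) (simp add: Lpw_norm_def)
    then show "cmod (T v) \<le> max C 0 * (\<Sum>p\<in>P. Lpw_norm \<mu> p w (V v))"
      using PC(3)[OF \<open>v \<in> S\<close>] by (meson max.cobounded1 mult_right_mono order_trans)
  qed (use PC in auto)
qed

end

section \<open>Riemann sums and the reproducing formula\<close>

lemma moderate_w: "moderate w w"
  using wt by (auto simp: weight_def moderate_def)

lemma enr_pi_diff:
  assumes "1 < p" "shiftdist y y' \<le> ennreal e" "0 \<le> e"
  shows "enr p w (cnorm (V (\<pi> y u - \<pi> y' u))) \<le> ennreal (e powr p) * enr p w (cnorm K)"
proof -
  have "enr p w (cnorm (V (\<pi> y u - \<pi> y' u))) \<le> epow p (shiftdist y y') * enr p w (cnorm K)"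
    using enr_K_diff[OF assms(1), of y y'] by (simp add: V_diff V_pi)
  also have "\<dots> \<le> epow p (ennreal e) * enr p w (cnorm K)"
    using assms by (intro mult_right_mono epow_mono) auto
  finally show ?thesis using assms by (simp add: epow_ennreal)
qed

lemma Lpw_norm_tendsto_0:
  assumes "1 < p" "(\<lambda>n. enr p w (cnorm (V (f n)))) \<longlonglongrightarrow> 0"
  shows "(\<lambda>n. Lpw_norm \<mu> p w (V (f n))) \<longlonglongrightarrow> 0"
proof -
  have "(\<lambda>n. enn2real (enr p w (cnorm (V (f n))))) \<longlonglongrightarrow> enn2real 0"
    using assms(2) by (intro tendsto_enn2real) auto
  then have "(\<lambda>n. enn2real (enr p w (cnorm (V (f n)))) powr (1 / p)) \<longlonglongrightarrow> 0"
    using assms(1) by (intro tendsto_zero_powrI[where b = "1 / p"]) auto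
  then show ?thesis by (simp add: Lpw_norm_eq)
qed

text \<open>The vector \<open>\<pi>(x)u = \<integral> V(\<pi>(x)u)(y) \<pi>(y)u dy\<close> is approximated by Riemann sums over
  compact sets \<open>D n\<close>. The error splits into the tail off \<open>D n\<close>, small by dominated
  convergence, and the discretization on \<open>D n\<close>, controlled by \<open>shiftdist\<close>.\<close>

lemma riemann_approximation:
  fixes x :: 'g
  obtains D :: "nat \<Rightarrow> 'g set" and s :: "nat \<Rightarrow> 'g \<Rightarrow> 'g" and v :: "nat \<Rightarrow> 'h" and e :: "nat \<Rightarrow> real"
  where "\<And>n. compact (D n)" "incseq D" "(\<Union>n. D n) = UNIV"
    and "\<And>n. finite (range (s n))" "\<And>n. s n \<in> measurable borel (count_space UNIV)"
    and "\<And>n. 0 < e n" "\<And>n y. y \<in> D n \<Longrightarrow> shiftdist y (s n y) \<le> ennreal (e n)"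
    and "\<And>n. (\<integral>\<^sup>+y. indicator (D n) y * cnorm K (- x + y) \<partial>\<mu>) * ennreal (e n) \<le> ennreal (1 / (real n + 1))"
    and "\<And>n. integrable \<mu> (\<lambda>y. indicator (D n) y * K (- x + y))"
    and "\<And>n. v n = (\<Sum>d\<in>range (s n). sc (\<integral>y. of_bool (s n y = d) * (indicator (D n) y * K (- x + y)) \<partial>\<mu>) (\<pi> d u))"
    and "\<And>p. 1 < p \<Longrightarrow> (\<lambda>n. enr p w (cnorm (V (\<pi> x u - v n)))) \<longlonglongrightarrow> 0"
proof -
  obtain D :: "nat \<Rightarrow> 'g set" where D: "\<And>n. compact (D n)" "incseq D" "(\<Union>n. D n) = UNIV"
    by (blast intro: compact_exhaustion)
  have [measurable]: "D n \<in> sets borel" for n using D(1) by simp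
  define g where "g y = K (- x + y)" for y
  have [measurable]: "g \<in> borel_measurable borel" unfolding g_def by measurable
  define mass where "mass n = (\<integral>\<^sup>+y. indicator (D n) y * cnorm g y \<partial>\<mu>)" for n
  obtain B where B: "\<And>y. cmod (K y) \<le> B" using K_bounded by blast
  have mass: "mass n < top" for n
  proof -
    have "mass n \<le> (\<integral>\<^sup>+y. ennreal B * indicator (D n) y \<partial>\<mu>)"
      unfolding mass_def g_def by (intro nn_integral_mono) (auto simp: indicator_def intro: ennreal_leI B)
    also have "\<dots> = ennreal B * emeasure \<mu> (D n)" by (rule nn_integral_cmult_indicator) simp
    also have "\<dots> < top" using emeasure_compact[OF D(1)] by (simp add: ennreal_mult_less_top)
    finally show ?thesis .
  qed
  \<comment> \<open>The tolerance is divided by the mass of g on D n, so that the accumulated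
    discretization error is at most 1/(n+1); adding 1 to the mass avoids a zero denominator.\<close>
  define e where "e n = 1 / ((real n + 1) * (1 + enn2real (mass n)))" for n
  have e: "0 < e n" for n
  proof -
    have "0 < 1 + enn2real (mass n)" by (intro add_pos_nonneg) auto
    then show ?thesis unfolding e_def by (intro divide_pos_pos mult_pos_pos) auto
  qed
  have mass_e: "mass n * ennreal (e n) \<le> ennreal (1 / (real n + 1))" for n
  proof -
    have pos: "0 < 1 + enn2real (mass n)" by (simp add: add_pos_nonneg)
    have "mass n * ennreal (e n) = ennreal (enn2real (mass n) * e n)"
      using mass[of n] e[of n] by (simp add: ennreal_mult less_imp_le)
    also have "enn2real (mass n) * e n \<le> (1 + enn2real (mass n)) * e n"
      using e[of n] by (intro mult_right_mono) auto
    also have "\<dots> = 1 / (real n + 1)" using pos by (simp add: e_def)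
    finally show ?thesis by (simp add: ennreal_leI)
  qed
  have "\<exists>s. finite (range s) \<and> s \<in> measurable borel (count_space UNIV) \<and>
      (\<forall>y\<in>D n. shiftdist y (s y) \<le> ennreal (e n))" for n
  proof -
    have "\<exists>S. open S \<and> y' \<in> S \<and> (\<forall>y\<in>S. shiftdist y y' \<le> ennreal (e n))" for y'
      using e[of n] by (intro shiftdist_nbhd) simp
    then obtain s :: "'g \<Rightarrow> 'g" where "finite (range s)" "s \<in> measurable borel (count_space UNIV)"
      "\<And>y. y \<in> D n \<Longrightarrow> shiftdist y (s y) \<le> ennreal (e n)"
      using finite_range_selection[OF D(1), of n "\<lambda>y y'. shiftdist y y' \<le> ennreal (e n)"] by metis
    then show ?thesis by blast
  qed
  then obtain s :: "nat \<Rightarrow> 'g \<Rightarrow> 'g" where s: "\<And>n. finite (range (s n))"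
      and sm: "\<And>n. s n \<in> measurable borel (count_space UNIV)"
      and sd: "\<And>n y. y \<in> D n \<Longrightarrow> shiftdist y (s n y) \<le> ennreal (e n)"
    by metis
  have s_borel [measurable]: "s n \<in> borel_measurable borel" for n
    using measurable_compose[OF sm[of n], of "\<lambda>y. y" borel] by simp
  define gn where "gn n y = indicator (D n) y * g y" for n y
  have [measurable]: "gn n \<in> borel_measurable borel" for n unfolding gn_def by measurable
  have cgn: "cnorm (gn n) y = indicator (D n) y * cnorm g y" for n y
    by (auto simp: gn_def indicator_def)
  have gn_int: "integrable \<mu> (gn n)" for n
  proof (subst integrable_iff_cnorm)
    show "(\<integral>\<^sup>+y. cnorm (gn n) y \<partial>\<mu>) < top" using mass[of n] by (simp only: cgn mass_def)
  qed measurable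
  define v where "v n = (\<Sum>d\<in>range (s n). sc (\<integral>y. of_bool (s n y = d) * gn n y \<partial>\<mu>) (\<pi> d u))" for n
  have sm': "s n \<in> measurable \<mu> (count_space UNIV)" for n using sm[of n] by simp
  have Vv: "V (v n) z = (\<integral>y. gn n y * K (- s n y + z) \<partial>\<mu>)" for n z
    unfolding v_def V_sum V_sc V_pi by (rule integral_finite_range(1)[OF s sm' gn_int])
  have Vint: "integrable \<mu> (\<lambda>y. gn n y * K (- s n y + z))" for n z
    using integral_finite_range(2)[OF s sm' gn_int, of n "\<lambda>d. K (- d + z)"] by simp
  \<comment> \<open>The majorant of the tail error: a translate of |K| * |K|, finite at every point
    and of finite L_{p,w} norm for all p > 1.\<close>
  define G where "G = nconv (cnorm g) (cnorm K)"
  have [measurable]: "G \<in> borel_measurable borel" unfolding G_def by measurable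
  have G_eq: "G z = KK (- x + z)" for z
    unfolding G_def g_def using nconv_translate[of "cnorm K" "cnorm K" x z] by simp
  have G_fin: "G z < top" for z
  proof -
    have "enr 2 w (cnorm g) < top" using S_pi[of x] by (auto simp: mem_S_iff V_pi g_def)
    then show ?thesis unfolding G_def by (intro nconv_K_finite[OF _ moderate_w, of 2]) auto
  qed
  have G_enr: "enr p w G < top" if "1 < p" for p
  proof -
    have "enr p w (\<lambda>z. KK (- x + z)) \<le> epow p (ennreal (w x)) * enr p w KK"
      using that by (intro enr_left_translate) auto
    also have "\<dots> < top" using enr_KK[OF that] by (simp add: ennreal_mult_less_top)
    finally show ?thesis by (simp add: G_eq[abs_def])
  qed
  have gK_int: "integrable \<mu> (\<lambda>y. g y * K (- y + z))" for z
    using G_fin[of z] by (intro integrable_conv) (auto simp: G_def)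
  have Vx: "V (\<pi> x u) z = (\<integral>y. g y * K (- y + z) \<partial>\<mu>)" for z
    using conv_translate[of K K x z] by (simp add: V_pi conv_K_K g_def conv_def)
  define e1 where "e1 n z = (\<integral>\<^sup>+y. indicator (- D n) y * (cnorm g y * cnorm K (- y + z)) \<partial>\<mu>)" for n z
  define e2 where "e2 n z = (\<integral>\<^sup>+y. (indicator (D n) y * cnorm g y) * cnorm (\<lambda>z. K (- y + z) - K (- s n y + z)) z \<partial>\<mu>)" for n z
  have [measurable]: "e1 n \<in> borel_measurable borel" "e2 n \<in> borel_measurable borel" for n
    unfolding e1_def e2_def by measurable
  have err: "cnorm (V (\<pi> x u - v n)) z \<le> e1 n z + e2 n z" for n z
  proof -
    have "V (\<pi> x u - v n) z = (\<integral>y. g y * K (- y + z) - gn n y * K (- s n y + z) \<partial>\<mu>)"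
      unfolding V_diff Vx Vv by (rule Bochner_Integration.integral_diff[symmetric]) (rule gK_int Vint)+
    then have "cnorm (V (\<pi> x u - v n)) z \<le> (\<integral>\<^sup>+y. cnorm (\<lambda>y. g y * K (- y + z) - gn n y * K (- s n y + z)) y \<partial>\<mu>)"
      using ennreal_norm_integral_le[of \<mu> "\<lambda>y. g y * K (- y + z) - gn n y * K (- s n y + z)"] by simp
    also have "\<dots> = (\<integral>\<^sup>+y. indicator (- D n) y * (cnorm g y * cnorm K (- y + z))
        + (indicator (D n) y * cnorm g y) * cnorm (\<lambda>z. K (- y + z) - K (- s n y + z)) z \<partial>\<mu>)"
      by (intro nn_integral_cong)
         (auto simp: gn_def indicator_def ennreal_mult[symmetric] norm_mult[symmetric] right_diff_distrib)
    also have "\<dots> = e1 n z + e2 n z" unfolding e1_def e2_def by (rule nn_integral_add) measurable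
    finally show ?thesis .
  qed
  have e1_lim: "(\<lambda>n. e1 n z) \<longlonglongrightarrow> 0" for z
  proof -
    have "(\<lambda>n. e1 n z) \<longlonglongrightarrow> (\<integral>\<^sup>+y. 0 \<partial>\<mu>)"
      unfolding e1_def
    proof (rule nn_integral_dominated_convergence[where w = "\<lambda>y. cnorm g y * cnorm K (- y + z)"])
      show "(\<integral>\<^sup>+y. cnorm g y * cnorm K (- y + z) \<partial>\<mu>) < \<infinity>"
        using G_fin[of z] by (simp add: G_def nconv_def)
      show "AE y in \<mu>. (\<lambda>n. indicator (- D n) y * (cnorm g y * cnorm K (- y + z))) \<longlonglongrightarrow> 0"
      proof (rule AE_I2)
        fix y
        obtain k where "y \<in> D k" using D(3) by blast
        then have "eventually (\<lambda>n. 0 = indicator (- D n) y * (cnorm g y * cnorm K (- y + z))) sequentially"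
          using D(2) by (intro eventually_sequentiallyI[of k]) (auto simp: indicator_def incseq_def)
        then show "(\<lambda>n. indicator (- D n) y * (cnorm g y * cnorm K (- y + z))) \<longlonglongrightarrow> 0"
          by (rule Lim_transform_eventually[OF tendsto_const])
      qed
    qed (auto simp: indicator_def)
    then show ?thesis by simp
  qed
  have e1_le: "e1 n z \<le> G z" for n z
    unfolding e1_def G_def nconv_def by (intro nn_integral_mono) (auto simp: indicator_def)
  have e1_enr: "(\<lambda>n. enr p w (e1 n)) \<longlonglongrightarrow> 0" if "1 < p" for p
  proof -
    have "(\<lambda>n. enr p w (e1 n)) \<longlonglongrightarrow> (\<integral>\<^sup>+z. 0 \<partial>\<mu>)"
      unfolding enr_def
    proof (rule nn_integral_dominated_convergence[where w = "\<lambda>z. epow p (ennreal (w z) * G z)"])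
      show "AE z in \<mu>. epow p (ennreal (w z) * e1 n z) \<le> epow p (ennreal (w z) * G z)" for n
        using that by (intro AE_I2 epow_mono mult_left_mono e1_le) auto
      show "(\<integral>\<^sup>+z. epow p (ennreal (w z) * G z) \<partial>\<mu>) < \<infinity>"
        using G_enr[OF that] by (simp add: enr_def)
      show "AE z in \<mu>. (\<lambda>n. epow p (ennreal (w z) * e1 n z)) \<longlonglongrightarrow> 0"
      proof (intro AE_I2 epow_tendsto_0)
        fix z
        show "(\<lambda>n. ennreal (w z) * e1 n z) \<longlonglongrightarrow> 0"
          using ennreal_tendsto_cmult[OF _ e1_lim, of "ennreal (w z)" z] by simp
      qed (use that in simp)
    qed measurable
    then show ?thesis by simp
  qed
  have e2_enr: "enr p w (e2 n) \<le> epow p (ennreal (1 / (real n + 1))) * enr p w (cnorm K)" if "1 < p" for p n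
  proof -
    have "enr p w (e2 n) \<le> epow (p - 1) (mass n)
        * (\<integral>\<^sup>+y. (indicator (D n) y * cnorm g y) * enr p w (cnorm (\<lambda>z. K (- y + z) - K (- s n y + z))) \<partial>\<mu>)"
      unfolding e2_def mass_def by (rule enr_integral_le[OF that]) measurable
    also have "\<dots> \<le> epow (p - 1) (mass n)
        * (\<integral>\<^sup>+y. (indicator (D n) y * cnorm g y) * (epow p (ennreal (e n)) * enr p w (cnorm K)) \<partial>\<mu>)"
    proof (rule mult_left_mono, rule nn_integral_mono)
      fix y
      show "(indicator (D n) y * cnorm g y) * enr p w (cnorm (\<lambda>z. K (- y + z) - K (- s n y + z)))
          \<le> (indicator (D n) y * cnorm g y) * (epow p (ennreal (e n)) * enr p w (cnorm K))"
      proof (cases "y \<in> D n")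
        case True
        have "enr p w (cnorm (\<lambda>z. K (- y + z) - K (- s n y + z))) \<le> epow p (shiftdist y (s n y)) * enr p w (cnorm K)"
          by (rule enr_K_diff[OF that])
        also have "\<dots> \<le> epow p (ennreal (e n)) * enr p w (cnorm K)"
          using that sd[OF True] by (intro mult_right_mono epow_mono) auto
        finally show ?thesis by (rule mult_left_mono) simp
      qed simp
    qed auto
    also have "\<dots> = epow (p - 1) (mass n) * (mass n * (epow p (ennreal (e n)) * enr p w (cnorm K)))"
      unfolding mass_def by (subst nn_integral_multc) auto
    \<comment> \<open>The power p - 1 of the mass from Jensen and the remaining mass combine with
      the p-th power of e n; the choice of e n bounds the product.\<close>
    also have "\<dots> = epow p (mass n * ennreal (e n)) * enr p w (cnorm K)"
      using epow_add[of "p - 1" 1 "mass n"] by (simp add: epow_mult mult.assoc)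
    also have "\<dots> \<le> epow p (ennreal (1 / (real n + 1))) * enr p w (cnorm K)"
      using that mass_e by (intro mult_right_mono epow_mono) auto
    finally show ?thesis .
  qed
  have lim: "(\<lambda>n. enr p w (cnorm (V (\<pi> x u - v n)))) \<longlonglongrightarrow> 0" if p: "1 < p" for p
  proof (rule tendsto_sandwich[OF _ _ tendsto_const])
    show "eventually (\<lambda>n. enr p w (cnorm (V (\<pi> x u - v n))) \<le>
       ennreal (2 powr p) * (enr p w (e1 n) + epow p (ennreal (1 / (real n + 1))) * enr p w (cnorm K))) sequentially"
    proof (rule always_eventually, rule allI)
      fix n
      have "enr p w (cnorm (V (\<pi> x u - v n))) \<le> ennreal (2 powr p) * (enr p w (e1 n) + enr p w (e2 n))"
        using p err by (intro enr_add_le) auto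
      also have "\<dots> \<le> ennreal (2 powr p) * (enr p w (e1 n) + epow p (ennreal (1 / (real n + 1))) * enr p w (cnorm K))"
        by (intro mult_left_mono add_left_mono e2_enr[OF p]) auto
      finally show "enr p w (cnorm (V (\<pi> x u - v n))) \<le> \<dots>" .
    qed
    have "(\<lambda>n. 1 / (real n + 1)) \<longlonglongrightarrow> 0"
      using LIMSEQ_inverse_real_of_nat by (simp add: inverse_eq_divide add.commute)
    then have "(\<lambda>n. ennreal (1 / (real n + 1))) \<longlonglongrightarrow> ennreal 0" by (rule tendsto_ennrealI)
    then have "(\<lambda>n. epow p (ennreal (1 / (real n + 1)))) \<longlonglongrightarrow> 0" using p by (intro epow_tendsto_0) auto
    then have "(\<lambda>n. enr p w (cnorm K) * epow p (ennreal (1 / (real n + 1)))) \<longlonglongrightarrow> enr p w (cnorm K) * 0"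
      by (intro ennreal_tendsto_cmult enr_K p)
    then have "(\<lambda>n. enr p w (e1 n) + epow p (ennreal (1 / (real n + 1))) * enr p w (cnorm K)) \<longlonglongrightarrow> 0 + 0"
      by (intro tendsto_add e1_enr p) (simp add: mult.commute)
    then have "(\<lambda>n. ennreal (2 powr p) * (enr p w (e1 n) + epow p (ennreal (1 / (real n + 1))) * enr p w (cnorm K)))
       \<longlonglongrightarrow> ennreal (2 powr p) * (0 + 0)"
      by (intro ennreal_tendsto_cmult) auto
    then show "(\<lambda>n. ennreal (2 powr p) * (enr p w (e1 n) + epow p (ennreal (1 / (real n + 1))) * enr p w (cnorm K)))
       \<longlonglongrightarrow> 0" by simp
  qed simp
  show ?thesis
  proof (rule that[of D s e v])
    show "(\<integral>\<^sup>+y. indicator (D n) y * cnorm K (- x + y) \<partial>\<mu>) * ennreal (e n) \<le> ennreal (1 / (real n + 1))" for n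
      using mass_e[of n] by (simp add: mass_def g_def)
    show "integrable \<mu> (\<lambda>y. indicator (D n) y * K (- x + y))" for n
      using gn_int[of n] by (simp add: gn_def[abs_def] g_def)
    show "v n = (\<Sum>d\<in>range (s n). sc (\<integral>y. of_bool (s n y = d) * (indicator (D n) y * K (- x + y)) \<partial>\<mu>) (\<pi> d u))" for n
      by (simp add: v_def gn_def g_def)
  qed (fact D s sm e sd lim)+
qed

text \<open>Applying T to the Riemann sums for \<pi>(x)u gives Riemann sums of the integral F * K at
  x. Continuity of T enters twice: for the convergence of the vectors, and for the oscillation of F
  between a point and its node, which \<open>shiftdist\<close> controls through the seminorm
  bound.\<close>

lemma reproducing_formula:
  assumes r: "1 < r" and m: "moderate w m" and T: "T \<in> antidual \<mu> sc ip \<pi> u w"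
    and L: "Ve \<pi> u T \<in> Lpw \<mu> r m"
  shows "conv \<mu> (Ve \<pi> u T) K = Ve \<pi> u T"
proof
  fix x
  define F where "F = Ve \<pi> u T"
  have [measurable]: "F \<in> borel_measurable borel" and F: "enr r m (cnorm F) < top"
    using L measurable_moderate[OF m] moderate_nonneg[OF m] by (auto simp: F_def Lpw_iff)
  obtain D :: "nat \<Rightarrow> 'g set" and s v e where D: "\<And>n. compact (D n)" "incseq D" "(\<Union>n. D n) = UNIV"
    and s: "\<And>n. finite (range (s n))" and sm: "\<And>n. s n \<in> measurable borel (count_space UNIV)"
    and e: "\<And>n. 0 < e n" and sd: "\<And>n y. y \<in> D n \<Longrightarrow> shiftdist y (s n y) \<le> ennreal (e n)"
    and mass: "\<And>n. (\<integral>\<^sup>+y. indicator (D n) y * cnorm K (- x + y) \<partial>\<mu>) * ennreal (e n) \<le> ennreal (1 / (real n + 1))"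
    and gn_int: "\<And>n. integrable \<mu> (\<lambda>y. indicator (D n) y * K (- x + y))"
    and v: "\<And>n. v n = (\<Sum>d\<in>range (s n). sc (\<integral>y. of_bool (s n y = d) * (indicator (D n) y * K (- x + y)) \<partial>\<mu>) (\<pi> d u))"
    and lim: "\<And>p. 1 < p \<Longrightarrow> (\<lambda>n. enr p w (cnorm (V (\<pi> x u - v n)))) \<longlonglongrightarrow> 0"
    by (rule riemann_approximation[of x]) (rule that)
  have [measurable]: "D n \<in> sets borel" for n using D(1) by simp
  obtain P C where P: "finite P" "P \<subseteq> {1<..}" and C: "0 \<le> C"
    and bound: "\<And>v. v \<in> S \<Longrightarrow> cmod (T v) \<le> C * (\<Sum>p\<in>P. Lpw_norm \<mu> p w (V v))"
    using T_bound[OF T] by metis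
  have vS: "v n \<in> S" for n
    unfolding v by (intro S_sum S_sc S_pi)
  let ?g = "\<lambda>n y. indicator (D n) y * K (- x + y)"
  have sm': "s n \<in> measurable \<mu> (count_space UNIV)" for n using sm[of n] by simp
  have "(\<lambda>n. T (\<pi> x u - v n)) \<longlonglongrightarrow> 0"
  proof (rule Lim_null_comparison)
    show "eventually (\<lambda>n. norm (T (\<pi> x u - v n)) \<le> C * (\<Sum>p\<in>P. Lpw_norm \<mu> p w (V (\<pi> x u - v n)))) sequentially"
      using bound S_diff[OF S_pi vS] by (intro always_eventually allI) auto
    have "(\<lambda>n. C * (\<Sum>p\<in>P. Lpw_norm \<mu> p w (V (\<pi> x u - v n)))) \<longlonglongrightarrow> C * (\<Sum>p\<in>P. 0)"
      using P(2) by (intro tendsto_mult_left tendsto_sum Lpw_norm_tendsto_0 lim) auto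
    then show "(\<lambda>n. C * (\<Sum>p\<in>P. Lpw_norm \<mu> p w (V (\<pi> x u - v n)))) \<longlonglongrightarrow> 0" by simp
  qed
  then have lim1: "(\<lambda>n. T (\<pi> x u) - T (v n)) \<longlonglongrightarrow> 0"
    by (simp add: T_diff[OF T S_pi vS])
  have Tv: "T (v n) = (\<integral>y. cnj (?g n y) * F (s n y) \<partial>\<mu>)" for n
  proof -
    have int: "integrable \<mu> (\<lambda>y. cnj (?g n y))" using gn_int[of n] by (rule integrable_cnj)
    have "cnj (\<integral>y. of_bool (s n y = d) * ?g n y \<partial>\<mu>) = (\<integral>y. of_bool (s n y = d) * cnj (?g n y) \<partial>\<mu>)" for d
      by (subst Bochner_Integration.integral_cnj[symmetric])
         (auto intro!: Bochner_Integration.integral_cong simp: of_bool_def)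
    then have "T (v n) = (\<Sum>d\<in>range (s n). (\<integral>y. of_bool (s n y = d) * cnj (?g n y) \<partial>\<mu>) * F d)"
      unfolding v by (simp add: T_sum[OF T] T_sc[OF T] S_sc S_pi F_def Ve_def)
    also have "\<dots> = (\<integral>y. cnj (?g n y) * F (s n y) \<partial>\<mu>)"
      by (rule integral_finite_range(1)[OF s sm' int])
    finally show ?thesis .
  qed
  have Tint: "integrable \<mu> (\<lambda>y. cnj (?g n y) * F (s n y))" for n
    by (rule integral_finite_range(2)[where \<phi> = F, OF s sm' integrable_cnj[OF gn_int]])
  have FK: "integrable \<mu> (\<lambda>y. F y * K (- y + x))"
    by (rule conv_K_integrable[OF r m]) (use F in auto)
  have FKn: "cnj (?g n y) * F y = indicator (D n) y *\<^sub>R (F y * K (- y + x))" for n y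
    using K_reflect[of y x] by (auto simp: indicator_def)
  have FKn_int: "integrable \<mu> (\<lambda>y. cnj (?g n y) * F y)" for n
    unfolding FKn using FK by (intro integrable_mult_indicator) auto
  \<comment> \<open>The continuity bound of T with the norms of K inserted: moving from y to its
    node \<open>s n y\<close> changes F by at most e n times this constant.\<close>
  define Q where "Q = C * (\<Sum>p\<in>P. Lpw_norm \<mu> p w K)"
  have Q: "0 \<le> Q" unfolding Q_def using C by (intro mult_nonneg_nonneg sum_nonneg) (auto simp: Lpw_norm_def)
  have Fdiff: "cmod (F (s n y) - F y) \<le> e n * Q" if "y \<in> D n" for n y
  proof -
    have "F y - F (s n y) = T (\<pi> y u - \<pi> (s n y) u)"
      by (simp add: F_def Ve_def T_diff[OF T S_pi S_pi])
    then have "cmod (F y - F (s n y)) \<le> C * (\<Sum>p\<in>P. Lpw_norm \<mu> p w (V (\<pi> y u - \<pi> (s n y) u)))"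
      using bound[OF S_diff[OF S_pi S_pi]] by simp
    also have "\<dots> \<le> C * (\<Sum>p\<in>P. e n * Lpw_norm \<mu> p w K)"
    proof (intro mult_left_mono sum_mono C)
      fix p assume "p \<in> P"
      then have p: "1 < p" using P(2) by auto
      have "Lpw_norm \<mu> p w (V (\<pi> y u - \<pi> (s n y) u)) \<le> (e n powr p) powr (1 / p) * Lpw_norm \<mu> p w K"
        using p enr_pi_diff[OF p sd[OF that]] e[of n] enr_K[OF p] by (intro Lpw_norm_le) auto
      then show "Lpw_norm \<mu> p w (V (\<pi> y u - \<pi> (s n y) u)) \<le> e n * Lpw_norm \<mu> p w K"
        using p e[of n] by (simp add: powr_powr)
    qed
    also have "\<dots> = e n * Q" by (simp add: Q_def sum_distrib_left mult_ac)
    finally show ?thesis by (simp add: norm_minus_commute)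
  qed
  have "(\<lambda>n. T (v n) - (\<integral>y. cnj (?g n y) * F y \<partial>\<mu>)) \<longlonglongrightarrow> 0"
  proof (rule Lim_null_comparison)
    have "cmod (T (v n) - (\<integral>y. cnj (?g n y) * F y \<partial>\<mu>)) \<le> 1 / (real n + 1) * Q" for n
    proof -
      have "T (v n) - (\<integral>y. cnj (?g n y) * F y \<partial>\<mu>) = (\<integral>y. cnj (?g n y) * (F (s n y) - F y) \<partial>\<mu>)"
        unfolding Tv right_diff_distrib by (rule Bochner_Integration.integral_diff[symmetric]) (rule Tint FKn_int)+
      then have "cnorm (\<lambda>n. T (v n) - (\<integral>y. cnj (?g n y) * F y \<partial>\<mu>)) n
          \<le> (\<integral>\<^sup>+y. cnorm (\<lambda>y. cnj (?g n y) * (F (s n y) - F y)) y \<partial>\<mu>)"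
        using ennreal_norm_integral_le[of \<mu> "\<lambda>y. cnj (?g n y) * (F (s n y) - F y)"] by simp
      also have "\<dots> \<le> (\<integral>\<^sup>+y. (indicator (D n) y * cnorm K (- x + y)) * (ennreal (e n) * ennreal Q) \<partial>\<mu>)"
      proof (rule nn_integral_mono)
        fix y
        show "cnorm (\<lambda>y. cnj (?g n y) * (F (s n y) - F y)) y \<le> (indicator (D n) y * cnorm K (- x + y)) * (ennreal (e n) * ennreal Q)"
        proof (cases "y \<in> D n")
          case True
          have "cmod (K (- x + y)) * cmod (F (s n y) - F y) \<le> cmod (K (- x + y)) * (e n * Q)"
            by (intro mult_left_mono Fdiff[OF True]) auto
          then show ?thesis
            using True Q e[of n] by (simp add: norm_mult ennreal_mult[symmetric] less_imp_le ennreal_leI)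
        qed simp
      qed
      also have "\<dots> = (\<integral>\<^sup>+y. indicator (D n) y * cnorm K (- x + y) \<partial>\<mu>) * (ennreal (e n) * ennreal Q)"
        by (rule nn_integral_multc) measurable
      also have "\<dots> = ((\<integral>\<^sup>+y. indicator (D n) y * cnorm K (- x + y) \<partial>\<mu>) * ennreal (e n)) * ennreal Q"
        by (simp add: mult.assoc)
      also have "\<dots> \<le> ennreal (1 / (real n + 1)) * ennreal Q"
        by (intro mult_right_mono mass) auto
      finally show ?thesis using Q by (simp add: ennreal_mult[symmetric])
    qed
    then show "eventually (\<lambda>n. norm (T (v n) - (\<integral>y. cnj (?g n y) * F y \<partial>\<mu>)) \<le> 1 / (real n + 1) * Q) sequentially"
      by (intro always_eventually allI)
    have "(\<lambda>n. 1 / (real n + 1)) \<longlonglongrightarrow> 0"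
      using LIMSEQ_inverse_real_of_nat by (simp add: inverse_eq_divide add.commute)
    then show "(\<lambda>n. 1 / (real n + 1) * Q) \<longlonglongrightarrow> 0"
      by (rule tendsto_mult_left_zero)
  qed
  from tendsto_add[OF lim1 this]
  have lim2: "(\<lambda>n. T (\<pi> x u) - (\<integral>y. cnj (?g n y) * F y \<partial>\<mu>)) \<longlonglongrightarrow> 0" by simp
  \<comment> \<open>The discretization is gone; it remains to let D n exhaust the group, with |F(y)
    K(y^{-1} x)| as integrable majorant.\<close>
  have lim3: "(\<lambda>n. \<integral>y. cnj (?g n y) * F y \<partial>\<mu>) \<longlonglongrightarrow> conv \<mu> F K x"
    unfolding conv_def FKn
  proof (rule integral_dominated_convergence[where w = "\<lambda>y. norm (F y * K (- y + x))"])
    show "AE y in \<mu>. (\<lambda>n. indicator (D n) y *\<^sub>R (F y * K (- y + x))) \<longlonglongrightarrow> F y * K (- y + x)"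
    proof (rule AE_I2)
      fix y
      obtain k where "y \<in> D k" using D(3) by blast
      then have "eventually (\<lambda>n. F y * K (- y + x) = indicator (D n) y *\<^sub>R (F y * K (- y + x))) sequentially"
        using D(2) by (intro eventually_sequentiallyI[of k]) (auto simp: indicator_def incseq_def)
      then show "(\<lambda>n. indicator (D n) y *\<^sub>R (F y * K (- y + x))) \<longlonglongrightarrow> F y * K (- y + x)"
        by (rule Lim_transform_eventually[OF tendsto_const])
    qed
  qed (use FK in \<open>auto simp: indicator_def\<close>)
  have "(\<lambda>n. T (\<pi> x u) - (\<integral>y. cnj (?g n y) * F y \<partial>\<mu>)) \<longlonglongrightarrow> T (\<pi> x u) - conv \<mu> F K x"
    by (intro tendsto_diff tendsto_const lim3)
  with lim2 have "T (\<pi> x u) - conv \<mu> F K x = 0" by (rule LIMSEQ_unique[rotated])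
  then show "conv \<mu> (Ve \<pi> u T) K x = Ve \<pi> u T x" by (simp add: F_def Ve_def)
qed

end

section \<open>Sampling and synthesis\<close>

lemma measurable_pair_count_space:
  assumes "countable (UNIV :: 'i set)" and "\<And>i::'i. (\<lambda>x. f x i) \<in> measurable M N"
  shows "(\<lambda>(x, i). f x i) \<in> measurable (M \<Otimes>\<^sub>M count_space UNIV) N"
  unfolding split_beta'
proof (rule measurable_compose_countable'[where f = "\<lambda>i p. f (fst p) i" and g = snd and I = UNIV])
  show "(\<lambda>p. f (fst p) i) \<in> measurable (M \<Otimes>\<^sub>M count_space UNIV) N" for i
    by (rule measurable_compose[OF measurable_fst assms(2)])
qed (use assms in auto)

lemma summable_on_iff_nn_integral:
  fixes f :: "'i \<Rightarrow> real"
  assumes f: "\<And>i. 0 \<le> f i"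
  shows "f summable_on UNIV \<longleftrightarrow> (\<integral>\<^sup>+i. ennreal (f i) \<partial>count_space UNIV) < top"
    and nn_integral_eq_infsum:
      "f summable_on UNIV \<Longrightarrow> (\<integral>\<^sup>+i. ennreal (f i) \<partial>count_space UNIV) = ennreal (infsum f UNIV)"
proof -
  have iff: "f summable_on UNIV \<longleftrightarrow> integrable (count_space UNIV) f"
  proof -
    have "f summable_on UNIV \<longleftrightarrow> (\<lambda>i. norm (f i)) summable_on UNIV" using f by simp
    also have "\<dots> \<longleftrightarrow> Infinite_Set_Sum.abs_summable_on f UNIV" by (rule abs_summable_equivalent)
    finally show ?thesis by (simp add: Infinite_Set_Sum.abs_summable_on_def)
  qed
  then show "f summable_on UNIV \<longleftrightarrow> (\<integral>\<^sup>+i. ennreal (f i) \<partial>count_space UNIV) < top"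
    using f by (simp add: integrable_iff_bounded)
  assume "f summable_on UNIV"
  with iff have int: "integrable (count_space UNIV) f" by simp
  then have "(\<integral>i. f i \<partial>count_space UNIV) = infsum f UNIV"
    using infsetsum_infsum[of f UNIV] by (simp add: Infinite_Set_Sum.abs_summable_on_def infsetsum_def)
  then show "(\<integral>\<^sup>+i. ennreal (f i) \<partial>count_space UNIV) = ennreal (infsum f UNIV)"
    using nn_integral_eq_integral[OF int] f by simp
qed

locale sampled_coorbit = coorbit \<mu> w sc ip \<pi> u W U
  for \<mu> :: "'g::{group_add, topological_space, t2_space, second_countable_topology} measure"
    and w :: "'g \<Rightarrow> real"
    and sc :: "complex \<Rightarrow> 'h::ab_group_add \<Rightarrow> 'h"
    and ip :: "'h \<Rightarrow> 'h \<Rightarrow> complex"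
    and \<pi> :: "'g \<Rightarrow> 'h \<Rightarrow> 'h"
    and u :: 'h
    and W :: "'g \<Rightarrow> complex"
    and U :: "'g set" +
  fixes X :: "'i \<Rightarrow> 'g" and \<psi> :: "'i \<Rightarrow> 'g \<Rightarrow> real"
  assumes bupu: "bupu U X \<psi>"
begin

lemma mem_translate: "x \<in> (\<lambda>q. a + q) ` U \<longleftrightarrow> - a + x \<in> U"
proof
  assume "- a + x \<in> U"
  then show "x \<in> (\<lambda>q. a + q) ` U"
    by (intro image_eqI[of _ _ "- a + x"]) (simp_all add: add.assoc[symmetric])
qed (auto simp: add.assoc[symmetric])

lemma overlap: "\<exists>N::nat. \<forall>x. finite {i. - X i + x \<in> U} \<and> card {i. - X i + x \<in> U} \<le> N"
proof -
  have "\<exists>N::nat. \<forall>x. finite {i. x \<in> (\<lambda>q. X i + q) ` U} \<and> card {i. x \<in> (\<lambda>q. X i + q) ` U} \<le> N"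
    using bupu U unfolding bupu_def rel_separated_def by blast
  then show ?thesis by (simp only: mem_translate)
qed

lemma measurable_psi [measurable]: "\<psi> i \<in> borel_measurable borel"
  and psi_nonneg [simp]: "0 \<le> \<psi> i y" and psi_le_1: "\<psi> i y \<le> 1"
  and psi_support: "- X i + y \<notin> U \<Longrightarrow> \<psi> i y = 0" and psi_sum: "((\<lambda>i. \<psi> i y) has_sum 1) UNIV"
  using bupu by (auto simp: bupu_def mem_translate)

text \<open>Every x_i U contains a point of a countable dense set, and each such point lies in
  finitely many x_i U. Countability makes the counting measure sigma-finite, so sums over I take
  part in Fubini.\<close>

lemma countable_index: "countable (UNIV :: 'i set)"
proof -
  obtain D :: "'g set" where D: "countable D" "\<And>A. open A \<Longrightarrow> A \<noteq> {} \<Longrightarrow> \<exists>d\<in>D. d \<in> A"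
    by (rule countable_dense_setE) blast
  have "UNIV \<subseteq> (\<Union>d\<in>D. {i. - X i + d \<in> U})"
  proof
    fix i
    have "open ((\<lambda>y. - X i + y) -` interior U)" by (intro open_vimage continuous_intros) auto
    moreover have "X i \<in> (\<lambda>y. - X i + y) -` interior U" using U by (simp add: unit_nbhd_def)
    ultimately obtain d where "d \<in> D" "- X i + d \<in> interior U" using D(2) by blast
    then show "i \<in> (\<Union>d\<in>D. {i. - X i + d \<in> U})" using interior_subset by auto
  qed
  moreover have "countable (\<Union>d\<in>D. {i. - X i + d \<in> U})"
    using D(1) overlap by (intro countable_UN) (auto intro: countable_finite)
  ultimately show ?thesis using countable_subset by blast
qed

abbreviation cs :: "'i measure" where "cs \<equiv> count_space UNIV"

sublocale I: sigma_finite_measure cs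
  by (rule sigma_finite_measure_count_space_countable[OF countable_index])

lemma measurable_nn_integral_index [measurable (raw)]:
  assumes "\<And>i. f i \<in> borel_measurable M"
  shows "(\<lambda>x. \<integral>\<^sup>+i. f i x \<partial>cs) \<in> borel_measurable M"
  by (rule I.borel_measurable_nn_integral, rule measurable_pair_count_space[OF countable_index assms])

lemma measurable_integral_index [measurable (raw)]:
  fixes f :: "'i \<Rightarrow> 'a \<Rightarrow> complex"
  assumes "\<And>i. f i \<in> borel_measurable M"
  shows "(\<lambda>x. \<integral>i. f i x \<partial>cs) \<in> borel_measurable M"
  by (rule I.borel_measurable_lebesgue_integral, rule measurable_pair_count_space[OF countable_index assms])

lemma psi_nn_sum: "(\<integral>\<^sup>+i. ennreal (\<psi> i y) \<partial>cs) = 1"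
  using nn_integral_eq_infsum[of "\<lambda>i. \<psi> i y"] psi_sum[of y]
  by (simp add: has_sum_imp_summable infsumI)

lemma U_measure: "emeasure \<mu> U \<noteq> 0" "emeasure \<mu> U \<noteq> top"
proof -
  have "0 < emeasure \<mu> (interior U)" using U by (intro emeasure_open) (auto simp: unit_nbhd_def)
  also have "\<dots> \<le> emeasure \<mu> U" using interior_subset by (intro emeasure_mono) auto
  finally show "emeasure \<mu> U \<noteq> 0" by simp
  show "emeasure \<mu> U \<noteq> top" using emeasure_compact[OF compact_U] by simp
qed

lemma w_bounded: "\<exists>C\<ge>0. \<forall>q\<in>U. w q \<le> C"
proof -
  have "continuous_on U w" using wt by (auto simp: weight_def intro: continuous_on_subset)
  then have "bounded (w ` U)"
    using compact_U by (intro compact_imp_bounded compact_continuous_image)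
  then obtain C where C: "\<And>q. q \<in> U \<Longrightarrow> norm (w q) \<le> C" unfolding bounded_iff by auto
  moreover have "0 \<le> C" using C[OF zero_in_U] norm_ge_zero order_trans by blast
  ultimately show ?thesis by (intro exI[of _ C]) auto
qed

lemma indicator_U_integral: "(\<integral>\<^sup>+y. indicator U (- a + y) \<partial>\<mu>) = emeasure \<mu> U"
  using nn_integral_left[of "indicator U" "- a"] by simp

section \<open>Sampling and synthesis operators\<close>

definition coef :: "('g \<Rightarrow> complex) \<Rightarrow> 'i \<Rightarrow> complex" where
  "coef F i = (\<integral>y. complex_of_real (\<psi> i y) * F y \<partial>\<mu>)"

text \<open>The sum is a Bochner integral over the counting measure, which puts it within reach of
  Fubini. Where it diverges its value is 0; for c in the weighted sequence space this happens at
  most on a null set.\<close>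

definition synW :: "('i \<Rightarrow> complex) \<Rightarrow> 'g \<Rightarrow> complex" where
  "synW c x = (\<integral>i. c i * W (- X i + x) \<partial>cs)"

definition nsynW :: "('i \<Rightarrow> ennreal) \<Rightarrow> 'g \<Rightarrow> ennreal" where
  "nsynW c x = (\<integral>\<^sup>+i. c i * cnorm W (- X i + x) \<partial>cs)"

text \<open>Formally the sum of c_i K(x_i^{-1} x). The detour through W gives it a meaning for
  infinitely many coefficients: the W series converges absolutely almost everywhere, whereas K is
  not controlled in L_1. For finite support both expressions agree, see
  \<open>synK_finite\<close>.\<close>

definition synK :: "('i \<Rightarrow> complex) \<Rightarrow> 'g \<Rightarrow> complex" where
  "synK c = conv \<mu> (synW c) K"

definition elw :: "real \<Rightarrow> ('g \<Rightarrow> real) \<Rightarrow> ('i \<Rightarrow> ennreal) \<Rightarrow> ennreal" where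
  "elw r m c = (\<integral>\<^sup>+i. epow r (ennreal (m (X i)) * c i) \<partial>cs)"

lemma measurable_synW [measurable]: "synW c \<in> borel_measurable borel"
  unfolding synW_def by measurable

lemma measurable_nsynW [measurable]: "nsynW c \<in> borel_measurable borel"
  unfolding nsynW_def by measurable

lemma measurable_synK [measurable]: "synK c \<in> borel_measurable borel"
  unfolding synK_def by measurable

lemma cnorm_synW_le: "cnorm (synW c) x \<le> nsynW (cnorm c) x"
  unfolding synW_def nsynW_def
  using ennreal_norm_integral_le[of cs "\<lambda>i. c i * W (- X i + x)"] by (simp add: norm_mult ennreal_mult)

lemma elw_mono: "0 < r \<Longrightarrow> (\<And>i. c i \<le> d i) \<Longrightarrow> elw r m c \<le> elw r m d"
  unfolding elw_def by (intro nn_integral_mono epow_mono mult_left_mono) auto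

text \<open>Averaging over \<open>y \<in> X i U\<close> bounds the sample at \<open>X i\<close> by the local maximal
  function; finite overlap then bounds the sum over the samples.\<close>

lemma sampled_W_sum:
  "\<exists>B<top. \<forall>x. (\<integral>\<^sup>+i. ennreal (w (- X i + x)) * cnorm W (- X i + x) \<partial>cs) \<le> B"
proof -
  obtain C where C: "0 \<le> C" "\<And>q. q \<in> U \<Longrightarrow> w q \<le> C" using w_bounded by blast
  obtain N :: nat where N: "\<And>x. finite {i. - X i + x \<in> U}" "\<And>x. card {i. - X i + x \<in> U} \<le> N"
    using overlap by blast
  define J where "J = (\<integral>\<^sup>+x. ennreal (w x / modular \<mu> x) * ennreal (maxW x) \<partial>\<mu>)"
  let ?g = "\<lambda>z. ennreal (w z) * cnorm W z" and ?G = "\<lambda>z. ennreal (w z) * ennreal (maxW z)"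
  \<comment> \<open>Reflection makes this integral independent of x, at the price of 1/\<Delta>; the
    uniformity in x of the final bound stems from here.\<close>
  have J: "(\<integral>\<^sup>+y. ?G (- y + x) \<partial>\<mu>) = J" for x
  proof -
    have "(\<integral>\<^sup>+y. ?G (- y + x) \<partial>\<mu>) = (\<integral>\<^sup>+y. ?G y * ennreal (1 / modular \<mu> y) \<partial>\<mu>)"
      by (rule nn_integral_reflect) measurable
    also have "\<dots> = J" unfolding J_def
      using modular_pos by (intro nn_integral_cong) (simp add: mult_ac less_imp_le ennreal_mult'[symmetric])
    finally show ?thesis .
  qed
  have pt: "?g (- X i + x) * indicator U (- X i + y) \<le> indicator U (- X i + y) * (ennreal C * ?G (- y + x))" for i x y
  proof (cases "- X i + y \<in> U")
    case True
    have eq: "- X i + x = (- X i + y) + (- y + x)" by (simp add: add.assoc)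
    have "cmod (W (- X i + x)) \<le> maxW (- y + x)"
      unfolding eq by (rule W_le_maxW[OF True])
    moreover have "w (- X i + x) \<le> C * w (- y + x)"
      unfolding eq using w_plus[of "- X i + y" "- y + x"] C(2)[OF True]
      by (meson mult_right_mono order_trans w_nonneg)
    ultimately have "w (- X i + x) * cmod (W (- X i + x)) \<le> (C * w (- y + x)) * maxW (- y + x)"
      using C by (intro mult_mono) auto
    then show ?thesis using True C by (simp add: ennreal_mult[symmetric] mult.assoc ennreal_leI)
  qed simp
  have main: "(\<integral>\<^sup>+i. ?g (- X i + x) \<partial>cs) * emeasure \<mu> U \<le> of_nat N * (ennreal C * J)" for x
  proof -
    have "(\<integral>\<^sup>+i. ?g (- X i + x) \<partial>cs) * emeasure \<mu> U = (\<integral>\<^sup>+i. ?g (- X i + x) * emeasure \<mu> U \<partial>cs)"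
      by (rule nn_integral_multc[symmetric]) simp
    also have "\<dots> = (\<integral>\<^sup>+i. \<integral>\<^sup>+y. ?g (- X i + x) * indicator U (- X i + y) \<partial>\<mu> \<partial>cs)"
    proof (rule nn_integral_cong)
      fix i
      have "(\<integral>\<^sup>+y. ?g (- X i + x) * indicator U (- X i + y) \<partial>\<mu>) = ?g (- X i + x) * (\<integral>\<^sup>+y. indicator U (- X i + y) \<partial>\<mu>)"
        by (rule nn_integral_cmult) measurable
      then show "?g (- X i + x) * emeasure \<mu> U = (\<integral>\<^sup>+y. ?g (- X i + x) * indicator U (- X i + y) \<partial>\<mu>)"
        by (simp add: indicator_U_integral)
    qed
    also have "\<dots> \<le> (\<integral>\<^sup>+i. \<integral>\<^sup>+y. indicator U (- X i + y) * (ennreal C * ?G (- y + x)) \<partial>\<mu> \<partial>cs)"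
      by (intro nn_integral_mono pt)
    also have "\<dots> = (\<integral>\<^sup>+y. \<integral>\<^sup>+i. indicator U (- X i + y) * (ennreal C * ?G (- y + x)) \<partial>cs \<partial>\<mu>)"
      by (rule nn_integral_count_space_nn_integral[OF countable_index, symmetric]) measurable
    also have "\<dots> \<le> (\<integral>\<^sup>+y. of_nat N * (ennreal C * ?G (- y + x)) \<partial>\<mu>)"
    proof (rule nn_integral_mono)
      fix y
      have "(\<integral>\<^sup>+i. indicator U (- X i + y) * (ennreal C * ?G (- y + x)) \<partial>cs)
         = (\<integral>\<^sup>+i. indicator {i. - X i + y \<in> U} i \<partial>cs) * (ennreal C * ?G (- y + x))"
        by (subst nn_integral_multc[symmetric]) (auto intro!: nn_integral_cong simp: indicator_def)
      also have "(\<integral>\<^sup>+i. indicator {i. - X i + y \<in> U} i \<partial>cs) = of_nat (card {i. - X i + y \<in> U})"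
        using N(1)[of y] by simp
      also have "\<dots> * (ennreal C * ?G (- y + x)) \<le> of_nat N * (ennreal C * ?G (- y + x))"
        using N(2)[of y] by (intro mult_right_mono) auto
      finally show "(\<integral>\<^sup>+i. indicator U (- X i + y) * (ennreal C * ?G (- y + x)) \<partial>cs) \<le> of_nat N * (ennreal C * ?G (- y + x))" .
    qed
    also have "\<dots> = (of_nat N * ennreal C) * (\<integral>\<^sup>+y. ?G (- y + x) \<partial>\<mu>)"
      by (subst nn_integral_cmult[symmetric]) (auto simp: mult.assoc)
    finally show ?thesis by (simp add: J mult.assoc)
  qed
  have "of_nat N * (ennreal C * J) < top"
    using maxW_integrable_modular by (simp add: J_def ennreal_mult_less_top of_nat_less_top)
  then have fin: "of_nat N * (ennreal C * J) / emeasure \<mu> U < top"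
    using U_measure by (auto simp: less_top[symmetric] ennreal_divide_eq_top_iff)
  moreover have "(\<integral>\<^sup>+i. ?g (- X i + x) \<partial>cs) \<le> of_nat N * (ennreal C * J) / emeasure \<mu> U" for x
  proof -
    have "(\<integral>\<^sup>+i. ?g (- X i + x) \<partial>cs) = ((\<integral>\<^sup>+i. ?g (- X i + x) \<partial>cs) * emeasure \<mu> U) / emeasure \<mu> U"
      using U_measure by (simp add: ennreal_mult_divide_eq)
    also have "\<dots> \<le> of_nat N * (ennreal C * J) / emeasure \<mu> U"
      by (intro divide_right_mono_ennreal main)
    finally show ?thesis .
  qed
  ultimately show ?thesis by blast
qed

context
  fixes r :: real and m :: "'g \<Rightarrow> real"
  assumes r: "1 < r" and m: "moderate w m"
begin

text \<open>A discrete counterpart of \<open>schur_right\<close>: the kernel (w |W|)(x_i^{-1} x) has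
  sums over i bounded by \<open>sampled_W_sum\<close>, and its integral in x is the L_{1,w} norm of
  W by left invariance.\<close>

lemma nsynW_bound: "\<exists>B<top. \<forall>c. enr r m (nsynW c) \<le> B * elw r m c"
proof -
  obtain A where A: "A < top" "\<And>x. (\<integral>\<^sup>+i. ennreal (w (- X i + x)) * cnorm W (- X i + x) \<partial>cs) \<le> A"
    using sampled_W_sum by blast
  note [measurable] = measurable_moderate[OF m]
  define L where "L = (\<integral>\<^sup>+x. ennreal (w x) * cnorm W x \<partial>\<mu>)"
  let ?g = "\<lambda>z. ennreal (w z) * cnorm W z"
  have "enr r m (nsynW c) \<le> epow (r - 1) A * L * elw r m c" for c
  proof -
    let ?h = "\<lambda>i. ennreal (m (X i)) * c i"
    have pt: "epow r (ennreal (m x) * nsynW c x) \<le> epow (r - 1) A * (\<integral>\<^sup>+i. ?g (- X i + x) * epow r (?h i) \<partial>cs)" for x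
    proof -
      have "ennreal (m x) * nsynW c x = (\<integral>\<^sup>+i. ennreal (m x) * (c i * cnorm W (- X i + x)) \<partial>cs)"
        unfolding nsynW_def by (rule nn_integral_cmult[symmetric]) simp
      also have "\<dots> \<le> (\<integral>\<^sup>+i. ?g (- X i + x) * ?h i \<partial>cs)"
      proof (rule nn_integral_mono)
        fix i
        have "ennreal (m x) \<le> ennreal (m (X i)) * ennreal (w (- X i + x))"
          using moderate_split[OF m, of x "X i"] moderate_nonneg[OF m] by (simp add: ennreal_mult[symmetric])
        from mult_right_mono[OF this, of "c i * cnorm W (- X i + x)"]
        show "ennreal (m x) * (c i * cnorm W (- X i + x)) \<le> ?g (- X i + x) * ?h i" by (simp add: mult_ac)
      qed
      finally have "epow r (ennreal (m x) * nsynW c x) \<le> epow r (\<integral>\<^sup>+i. ?g (- X i + x) * ?h i \<partial>cs)"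
        using r by (intro epow_mono) auto
      also have "\<dots> \<le> epow (r - 1) (\<integral>\<^sup>+i. ?g (- X i + x) \<partial>cs) * (\<integral>\<^sup>+i. ?g (- X i + x) * epow r (?h i) \<partial>cs)"
        by (rule nn_integral_jensen[OF r]) auto
      also have "\<dots> \<le> epow (r - 1) A * (\<integral>\<^sup>+i. ?g (- X i + x) * epow r (?h i) \<partial>cs)"
        using r by (intro mult_right_mono epow_mono A) auto
      finally show ?thesis .
    qed
    then have "enr r m (nsynW c) \<le> (\<integral>\<^sup>+x. epow (r - 1) A * (\<integral>\<^sup>+i. ?g (- X i + x) * epow r (?h i) \<partial>cs) \<partial>\<mu>)"
      unfolding enr_def by (rule nn_integral_mono)
    also have "\<dots> = epow (r - 1) A * (\<integral>\<^sup>+x. \<integral>\<^sup>+i. ?g (- X i + x) * epow r (?h i) \<partial>cs \<partial>\<mu>)"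
      by (rule nn_integral_cmult) measurable
    also have "(\<integral>\<^sup>+x. \<integral>\<^sup>+i. ?g (- X i + x) * epow r (?h i) \<partial>cs \<partial>\<mu>)
        = (\<integral>\<^sup>+i. \<integral>\<^sup>+x. ?g (- X i + x) * epow r (?h i) \<partial>\<mu> \<partial>cs)"
      by (rule nn_integral_count_space_nn_integral[OF countable_index]) measurable
    also have "\<dots> = (\<integral>\<^sup>+i. L * epow r (?h i) \<partial>cs)"
    proof (rule nn_integral_cong)
      fix i
      have "(\<integral>\<^sup>+x. ?g (- X i + x) * epow r (?h i) \<partial>\<mu>) = (\<integral>\<^sup>+x. ?g (- X i + x) \<partial>\<mu>) * epow r (?h i)"
        by (rule nn_integral_multc) measurable
      also have "(\<integral>\<^sup>+x. ?g (- X i + x) \<partial>\<mu>) = L"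
        unfolding L_def by (rule nn_integral_left) measurable
      finally show "(\<integral>\<^sup>+x. ?g (- X i + x) * epow r (?h i) \<partial>\<mu>) = L * epow r (?h i)" .
    qed
    also have "\<dots> = L * elw r m c" unfolding elw_def by (rule nn_integral_cmult) simp
    finally show ?thesis by (simp add: mult.assoc)
  qed
  moreover have "epow (r - 1) A * L < top"
    using A W_integrable by (simp add: L_def ennreal_mult_less_top)
  ultimately show ?thesis by blast
qed

text \<open>Jensen on each cell with density \<psi>_i, whose mass is at most that of U; on the cell
  m(x_i) is bounded by a multiple of m(y), since w is bounded on U. Summing over i uses that the
  \<psi>_i add up to 1.\<close>

lemma coef_bound: "\<exists>B<top. \<forall>F\<in>borel_measurable borel. elw r m (cnorm (coef F)) \<le> B * enr r m (cnorm F)"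
proof -
  obtain C where C: "0 \<le> C" "\<And>q. q \<in> U \<Longrightarrow> w q \<le> C" using w_bounded by blast
  note [measurable] = measurable_moderate[OF m]
  have "elw r m (cnorm (coef F)) \<le> epow (r - 1) (emeasure \<mu> U) * epow r (ennreal C) * enr r m (cnorm F)"
    if F [measurable]: "F \<in> borel_measurable borel" for F
  proof -
    let ?h = "\<lambda>y. ennreal C * (ennreal (m y) * cnorm F y)"
    have pt: "epow r (ennreal (m (X i)) * cnorm (coef F) i)
       \<le> epow (r - 1) (emeasure \<mu> U) * (\<integral>\<^sup>+y. ennreal (\<psi> i y) * epow r (?h y) \<partial>\<mu>)" for i
    proof -
      have "cnorm (coef F) i \<le> (\<integral>\<^sup>+y. ennreal (\<psi> i y) * cnorm F y \<partial>\<mu>)"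
        unfolding coef_def
        using ennreal_norm_integral_le[of \<mu> "\<lambda>y. complex_of_real (\<psi> i y) * F y"]
        by (simp add: norm_mult ennreal_mult)
      then have "ennreal (m (X i)) * cnorm (coef F) i \<le> ennreal (m (X i)) * (\<integral>\<^sup>+y. ennreal (\<psi> i y) * cnorm F y \<partial>\<mu>)"
        by (rule mult_left_mono) simp
      also have "\<dots> = (\<integral>\<^sup>+y. ennreal (m (X i)) * (ennreal (\<psi> i y) * cnorm F y) \<partial>\<mu>)"
        by (rule nn_integral_cmult[symmetric]) measurable
      also have "\<dots> \<le> (\<integral>\<^sup>+y. ennreal (\<psi> i y) * ?h y \<partial>\<mu>)"
      proof (rule nn_integral_mono)
        fix y
        show "ennreal (m (X i)) * (ennreal (\<psi> i y) * cnorm F y) \<le> ennreal (\<psi> i y) * ?h y"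
        proof (cases "- X i + y \<in> U")
          case True
          have "w (- y + X i) = w (- X i + y)" using w_minus[of "- X i + y"] by (simp add: minus_add)
          then have "m (X i) \<le> m y * w (- X i + y)"
            using moderate_split[OF m, of "X i" y] by simp
          also have "\<dots> \<le> m y * C" using C(2)[OF True] moderate_nonneg[OF m] by (intro mult_left_mono) auto
          finally have "ennreal (m (X i)) \<le> ennreal C * ennreal (m y)"
            using C(1) moderate_nonneg[OF m] by (simp add: ennreal_mult[symmetric] mult.commute ennreal_leI)
          from mult_right_mono[OF this, of "ennreal (\<psi> i y) * cnorm F y"]
          show ?thesis by (simp add: mult_ac)
        qed (simp add: psi_support)
      qed
      finally have "epow r (ennreal (m (X i)) * cnorm (coef F) i) \<le> epow r (\<integral>\<^sup>+y. ennreal (\<psi> i y) * ?h y \<partial>\<mu>)"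
        using r by (intro epow_mono) auto
      also have "\<dots> \<le> epow (r - 1) (\<integral>\<^sup>+y. ennreal (\<psi> i y) \<partial>\<mu>) * (\<integral>\<^sup>+y. ennreal (\<psi> i y) * epow r (?h y) \<partial>\<mu>)"
        by (rule nn_integral_jensen[OF r]) measurable
      also have "\<dots> \<le> epow (r - 1) (emeasure \<mu> U) * (\<integral>\<^sup>+y. ennreal (\<psi> i y) * epow r (?h y) \<partial>\<mu>)"
      proof (intro mult_right_mono epow_mono)
        have "(\<integral>\<^sup>+y. ennreal (\<psi> i y) \<partial>\<mu>) \<le> (\<integral>\<^sup>+y. indicator U (- X i + y) \<partial>\<mu>)"
          by (intro nn_integral_mono) (use psi_le_1 psi_support in \<open>auto simp: indicator_def\<close>)
        then show "(\<integral>\<^sup>+y. ennreal (\<psi> i y) \<partial>\<mu>) \<le> emeasure \<mu> U" by (simp add: indicator_U_integral)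
      qed (use r in auto)
      finally show ?thesis .
    qed
    then have "elw r m (cnorm (coef F)) \<le> (\<integral>\<^sup>+i. epow (r - 1) (emeasure \<mu> U) * (\<integral>\<^sup>+y. ennreal (\<psi> i y) * epow r (?h y) \<partial>\<mu>) \<partial>cs)"
      unfolding elw_def by (rule nn_integral_mono)
    also have "\<dots> = epow (r - 1) (emeasure \<mu> U) * (\<integral>\<^sup>+i. \<integral>\<^sup>+y. ennreal (\<psi> i y) * epow r (?h y) \<partial>\<mu> \<partial>cs)"
      by (rule nn_integral_cmult) simp
    also have "(\<integral>\<^sup>+i. \<integral>\<^sup>+y. ennreal (\<psi> i y) * epow r (?h y) \<partial>\<mu> \<partial>cs)
        = (\<integral>\<^sup>+y. \<integral>\<^sup>+i. ennreal (\<psi> i y) * epow r (?h y) \<partial>cs \<partial>\<mu>)"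
      by (rule nn_integral_count_space_nn_integral[OF countable_index, symmetric]) measurable
    also have "\<dots> = (\<integral>\<^sup>+y. epow r (?h y) \<partial>\<mu>)"
      by (subst nn_integral_multc) (auto simp: psi_nn_sum)
    also have "\<dots> = epow r (ennreal C) * enr r m (cnorm F)"
      unfolding enr_def epow_mult[of r "ennreal C"] by (rule nn_integral_cmult) measurable
    finally show ?thesis by (simp add: mult.assoc)
  qed
  moreover have "epow (r - 1) (emeasure \<mu> U) * epow r (ennreal C) < top"
    using U_measure by (simp add: ennreal_mult_less_top less_top)
  ultimately show ?thesis by blast
qed

lemma AE_finite_of_enr:
  assumes [measurable]: "f \<in> borel_measurable borel" and "enr r m f < top"
  shows "AE x in \<mu>. f x < top"
proof -
  note [measurable] = measurable_moderate[OF m]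
  have "AE x in \<mu>. epow r (ennreal (m x) * f x) \<noteq> \<infinity>"
    using assms(2) unfolding enr_def by (intro nn_integral_PInf_AE) auto
  then show ?thesis
  proof eventually_elim
    case (elim x)
    then show ?case using moderate_pos[OF m, of x]
      by (auto simp: ennreal_mult_eq_top_iff less_top)
  qed
qed

lemma enr_nconv_finite:
  assumes [measurable]: "f \<in> borel_measurable borel" "g \<in> borel_measurable borel" and "enr r m f < top"
    and "(\<integral>\<^sup>+x. ennreal (w x) * g x \<partial>\<mu>) < top" "(\<integral>\<^sup>+x. ennreal (w x / modular \<mu> x) * g x \<partial>\<mu>) < top"
  shows "enr r m (nconv f g) < top"
  by (rule le_less_trans[OF schur_right[OF r m]]) (use assms in \<open>auto simp: ennreal_mult_less_top\<close>)

text \<open>Inserting the partition of unity writes both terms as integrals over I x G. On the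
  support of \<psi>_i one has x_i^{-1} x = (x_i^{-1} y)(y^{-1} x) with first factor in U, so
  replacing y by x_i changes W by at most the oscillation at y^{-1} x. Fubini is available where the
  convolution of |F| with \<open>maxW\<close> is finite, hence almost everywhere.\<close>

lemma discretization_error:
  assumes [measurable]: "F \<in> borel_measurable borel" and F: "enr r m (cnorm F) < top"
  shows "AE x in \<mu>. cnorm (\<lambda>x. conv \<mu> F W x - synW (coef F) x) x \<le> nconv (cnorm F) (\<lambda>x. ennreal (osc U W x)) x"
proof -
  interpret P: pair_sigma_finite cs \<mu> ..
  have "AE x in \<mu>. nconv (cnorm F) (\<lambda>x. ennreal (maxW x)) x < top"
    using F maxW_integrable maxW_integrable_modular by (intro AE_finite_of_enr enr_nconv_finite) auto
  then show ?thesis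
  proof eventually_elim
    case (elim x)
    let ?A = "\<lambda>i y. complex_of_real (\<psi> i y) * (F y * W (- y + x))"
    let ?B = "\<lambda>i y. complex_of_real (\<psi> i y) * F y * W (- X i + x)"
    have close: "cmod (W (- X i + x)) \<le> maxW (- y + x)"
      "cmod (W (- y + x) - W (- X i + x)) \<le> osc U W (- y + x)" if "\<psi> i y \<noteq> 0" for i y
    proof -
      have U': "- X i + y \<in> U" using that psi_support by blast
      have eq: "- X i + x = (- X i + y) + (- y + x)" by (simp add: add.assoc)
      show "cmod (W (- X i + x)) \<le> maxW (- y + x)" unfolding eq by (rule W_le_maxW[OF U'])
      show "cmod (W (- y + x) - W (- X i + x)) \<le> osc U W (- y + x)"
        unfolding eq norm_minus_commute[of "W (- y + x)"] by (rule le_osc[OF U'])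
    qed
    have mono: "(\<integral>\<^sup>+i. \<integral>\<^sup>+y. ennreal (\<psi> i y) * (cnorm F y * ennreal (h (- y + x))) \<partial>\<mu> \<partial>cs) = nconv (cnorm F) (\<lambda>x. ennreal (h x)) x"
      if [measurable]: "h \<in> borel_measurable borel" for h :: "'g \<Rightarrow> real"
    proof -
      have "(\<integral>\<^sup>+i. \<integral>\<^sup>+y. ennreal (\<psi> i y) * (cnorm F y * ennreal (h (- y + x))) \<partial>\<mu> \<partial>cs)
          = (\<integral>\<^sup>+y. \<integral>\<^sup>+i. ennreal (\<psi> i y) * (cnorm F y * ennreal (h (- y + x))) \<partial>cs \<partial>\<mu>)"
        by (rule nn_integral_count_space_nn_integral[OF countable_index, symmetric]) measurable
      also have "\<dots> = nconv (cnorm F) (\<lambda>x. ennreal (h x)) x"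
        unfolding nconv_def by (intro nn_integral_cong) (subst nn_integral_multc, auto simp: psi_nn_sum)
      finally show ?thesis .
    qed
    have meas: "(\<lambda>(i, y). f i y) \<in> borel_measurable (cs \<Otimes>\<^sub>M \<mu>)"
      if "\<And>i. f i \<in> borel_measurable borel" for f :: "'i \<Rightarrow> 'g \<Rightarrow> complex"
      using that by (intro measurable_pair_measure_countable1[OF countable_index]) auto
    have int: "integrable (cs \<Otimes>\<^sub>M \<mu>) (\<lambda>(i, y). f i y)"
      if [measurable]: "\<And>i. f i \<in> borel_measurable borel"
        and le: "\<And>i y. cnorm (f i) y \<le> ennreal (\<psi> i y) * (cnorm F y * ennreal (maxW (- y + x)))"
      for f :: "'i \<Rightarrow> 'g \<Rightarrow> complex"
    proof (subst integrable_iff_cnorm)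
      have "(\<integral>\<^sup>+p. cnorm (\<lambda>(i, y). f i y) p \<partial>(cs \<Otimes>\<^sub>M \<mu>)) = (\<integral>\<^sup>+i. \<integral>\<^sup>+y. cnorm (f i) y \<partial>\<mu> \<partial>cs)"
        using meas[OF that(1)] by (subst nn_integral_fst[symmetric]) (auto simp: split_beta')
      also have "\<dots> \<le> (\<integral>\<^sup>+i. \<integral>\<^sup>+y. ennreal (\<psi> i y) * (cnorm F y * ennreal (maxW (- y + x))) \<partial>\<mu> \<partial>cs)"
        by (intro nn_integral_mono le)
      also have "\<dots> < top" using elim by (simp add: mono)
      finally show "(\<integral>\<^sup>+p. cnorm (\<lambda>(i, y). f i y) p \<partial>(cs \<Otimes>\<^sub>M \<mu>)) < top" .
    qed (rule meas[OF that(1)])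
    have A_le: "cnorm (?A i) y \<le> ennreal (\<psi> i y) * (cnorm F y * ennreal (maxW (- y + x)))" for i y
    proof -
      have "cmod (?A i y) \<le> \<psi> i y * (cmod (F y) * maxW (- y + x))"
        unfolding norm_mult by (intro mult_mono) (auto intro: W_le_maxW_self)
      then show ?thesis by (simp add: ennreal_mult[symmetric] ennreal_leI)
    qed
    have B_le: "cnorm (?B i) y \<le> ennreal (\<psi> i y) * (cnorm F y * ennreal (maxW (- y + x)))" for i y
    proof (cases "\<psi> i y = 0")
      case False
      have "cmod (?B i y) \<le> \<psi> i y * cmod (F y) * maxW (- y + x)"
        unfolding norm_mult by (intro mult_mono) (auto intro: close[OF False])
      then show ?thesis by (simp add: ennreal_mult[symmetric] ennreal_leI mult.assoc)
    qed simp
    have A: "integrable (cs \<Otimes>\<^sub>M \<mu>) (\<lambda>(i, y). ?A i y)" by (rule int[OF _ A_le]) measurable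
    have B: "integrable (cs \<Otimes>\<^sub>M \<mu>) (\<lambda>(i, y). ?B i y)" by (rule int[OF _ B_le]) measurable
    have "conv \<mu> F W x = (\<integral>y. \<integral>i. ?A i y \<partial>cs \<partial>\<mu>)"
      unfolding conv_def
    proof (rule Bochner_Integration.integral_cong[OF refl])
      fix y
      have "(\<integral>i. \<psi> i y \<partial>cs) = 1"
        by (subst integral_eq_nn_integral) (auto simp: psi_nn_sum)
      then have "(\<integral>i. complex_of_real (\<psi> i y) \<partial>cs) = 1"
        by (simp add: Bochner_Integration.integral_of_real)
      then show "F y * W (- y + x) = (\<integral>i. ?A i y \<partial>cs)" by simp
    qed
    also have "\<dots> = (\<integral>p. (\<lambda>(i, y). ?A i y) p \<partial>(cs \<Otimes>\<^sub>M \<mu>))"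
      using P.integral_snd[OF A] by simp
    finally have c1: "conv \<mu> F W x = (\<integral>p. (\<lambda>(i, y). ?A i y) p \<partial>(cs \<Otimes>\<^sub>M \<mu>))" .
    have c2: "synW (coef F) x = (\<integral>p. (\<lambda>(i, y). ?B i y) p \<partial>(cs \<Otimes>\<^sub>M \<mu>))"
      using P.integral_fst[OF B] by (simp add: synW_def coef_def)
    have "cnorm (\<lambda>x. conv \<mu> F W x - synW (coef F) x) x
       = cnorm (\<lambda>_. \<integral>p. (\<lambda>(i, y). ?A i y) p - (\<lambda>(i, y). ?B i y) p \<partial>(cs \<Otimes>\<^sub>M \<mu>)) x"
      unfolding c1 c2 by (subst Bochner_Integration.integral_diff[OF A B]) simp
    also have "\<dots> \<le> (\<integral>\<^sup>+p. cnorm (\<lambda>(i, y). ?A i y - ?B i y) p \<partial>(cs \<Otimes>\<^sub>M \<mu>))"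
      using ennreal_norm_integral_le[of "cs \<Otimes>\<^sub>M \<mu>" "\<lambda>p. (\<lambda>(i, y). ?A i y) p - (\<lambda>(i, y). ?B i y) p"]
      by (simp add: split_beta')
    also have "\<dots> = (\<integral>\<^sup>+i. \<integral>\<^sup>+y. cnorm (\<lambda>y. ?A i y - ?B i y) y \<partial>\<mu> \<partial>cs)"
    proof -
      have "(\<lambda>(i, y). ?A i y - ?B i y) \<in> borel_measurable (cs \<Otimes>\<^sub>M \<mu>)"
        by (rule meas) measurable
      then show ?thesis by (subst nn_integral_fst[symmetric]) (auto simp: split_beta')
    qed
    also have "\<dots> \<le> (\<integral>\<^sup>+i. \<integral>\<^sup>+y. ennreal (\<psi> i y) * (cnorm F y * ennreal (osc U W (- y + x))) \<partial>\<mu> \<partial>cs)"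
    proof (intro nn_integral_mono)
      fix i y
      show "cnorm (\<lambda>y. ?A i y - ?B i y) y \<le> ennreal (\<psi> i y) * (cnorm F y * ennreal (osc U W (- y + x)))"
      proof (cases "\<psi> i y = 0")
        case False
        have eq: "?A i y - ?B i y = complex_of_real (\<psi> i y) * (F y * (W (- y + x) - W (- X i + x)))"
          by (simp add: algebra_simps)
        have "cmod (?A i y - ?B i y) \<le> \<psi> i y * (cmod (F y) * osc U W (- y + x))"
          unfolding eq norm_mult by (intro mult_mono) (auto intro: close[OF False])
        then show ?thesis by (simp add: ennreal_mult[symmetric] ennreal_leI)
      qed simp
    qed
    also have "\<dots> = nconv (cnorm F) (\<lambda>x. ennreal (osc U W x)) x" by (rule mono) measurable
    finally show ?case .
  qed
qed

end

end

section \<open>The Neumann iteration\<close>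

lemma enn2real_powr_le:
  assumes "x \<le> ennreal b * y" "y < top" "0 \<le> b" "0 < r"
  shows "enn2real x powr (1 / r) \<le> b powr (1 / r) * enn2real y powr (1 / r)"
proof -
  have "enn2real x \<le> enn2real (ennreal b * y)"
    using assms by (intro enn2real_mono) (auto simp: ennreal_mult_less_top)
  also have "\<dots> = b * enn2real y" using assms by (simp add: enn2real_mult)
  finally have "enn2real x powr (1 / r) \<le> (b * enn2real y) powr (1 / r)"
    using assms by (intro powr_mono2) auto
  then show ?thesis using assms by (simp add: powr_mult)
qed

context sampled_coorbit
begin

definition resid :: "('g \<Rightarrow> complex) \<Rightarrow> 'g \<Rightarrow> complex" where
  "resid F x = F x - synK (coef F) x"

definition neumann_coef :: "('g \<Rightarrow> complex) \<Rightarrow> 'i \<Rightarrow> complex" where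
  "neumann_coef F i = (\<Sum>n. coef ((resid ^^ n) F) i)"

text \<open>Homogeneity holds for arbitrary F, as a divergent Bochner integral is 0 before and after
  scaling; additivity below is stated on a class where the integrals converge.\<close>

lemma coef_cmult: "coef (\<lambda>x. a * F x) = (\<lambda>i. a * coef F i)"
proof
  fix i
  have "coef (\<lambda>x. a * F x) i = (\<integral>y. a * (complex_of_real (\<psi> i y) * F y) \<partial>\<mu>)"
    by (simp add: coef_def mult_ac)
  then show "coef (\<lambda>x. a * F x) i = a * coef F i" by (simp add: coef_def)
qed

lemma conv_cmult: "conv \<mu> (\<lambda>x. a * F x) G = (\<lambda>x. a * conv \<mu> F G x)"
  by (rule ext) (simp add: conv_def mult.assoc)

lemma synK_cmult: "synK (\<lambda>i. a * c i) = (\<lambda>x. a * synK c x)"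
proof -
  have "synW (\<lambda>i. a * c i) = (\<lambda>x. a * synW c x)"
    by (rule ext) (simp add: synW_def mult.assoc)
  then show ?thesis by (simp add: synK_def conv_cmult)
qed

lemma resid_cmult: "resid (\<lambda>x. a * F x) = (\<lambda>x. a * resid F x)"
  by (rule ext) (simp add: resid_def coef_cmult synK_cmult right_diff_distrib)

lemma resid_funpow_cmult: "(resid ^^ n) (\<lambda>x. a * F x) = (\<lambda>x. a * (resid ^^ n) F x)"
  by (induction n arbitrary: F) (simp_all add: resid_cmult)

text \<open>For finite support W * K = K applies term by term. This identifies the transforms of the
  partial sums of the series in the theorem with values of \<open>synK\<close>.\<close>

lemma synK_finite:
  assumes "finite A"
  shows "synK (\<lambda>i. if i \<in> A then c i else 0) x = (\<Sum>i\<in>A. c i * K (- X i + x))"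
proof -
  have synW: "synW (\<lambda>i. if i \<in> A then c i else 0) = (\<lambda>x. \<Sum>i\<in>A. c i * W (- X i + x))"
  proof
    fix x
    have "synW (\<lambda>i. if i \<in> A then c i else 0) x
        = (\<Sum>i | i \<in> UNIV \<and> (if i \<in> A then c i else 0) * W (- X i + x) \<noteq> 0. (if i \<in> A then c i else 0) * W (- X i + x))"
      unfolding synW_def
      by (rule lebesgue_integral_count_space_finite_support) (rule finite_subset[OF _ assms], auto)
    also have "\<dots> = (\<Sum>i\<in>A. c i * W (- X i + x))"
      using assms by (intro sum.mono_neutral_cong_left) auto
    finally show "synW (\<lambda>i. if i \<in> A then c i else 0) x = (\<Sum>i\<in>A. c i * W (- X i + x))" .
  qed
  have int: "integrable \<mu> (\<lambda>y. c i * W (- X i + y) * K (- y + x))" for i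
  proof -
    have "nconv (cnorm (\<lambda>t. W (- X i + t))) (cnorm K) x < top"
      using nconv_translate[of "cnorm W" "cnorm K" "X i" x] nconv_W_K_finite by simp
    then have "integrable \<mu> (\<lambda>y. W (- X i + y) * K (- y + x))" by (intro integrable_conv) auto
    then show ?thesis by (simp add: mult.assoc)
  qed
  have "synK (\<lambda>i. if i \<in> A then c i else 0) x = (\<integral>y. (\<Sum>i\<in>A. c i * W (- X i + y) * K (- y + x)) \<partial>\<mu>)"
    by (simp add: synK_def synW conv_def sum_distrib_right)
  also have "\<dots> = (\<Sum>i\<in>A. \<integral>y. c i * W (- X i + y) * K (- y + x) \<partial>\<mu>)"
    by (rule Bochner_Integration.integral_sum) (rule int)
  also have "\<dots> = (\<Sum>i\<in>A. c i * K (- X i + x))"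
    using conv_W_translate by (intro sum.cong) (simp_all add: mult.assoc conv_def)
  finally show ?thesis .
qed

section \<open>The reproducing kernel space and the residual\<close>

context
  fixes r :: real and m :: "'g \<Rightarrow> real"
  assumes r: "1 < r" and m: "moderate w m" and rc: "rc_bounded \<mu> K r m"
begin

declare measurable_moderate[OF m, measurable] moderate_nonneg[OF m, simp]

text \<open>Function model of the coorbit space: \<open>Co_iff\<close> places every V_e T here. The
  equation F * K = F is imposed at every point, which selects one representative of each
  class.\<close>

definition inM :: "('g \<Rightarrow> complex) \<Rightarrow> bool" where
  "inM F \<longleftrightarrow> F \<in> borel_measurable borel \<and> enr r m (cnorm F) < top \<and> conv \<mu> F K = F"

text \<open>Boundedness makes the set of admissible constants nonempty, after replacing the given
  constant by its positive part. Dividing by the norm of f shows that the infimum is itself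
  admissible; norm 0 falls back on the given constant.\<close>

lemma rc_norm_nonneg: "0 \<le> rc_norm \<mu> K r m"
  and Lpw_norm_conv_K_le: "f \<in> Lpw \<mu> r m \<Longrightarrow> Lpw_norm \<mu> r m (conv \<mu> f K) \<le> rc_norm \<mu> K r m * Lpw_norm \<mu> r m f"
proof -
  define A where "A = {C. 0 \<le> C \<and> (\<forall>f\<in>Lpw \<mu> r m. Lpw_norm \<mu> r m (conv \<mu> f K) \<le> C * Lpw_norm \<mu> r m f)}"
  obtain C where C: "\<And>f. f \<in> Lpw \<mu> r m \<Longrightarrow> Lpw_norm \<mu> r m (conv \<mu> f K) \<le> C * Lpw_norm \<mu> r m f"
    using rc unfolding rc_bounded_def by blast
  have nonneg: "0 \<le> Lpw_norm \<mu> r m f" for f by (simp add: Lpw_norm_def)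
  have "max C 0 \<in> A"
    unfolding A_def using C nonneg by (auto intro!: order_trans[OF C] mult_right_mono)
  then have ne: "A \<noteq> {}" by blast
  have rcA: "rc_norm \<mu> K r m = Inf A" by (simp add: rc_norm_def A_def)
  show "0 \<le> rc_norm \<mu> K r m" unfolding rcA using ne by (intro cInf_greatest) (auto simp: A_def)
  show "Lpw_norm \<mu> r m (conv \<mu> f K) \<le> rc_norm \<mu> K r m * Lpw_norm \<mu> r m f" if f: "f \<in> Lpw \<mu> r m"
  proof (cases "Lpw_norm \<mu> r m f = 0")
    case True
    then show ?thesis using C[OF f] by simp
  next
    case False
    then have pos: "0 < Lpw_norm \<mu> r m f" using nonneg[of f] by simp
    have "Lpw_norm \<mu> r m (conv \<mu> f K) / Lpw_norm \<mu> r m f \<le> Inf A"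
      using ne
    proof (rule cInf_greatest)
      fix C assume "C \<in> A"
      then show "Lpw_norm \<mu> r m (conv \<mu> f K) / Lpw_norm \<mu> r m f \<le> C"
        using f pos by (simp add: A_def divide_le_eq)
    qed
    then show ?thesis using pos by (simp add: rcA divide_le_eq)
  qed
qed

lemma enr_conv_K_le:
  assumes [measurable]: "f \<in> borel_measurable borel" and f: "enr r m (cnorm f) < top"
  shows "enr r m (cnorm (conv \<mu> f K)) \<le> epow r (ennreal (rc_norm \<mu> K r m)) * enr r m (cnorm f)"
proof -
  let ?\<rho> = "rc_norm \<mu> K r m"
  have fL: "f \<in> Lpw \<mu> r m" using f by (simp add: Lpw_iff)
  then have "conv \<mu> f K \<in> Lpw \<mu> r m" using rc by (simp add: rc_bounded_def)
  then have fin: "enr r m (cnorm (conv \<mu> f K)) < top" by (simp add: Lpw_iff)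
  define a b where "a = enn2real (enr r m (cnorm (conv \<mu> f K)))" and "b = enn2real (enr r m (cnorm f))"
  have ab: "0 \<le> a" "0 \<le> b" "enr r m (cnorm (conv \<mu> f K)) = ennreal a" "enr r m (cnorm f) = ennreal b"
    using f fin by (simp_all add: a_def b_def)
  have "a powr (1 / r) \<le> ?\<rho> * b powr (1 / r)"
    using Lpw_norm_conv_K_le[OF fL] by (simp add: Lpw_norm_eq a_def b_def)
  then have "(a powr (1 / r)) powr r \<le> (?\<rho> * b powr (1 / r)) powr r"
    using r by (intro powr_mono2) auto
  then have "a \<le> ?\<rho> powr r * b"
    using r ab rc_norm_nonneg by (simp add: powr_mult powr_powr)
  then show ?thesis
    using ab rc_norm_nonneg by (simp add: epow_ennreal ennreal_mult[symmetric] ennreal_leI)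
qed

lemma conv_K_add:
  assumes [measurable]: "f \<in> borel_measurable borel" "g \<in> borel_measurable borel"
    and "enr r m (cnorm f) < top" "enr r m (cnorm g) < top"
  shows "conv \<mu> (\<lambda>x. f x + g x) K = (\<lambda>x. conv \<mu> f K x + conv \<mu> g K x)"
proof
  fix x
  have "conv \<mu> (\<lambda>x. f x + g x) K x = (\<integral>y. f y * K (- y + x) + g y * K (- y + x) \<partial>\<mu>)"
    by (simp add: conv_def distrib_right)
  also have "\<dots> = conv \<mu> f K x + conv \<mu> g K x"
    unfolding conv_def
    by (intro Bochner_Integration.integral_add conv_K_integrable[OF r m]) (use assms in auto)
  finally show "conv \<mu> (\<lambda>x. f x + g x) K x = conv \<mu> f K x + conv \<mu> g K x" .
qed

lemma enr_add_finite:
  assumes [measurable]: "f \<in> borel_measurable borel" "g \<in> borel_measurable borel"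
    and "enr r m (cnorm f) < top" "enr r m (cnorm g) < top"
  shows "enr r m (cnorm (\<lambda>x. f x + g x)) < top"
proof -
  have "enr r m (cnorm (\<lambda>x. f x + g x)) \<le> ennreal (2 powr r) * (enr r m (cnorm f) + enr r m (cnorm g))"
    using r by (intro enr_add_le) (auto simp: ennreal_plus[symmetric] norm_triangle_ineq simp del: ennreal_plus)
  also have "\<dots> < top" using assms by (simp add: ennreal_mult_less_top)
  finally show ?thesis .
qed

lemma enr_cnorm_cmult:
  assumes [measurable]: "f \<in> borel_measurable borel"
  shows "enr r m (cnorm (\<lambda>x. a * f x)) = epow r (ennreal (cmod a)) * enr r m (cnorm f)"
  by (subst enr_cmult[symmetric]) (auto simp: norm_mult ennreal_mult)

lemma inM_add: "inM F \<Longrightarrow> inM G \<Longrightarrow> inM (\<lambda>x. F x + G x)"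
  by (auto simp: inM_def conv_K_add intro: enr_add_finite)

lemma inM_cmult: "inM F \<Longrightarrow> inM (\<lambda>x. a * F x)"
  by (auto simp: inM_def conv_cmult enr_cnorm_cmult ennreal_mult_less_top)

lemma inM_diff: "inM F \<Longrightarrow> inM G \<Longrightarrow> inM (\<lambda>x. F x - G x)"
  using inM_add[OF _ inM_cmult[of G "- 1"], of F] by simp

text \<open>Convolution with K does not see null sets, and both functions are reproduced by it at
  every point.\<close>

lemma inM_AE_eq:
  assumes "inM F" "inM G" "AE x in \<mu>. F x = G x"
  shows "F = G"
proof
  fix x
  have [measurable]: "F \<in> borel_measurable borel" "G \<in> borel_measurable borel"
    using assms by (auto simp: inM_def)
  have "conv \<mu> F K x = conv \<mu> G K x"
    unfolding conv_def by (rule integral_cong_AE) (use assms(3) in auto)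
  then show "F x = G x" using assms by (simp add: inM_def)
qed

lemma synW_finite: "elw r m (cnorm c) < top \<Longrightarrow> enr r m (cnorm (synW c)) < top"
  and nsynW_AE_finite: "elw r m (cnorm c) < top \<Longrightarrow> AE x in \<mu>. nsynW (cnorm c) x < top"
proof -
  assume c: "elw r m (cnorm c) < top"
  obtain B where B: "B < top" "\<And>c. enr r m (nsynW c) \<le> B * elw r m c" using nsynW_bound[OF r m] by blast
  have "enr r m (nsynW (cnorm c)) \<le> B * elw r m (cnorm c)" by (rule B)
  also have "\<dots> < top" using B c by (simp add: ennreal_mult_less_top)
  finally have fin: "enr r m (nsynW (cnorm c)) < top" .
  then show "AE x in \<mu>. nsynW (cnorm c) x < top" by (intro AE_finite_of_enr[OF r m]) auto
  show "enr r m (cnorm (synW c)) < top"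
    using r by (intro le_less_trans[OF enr_mono fin] cnorm_synW_le) auto
qed

lemma synK_bound: "\<exists>B<top. \<forall>c. elw r m (cnorm c) < top \<longrightarrow> enr r m (cnorm (synK c)) \<le> B * elw r m (cnorm c)"
proof -
  obtain B where B: "B < top" "\<And>c. enr r m (nsynW c) \<le> B * elw r m c" using nsynW_bound[OF r m] by blast
  have "enr r m (cnorm (synK c)) \<le> epow r (ennreal (rc_norm \<mu> K r m)) * B * elw r m (cnorm c)"
    if c: "elw r m (cnorm c) < top" for c
  proof -
    have "enr r m (cnorm (synK c)) \<le> epow r (ennreal (rc_norm \<mu> K r m)) * enr r m (cnorm (synW c))"
      unfolding synK_def by (rule enr_conv_K_le) (use synW_finite[OF c] in auto)
    also have "enr r m (cnorm (synW c)) \<le> enr r m (nsynW (cnorm c))"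
      using r by (intro enr_mono cnorm_synW_le) auto
    also have "\<dots> \<le> B * elw r m (cnorm c)" by (rule B)
    finally show ?thesis by (simp add: mult.assoc mult_left_mono)
  qed
  moreover have "epow r (ennreal (rc_norm \<mu> K r m)) * B < top" using B by (simp add: ennreal_mult_less_top)
  ultimately show ?thesis by blast
qed

lemma synK_inM: "elw r m (cnorm c) < top \<Longrightarrow> inM (synK c)"
proof -
  assume c: "elw r m (cnorm c) < top"
  obtain B where "B < top" "enr r m (cnorm (synK c)) \<le> B * elw r m (cnorm c)"
    using synK_bound c by blast
  then have "enr r m (cnorm (synK c)) < top"
    using c by (auto simp: ennreal_mult_less_top intro: le_less_trans)
  moreover have "conv \<mu> (synK c) K = synK c"
    unfolding synK_def by (rule conv_conv_K[OF r m]) (use synW_finite[OF c] in auto)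
  ultimately show "inM (synK c)" by (simp add: inM_def)
qed

text \<open>\<open>synW\<close> splits where both series converge absolutely, that is almost
  everywhere; convolution with K removes the exceptional set, so the identity for
  \<open>synK\<close> holds everywhere.\<close>

lemma synK_add:
  assumes c: "elw r m (cnorm c) < top" and d: "elw r m (cnorm d) < top"
  shows "synK (\<lambda>i. c i + d i) = (\<lambda>x. synK c x + synK d x)"
proof -
  have AE: "AE x in \<mu>. synW (\<lambda>i. c i + d i) x = synW c x + synW d x"
    using nsynW_AE_finite[OF c] nsynW_AE_finite[OF d]
  proof eventually_elim
    case (elim x)
    have int: "integrable cs (\<lambda>i. c i * W (- X i + x))" if "nsynW (cnorm c) x < top" for c
      using that by (subst integrable_iff_cnorm) (auto simp: nsynW_def norm_mult ennreal_mult)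
    show ?case
      unfolding synW_def distrib_right by (intro Bochner_Integration.integral_add int elim)
  qed
  have "synK (\<lambda>i. c i + d i) = conv \<mu> (\<lambda>x. synW c x + synW d x) K"
  proof
    fix x
    show "synK (\<lambda>i. c i + d i) x = conv \<mu> (\<lambda>x. synW c x + synW d x) K x"
      unfolding synK_def conv_def by (rule integral_cong_AE) (use AE in auto)
  qed
  also have "\<dots> = (\<lambda>x. synK c x + synK d x)"
    unfolding synK_def by (rule conv_K_add) (use synW_finite[OF c] synW_finite[OF d] in auto)
  finally show ?thesis .
qed

lemma coef_finite:
  assumes "F \<in> borel_measurable borel" "enr r m (cnorm F) < top"
  shows "elw r m (cnorm (coef F)) < top"
proof -
  obtain B where "B < top" "elw r m (cnorm (coef F)) \<le> B * enr r m (cnorm F)"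
    using coef_bound[OF r m] assms(1) by blast
  then show ?thesis
    using assms by (auto simp: ennreal_mult_less_top intro: le_less_trans)
qed

text \<open>\<psi>_i is bounded by 1 and supported in the compact set x_i U, so it lies in the dual
  space L_{q,w}.\<close>

lemma coef_integrable:
  assumes [measurable]: "F \<in> borel_measurable borel" and F: "enr r m (cnorm F) < top"
  shows "integrable \<mu> (\<lambda>y. complex_of_real (\<psi> i y) * F y)"
proof -
  define q where "q = r / (r - 1)"
  have q: "1 < q" using r by (simp add: q_def)
  obtain C where C: "0 \<le> C" "\<And>q. q \<in> U \<Longrightarrow> w q \<le> C" using w_bounded by blast
  have "enr q w (\<lambda>y. ennreal (\<psi> i y)) \<le> (\<integral>\<^sup>+y. epow q (ennreal (w (X i) * C)) * indicator U (- X i + y) \<partial>\<mu>)"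
    unfolding enr_def
  proof (rule nn_integral_mono)
    fix y
    show "epow q (ennreal (w y) * ennreal (\<psi> i y)) \<le> epow q (ennreal (w (X i) * C)) * indicator U (- X i + y)"
    proof (cases "- X i + y \<in> U")
      case True
      have "w y \<le> w (X i) * C"
        using w_split[of y "X i"] C(2)[OF True] by (meson mult_left_mono order_trans w_nonneg)
      then have "w y * \<psi> i y \<le> w (X i) * C * 1" using psi_le_1 C by (intro mult_mono) auto
      then show ?thesis using True q by (simp add: ennreal_mult[symmetric] epow_mono ennreal_leI)
    qed (simp add: psi_support)
  qed
  also have "\<dots> = epow q (ennreal (w (X i) * C)) * emeasure \<mu> U"
    by (subst nn_integral_cmult) (auto simp: indicator_U_integral)
  also have "\<dots> < top" using U_measure by (simp add: ennreal_mult_less_top less_top)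
  finally have "(\<integral>\<^sup>+y. cnorm F y * ennreal (\<psi> i y) \<partial>\<mu>) < top"
    using F by (intro pairing_finite[OF r m]) (auto simp: q_def)
  then show ?thesis
    by (subst integrable_iff_cnorm) (auto simp: norm_mult ennreal_mult mult.commute)
qed

lemma coef_add:
  assumes "inM F" "inM G" shows "coef (\<lambda>x. F x + G x) = (\<lambda>i. coef F i + coef G i)"
  unfolding coef_def distrib_left
  by (rule ext, intro Bochner_Integration.integral_add coef_integrable) (use assms in \<open>auto simp: inM_def\<close>)

lemma inM_coef: "inM F \<Longrightarrow> elw r m (cnorm (coef F)) < top"
  by (rule coef_finite) (auto simp: inM_def)

lemma inM_resid: "inM F \<Longrightarrow> inM (resid F)"
  unfolding resid_def by (intro inM_diff synK_inM inM_coef)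

lemma inM_resid_funpow: "inM F \<Longrightarrow> inM ((resid ^^ n) F)"
  by (induction n) (auto intro: inM_resid)

lemma resid_add: "inM F \<Longrightarrow> inM G \<Longrightarrow> resid (\<lambda>x. F x + G x) = (\<lambda>x. resid F x + resid G x)"
  by (rule ext) (simp add: resid_def coef_add synK_add inM_coef)

lemma resid_funpow_add:
  "inM F \<Longrightarrow> inM G \<Longrightarrow> (resid ^^ n) (\<lambda>x. F x + G x) = (\<lambda>x. (resid ^^ n) F x + (resid ^^ n) G x)"
  by (induction n) (simp_all add: resid_add inM_resid_funpow)

text \<open>On the range of the right convolution with \<open>K\<close>, \<open>F = F * W * K\<close>; so the residual is
  \<open>(F * W - synW (coef F)) * K\<close>, and the first factor is dominated by \<open>|F| * osc W\<close>.\<close>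

lemma resid_bound:
  assumes "inM F"
  shows "enr r m (cnorm (resid F)) \<le> epow r (max (Lpw_enorm_p \<mu> 1 w (osc U W))
      (Lpw_enorm_p \<mu> 1 (\<lambda>x. w x / modular \<mu> x) (osc U W)) * ennreal (rc_norm \<mu> K r m)) * enr r m (cnorm F)"
proof -
  have [measurable]: "F \<in> borel_measurable borel" and F: "enr r m (cnorm F) < top" and FK: "conv \<mu> F K = F"
    using assms by (auto simp: inM_def)
  let ?o = "\<lambda>x. ennreal (osc U W x)"
  define A where "A = (\<integral>\<^sup>+x. ennreal (w x) * ?o x \<partial>\<mu>)"
  define B where "B = (\<integral>\<^sup>+x. ennreal (w x / modular \<mu> x) * ?o x \<partial>\<mu>)"
  have AB: "Lpw_enorm_p \<mu> 1 w (osc U W) = A" "Lpw_enorm_p \<mu> 1 (\<lambda>x. w x / modular \<mu> x) (osc U W) = B"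
    using modular_pos by (simp_all add: Lpw_enorm_p_eq A_def B_def enr_def less_imp_le)
  \<comment> \<open>The error before convolution with K. The subtraction is written as addition of a
    multiple by -1 so that \<open>conv_K_add\<close> and \<open>conv_cmult\<close> apply.\<close>
  define E where "E x = conv \<mu> F W x + (- 1) * synW (coef F) x" for x
  have [measurable]: "E \<in> borel_measurable borel" unfolding E_def by measurable
  have sW: "enr r m (cnorm (synW (coef F))) < top" by (intro synW_finite inM_coef assms)
  have cW: "enr r m (cnorm (conv \<mu> F W)) < top"
    using r by (intro le_less_trans[OF enr_mono enr_nconv_W[OF r m _ F]] cnorm_conv_le) auto
  have sW': "enr r m (cnorm (\<lambda>x. (- 1) * synW (coef F) x)) < top"
    using sW by (subst enr_cnorm_cmult) (auto simp: ennreal_mult_less_top)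
  have E: "enr r m (cnorm E) < top"
    unfolding E_def by (rule enr_add_finite) (use cW sW' in auto)
  have "conv \<mu> E K = (\<lambda>x. conv \<mu> (conv \<mu> F W) K x + conv \<mu> (\<lambda>x. (- 1) * synW (coef F) x) K x)"
    unfolding E_def by (rule conv_K_add) (use cW sW' in auto)
  also have "\<dots> = resid F"
    unfolding conv_conv_W_K[OF r m \<open>F \<in> borel_measurable borel\<close> F] conv_cmult
    by (rule ext) (simp add: FK resid_def synK_def)
  finally have "enr r m (cnorm (resid F)) \<le> epow r (ennreal (rc_norm \<mu> K r m)) * enr r m (cnorm E)"
    using enr_conv_K_le[OF _ E] by simp
  also have "enr r m (cnorm E) \<le> enr r m (nconv (cnorm F) ?o)"
    using r discretization_error[OF r m \<open>F \<in> borel_measurable borel\<close> F]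
    by (intro enr_mono_AE) (auto simp: E_def)
  also have "\<dots> \<le> epow (r - 1) B * A * enr r m (cnorm F)"
    unfolding A_def B_def by (rule schur_right[OF r m]) measurable
  \<comment> \<open>The two Schur constants enter with exponents r - 1 and 1, which add up to r;
    replacing both by their maximum produces the smallness condition of the theorem.\<close>
  also have "epow (r - 1) B * A \<le> epow (r - 1) (max A B) * epow 1 (max A B)"
    using r by (intro mult_mono epow_mono) auto
  also have "\<dots> = epow r (max A B)" by (subst epow_add[symmetric]) simp
  finally show ?thesis
    unfolding AB by (simp add: epow_mult mult_left_mono mult_right_mono mult.assoc mult.left_commute)
qed

end

text \<open>Jensen with the geometric weights \<open>t\<^sup>n\<close>, where \<open>t\<^bsup>r-1\<^esup> = q\<^bsup>1/2\<^esup>\<close>,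
  replaces Minkowski's inequality for the infinite sum.\<close>

lemma geometric_series_bound:
  fixes a :: "nat \<Rightarrow> 'i \<Rightarrow> ennreal"
  assumes r: "1 < r" and q: "0 < q" "q < 1" and a: "\<And>n. elw r m (a n) \<le> ennreal (q ^ n) * E"
  shows "elw r m (\<lambda>i. \<integral>\<^sup>+n. a n i \<partial>count_space UNIV) \<le>
    epow (r - 1) (ennreal (1 / (1 - q powr (1 / (2 * (r - 1)))))) * (ennreal (1 / (1 - sqrt q)) * E)"
proof -
  define t where "t = q powr (1 / (2 * (r - 1)))"
  have t: "0 < t" "t < 1"
  proof -
    show "0 < t" using q by (simp add: t_def)
    have "t < 1 powr (1 / (2 * (r - 1)))"
      unfolding t_def using q r by (intro powr_less_mono2) auto
    then show "t < 1" by simp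
  qed
  have tr: "t powr (r - 1) = sqrt q"
  proof -
    have "1 / (2 * (r - 1)) * (r - 1) = 1 / 2" using r by (simp add: divide_simps)
    then have "t powr (r - 1) = q powr (1 / 2)" unfolding t_def powr_powr by (simp only:)
    then show ?thesis using q by (simp add: powr_half_sqrt)
  qed
  \<comment> \<open>The decay q^n is split evenly: one factor \<open>sqrt q\<close> pays for the
    Jensen weights, the other is left to sum.\<close>
  have tq: "t * (1 / t) powr r * q = sqrt q"
  proof -
    have "t * (1 / t) powr r = 1 / t powr (r - 1)"
      using t by (simp add: powr_divide powr_diff)
    then show ?thesis using tr q by (simp add: real_div_sqrt)
  qed
  have geo: "(\<integral>\<^sup>+n. ennreal (s ^ n) \<partial>count_space UNIV) = ennreal (1 / (1 - s))" if "0 < s" "s < 1" for s :: real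
  proof -
    have "(\<integral>\<^sup>+n. ennreal (s ^ n) \<partial>count_space UNIV) = (\<Sum>n. ennreal (s ^ n))"
      by (rule nn_integral_count_space_nat)
    also have "\<dots> = ennreal (\<Sum>n. s ^ n)"
      using that by (intro suminf_ennreal2 summable_geometric) auto
    also have "(\<Sum>n. s ^ n) = 1 / (1 - s)" using that by (intro suminf_geometric) auto
    finally show ?thesis .
  qed
  let ?k = "\<lambda>n. ennreal (t ^ n)" and ?h = "\<lambda>n i. ennreal ((1 / t) ^ n) * (ennreal (m (X i)) * a n i)"
  have kh: "?k n * ?h n i = ennreal (m (X i)) * a n i" for n i
  proof -
    have "?k n * ennreal ((1 / t) ^ n) = 1"
      using t by (simp add: ennreal_mult[symmetric] power_mult_distrib[symmetric])
    then show ?thesis by (simp add: mult.assoc[symmetric])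
  qed
  have keh: "?k n * epow r (?h n i) = ennreal ((t * (1 / t) powr r) ^ n) * epow r (ennreal (m (X i)) * a n i)" for n i
  proof -
    have "((1 / t) ^ n) powr r = ((1 / t) powr r) ^ n"
      using t by (simp add: powr_realpow[symmetric] powr_powr mult.commute)
    then have "?k n * epow r (ennreal ((1 / t) ^ n)) = ennreal ((t * (1 / t) powr r) ^ n)"
      using t by (simp add: epow_ennreal ennreal_mult[symmetric] power_mult_distrib)
    then show ?thesis by (simp add: epow_mult mult.assoc[symmetric])
  qed
  have pt: "epow r (ennreal (m (X i)) * (\<integral>\<^sup>+n. a n i \<partial>count_space UNIV)) \<le>
     epow (r - 1) (ennreal (1 / (1 - t))) * (\<integral>\<^sup>+n. ?k n * epow r (?h n i) \<partial>count_space UNIV)" for i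
  proof -
    have "ennreal (m (X i)) * (\<integral>\<^sup>+n. a n i \<partial>count_space UNIV) = (\<integral>\<^sup>+n. ?k n * ?h n i \<partial>count_space UNIV)"
      unfolding kh by (rule nn_integral_cmult[symmetric]) simp
    then show ?thesis
      using nn_integral_jensen[OF r, of ?k "count_space UNIV" "\<lambda>n. ?h n i"] by (simp add: geo t)
  qed
  have "elw r m (\<lambda>i. \<integral>\<^sup>+n. a n i \<partial>count_space UNIV)
     \<le> (\<integral>\<^sup>+i. epow (r - 1) (ennreal (1 / (1 - t))) * (\<integral>\<^sup>+n. ?k n * epow r (?h n i) \<partial>count_space UNIV) \<partial>cs)"
    unfolding elw_def by (intro nn_integral_mono pt)
  also have "\<dots> = epow (r - 1) (ennreal (1 / (1 - t))) * (\<integral>\<^sup>+i. \<integral>\<^sup>+n. ?k n * epow r (?h n i) \<partial>count_space UNIV \<partial>cs)"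
    by (rule nn_integral_cmult) simp
  also have "(\<integral>\<^sup>+i. \<integral>\<^sup>+n. ?k n * epow r (?h n i) \<partial>count_space UNIV \<partial>cs)
      = (\<integral>\<^sup>+n. \<integral>\<^sup>+i. ?k n * epow r (?h n i) \<partial>cs \<partial>count_space UNIV)"
    by (rule nn_integral_count_space_nn_integral) auto
  also have "\<dots> = (\<integral>\<^sup>+n. ennreal ((t * (1 / t) powr r) ^ n) * elw r m (a n) \<partial>count_space UNIV)"
    unfolding keh elw_def by (intro nn_integral_cong nn_integral_cmult) simp
  also have "\<dots> \<le> (\<integral>\<^sup>+n. ennreal (sqrt q ^ n) * E \<partial>count_space UNIV)"
  proof (rule nn_integral_mono)
    fix n
    have "ennreal ((t * (1 / t) powr r) ^ n) * elw r m (a n) \<le> ennreal ((t * (1 / t) powr r) ^ n) * (ennreal (q ^ n) * E)"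
      by (intro mult_left_mono a) simp
    also have "\<dots> = ennreal (sqrt q ^ n) * E"
      using t q by (simp add: mult.assoc[symmetric] ennreal_mult[symmetric] power_mult_distrib[symmetric] tq)
    finally show "ennreal ((t * (1 / t) powr r) ^ n) * elw r m (a n) \<le> ennreal (sqrt q ^ n) * E" .
  qed
  also have "\<dots> = ennreal (1 / (1 - sqrt q)) * E"
    using q by (subst nn_integral_multc) (auto simp: geo)
  finally show ?thesis by (simp add: t_def mult_left_mono)
qed

section \<open>Convergence of the Neumann series\<close>

context
  fixes r :: real and m :: "'g \<Rightarrow> real"
  assumes r: "1 < r" and m: "moderate w m" and rc: "rc_bounded \<mu> K r m"
    and small: "max (Lpw_enorm_p \<mu> 1 w (osc U W)) (Lpw_enorm_p \<mu> 1 (\<lambda>x. w x / modular \<mu> x) (osc U W))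
        * ennreal (rc_norm \<mu> K r m) < 1"
begin

declare measurable_moderate[OF m, measurable] moderate_nonneg[OF m, simp]
abbreviation M where "M \<equiv> inM r m"

lemma inM_D: "M F \<Longrightarrow> F \<in> borel_measurable borel" "M F \<Longrightarrow> enr r m (cnorm F) < top" "M F \<Longrightarrow> conv \<mu> F K = F"
  by (simp_all add: inM_def[OF r m rc])

lemma resid_contraction:
  obtains q where "0 < q" "q < 1" "\<And>F n. M F \<Longrightarrow> enr r m (cnorm ((resid ^^ n) F)) \<le> ennreal (q ^ n) * enr r m (cnorm F)"
proof -
  define z where "z = max (Lpw_enorm_p \<mu> 1 w (osc U W)) (Lpw_enorm_p \<mu> 1 (\<lambda>x. w x / modular \<mu> x) (osc U W))
        * ennreal (rc_norm \<mu> K r m)"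
  obtain b where b: "z = ennreal b" "0 \<le> b" "b < 1"
    using small by (cases z) (auto simp: z_def[symmetric] ennreal_less_one_iff)
  \<comment> \<open>The factor for r-th powers is b^r, which may be 0; a number strictly between b^r
    and 1 is taken because the geometric sums ask for q > 0.\<close>
  define q where "q = (1 + b powr r) / 2"
  have br: "b powr r < 1"
    using powr_less_mono2[of r b 1] r b by simp
  have q: "0 < q" "q < 1" "b powr r \<le> q"
    using br by (auto simp: q_def add_pos_nonneg)
  have "enr r m (cnorm ((resid ^^ n) F)) \<le> ennreal (q ^ n) * enr r m (cnorm F)" if F: "M F" for F n
  proof (induction n)
    case (Suc n)
    have "enr r m (cnorm ((resid ^^ Suc n) F)) \<le> epow r z * enr r m (cnorm ((resid ^^ n) F))"
      using resid_bound[OF r m rc inM_resid_funpow[OF r m rc F]] by (simp add: z_def)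
    also have "\<dots> \<le> ennreal q * (ennreal (q ^ n) * enr r m (cnorm F))"
      using b q Suc by (intro mult_mono) (auto simp: epow_ennreal ennreal_leI)
    finally show ?case using q by (simp add: mult.assoc[symmetric] ennreal_mult)
  qed simp
  with q that show ?thesis by blast
qed

lemma neumann_series_bound:
  "\<exists>B<top. \<forall>F. M F \<longrightarrow>
     elw r m (\<lambda>i. \<integral>\<^sup>+n. cnorm (coef ((resid ^^ n) F)) i \<partial>count_space UNIV) \<le> B * enr r m (cnorm F)"
proof -
  obtain q where q: "0 < q" "q < 1"
    and R: "\<And>F n. M F \<Longrightarrow> enr r m (cnorm ((resid ^^ n) F)) \<le> ennreal (q ^ n) * enr r m (cnorm F)"
    using resid_contraction by blast
  obtain B where B: "B < top" "\<And>F. F \<in> borel_measurable borel \<Longrightarrow> elw r m (cnorm (coef F)) \<le> B * enr r m (cnorm F)"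
    using coef_bound[OF r m] by blast
  define A where "A = epow (r - 1) (ennreal (1 / (1 - q powr (1 / (2 * (r - 1)))))) * (ennreal (1 / (1 - sqrt q)) * B)"
  have "elw r m (\<lambda>i. \<integral>\<^sup>+n. cnorm (coef ((resid ^^ n) F)) i \<partial>count_space UNIV) \<le> A * enr r m (cnorm F)" if F: "M F" for F
  proof -
    have "elw r m (cnorm (coef ((resid ^^ n) F))) \<le> ennreal (q ^ n) * (B * enr r m (cnorm F))" for n
    proof -
      have "elw r m (cnorm (coef ((resid ^^ n) F))) \<le> B * enr r m (cnorm ((resid ^^ n) F))"
        by (intro B inM_D(1) inM_resid_funpow[OF r m rc] F)
      also have "\<dots> \<le> B * (ennreal (q ^ n) * enr r m (cnorm F))"
        by (intro mult_left_mono R F) simp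
      finally show ?thesis by (simp add: mult_ac)
    qed
    from geometric_series_bound[OF r q this] show ?thesis by (simp add: A_def mult.assoc)
  qed
  moreover have "A < top" using B by (simp add: A_def ennreal_mult_less_top)
  ultimately show ?thesis by blast
qed

text \<open>A finite weighted norm of the series of moduli forces each entry to be finite, since m >
  0 and null sets of the counting measure are empty. This makes the pointwise sum in
  \<open>neumann_coef\<close> meaningful and additive.\<close>

lemma neumann_summable:
  assumes F: "M F" shows "summable (\<lambda>n. norm (coef ((resid ^^ n) F) i))"
    and "cnorm (neumann_coef F) i \<le> (\<integral>\<^sup>+n. cnorm (coef ((resid ^^ n) F)) i \<partial>count_space UNIV)"
proof -
  let ?a = "\<lambda>i. \<integral>\<^sup>+n. cnorm (coef ((resid ^^ n) F)) i \<partial>count_space UNIV"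
  obtain B where B: "B < top" "elw r m ?a \<le> B * enr r m (cnorm F)"
    using neumann_series_bound F by blast
  then have "elw r m ?a < top"
    using inM_D(2)[OF F] by (auto simp: ennreal_mult_less_top intro: le_less_trans)
  then have "AE i in cs. epow r (ennreal (m (X i)) * ?a i) \<noteq> \<infinity>"
    unfolding elw_def by (intro nn_integral_PInf_AE) auto
  then have "ennreal (m (X i)) * ?a i \<noteq> top" by (simp add: AE_count_space)
  then have fin: "?a i < top"
    using moderate_pos[OF m, of "X i"] by (auto simp: ennreal_mult_eq_top_iff less_top)
  then have int: "integrable (count_space UNIV) (\<lambda>n. coef ((resid ^^ n) F) i)"
    by (subst integrable_iff_cnorm) auto
  then show "summable (\<lambda>n. norm (coef ((resid ^^ n) F) i))"
    by (simp add: integrable_count_space_nat_iff)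
  have "neumann_coef F i = (\<integral>n. coef ((resid ^^ n) F) i \<partial>count_space UNIV)"
    by (simp add: neumann_coef_def integral_count_space_nat[OF int])
  then show "cnorm (neumann_coef F) i \<le> ?a i"
    using ennreal_norm_integral_le[of "count_space UNIV" "\<lambda>n. coef ((resid ^^ n) F) i"] by simp
qed

lemmas neumann_summable' = summable_norm_cancel[OF neumann_summable(1)]

lemma neumann_coef_bound: "\<exists>B<top. \<forall>F. M F \<longrightarrow> elw r m (cnorm (neumann_coef F)) \<le> B * enr r m (cnorm F)"
proof -
  obtain B where B: "B < top" "\<And>F. M F \<Longrightarrow>
     elw r m (\<lambda>i. \<integral>\<^sup>+n. cnorm (coef ((resid ^^ n) F)) i \<partial>count_space UNIV) \<le> B * enr r m (cnorm F)"
    using neumann_series_bound by blast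
  have "elw r m (cnorm (neumann_coef F)) \<le> B * enr r m (cnorm F)" if "M F" for F
    using r neumann_summable(2)[OF that] by (intro order_trans[OF elw_mono B(2)[OF that]]) auto
  with B(1) show ?thesis by blast
qed

lemma neumann_coef_finite: "M F \<Longrightarrow> elw r m (cnorm (neumann_coef F)) < top"
proof -
  assume F: "M F"
  obtain B where "B < top" "elw r m (cnorm (neumann_coef F)) \<le> B * enr r m (cnorm F)"
    using neumann_coef_bound F by blast
  then show ?thesis using inM_D(2)[OF F] by (auto simp: ennreal_mult_less_top intro: le_less_trans)
qed

lemma neumann_coef_add:
  assumes "M F" "M G" shows "neumann_coef (\<lambda>x. F x + G x) = (\<lambda>i. neumann_coef F i + neumann_coef G i)"
proof
  fix i
  have "neumann_coef (\<lambda>x. F x + G x) i = (\<Sum>n. coef ((resid ^^ n) F) i + coef ((resid ^^ n) G) i)"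
    unfolding neumann_coef_def resid_funpow_add[OF r m rc assms]
      coef_add[OF r m rc inM_resid_funpow[OF r m rc assms(1)] inM_resid_funpow[OF r m rc assms(2)]] ..
  also have "\<dots> = neumann_coef F i + neumann_coef G i"
    unfolding neumann_coef_def using assms
    by (intro suminf_add[symmetric] neumann_summable')
  finally show "neumann_coef (\<lambda>x. F x + G x) i = neumann_coef F i + neumann_coef G i" .
qed

lemma neumann_coef_cmult:
  assumes "M F" shows "neumann_coef (\<lambda>x. a * F x) = (\<lambda>i. a * neumann_coef F i)"
proof
  fix i
  have "neumann_coef (\<lambda>x. a * F x) i = (\<Sum>n. a * coef ((resid ^^ n) F) i)"
    unfolding neumann_coef_def resid_funpow_cmult coef_cmult ..
  also have "\<dots> = a * neumann_coef F i"
    unfolding neumann_coef_def using assms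
    by (intro suminf_mult neumann_summable')
  finally show "neumann_coef (\<lambda>x. a * F x) i = a * neumann_coef F i" .
qed

text \<open>The defect \<open>F - synK (neumann_coef F)\<close> is bounded in \<open>F\<close> and unchanged when \<open>F\<close> is
  replaced by its residual, hence it vanishes by contraction.\<close>

lemma synK_neumann_coef:
  assumes F: "M F" shows "synK (neumann_coef F) = F"
proof -
  define D where "D F x = F x - synK (neumann_coef F) x" for F x
  have inM_defect: "M (D F)" if "M F" for F
    unfolding D_def using that by (intro inM_diff[OF r m rc] synK_inM[OF r m rc] neumann_coef_finite)
  have step: "D F = D (resid F)" if F: "M F" for F
  proof -
    note R = inM_resid[OF r m rc F]
    have "neumann_coef F i = coef F i + neumann_coef (resid F) i" for i
    proof -
      have "summable (\<lambda>n. coef ((resid ^^ n) F) i)"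
        by (intro neumann_summable' F)
      from suminf_split_head[OF this] show ?thesis
        by (simp add: neumann_coef_def funpow_swap1)
    qed
    then have "neumann_coef F = (\<lambda>i. coef F i + neumann_coef (resid F) i)" by blast
    then have "synK (neumann_coef F) = (\<lambda>x. synK (coef F) x + synK (neumann_coef (resid F)) x)"
      using synK_add[OF r m rc inM_coef[OF r m rc F] neumann_coef_finite[OF R]] by simp
    then show ?thesis by (intro ext) (simp add: D_def resid_def)
  qed
  have iter: "D F = D ((resid ^^ n) F)" for n
  proof (induction n)
    case (Suc n)
    then show ?case using step[OF inM_resid_funpow[OF r m rc F, of n]] by simp
  qed simp
  obtain B where B: "B < top" "\<And>F. M F \<Longrightarrow> elw r m (cnorm (neumann_coef F)) \<le> B * enr r m (cnorm F)"
    using neumann_coef_bound by blast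
  obtain C where C: "C < top" "\<And>c. elw r m (cnorm c) < top \<Longrightarrow> enr r m (cnorm (synK c)) \<le> C * elw r m (cnorm c)"
    using synK_bound[OF r m rc] by blast
  have bnd: "enr r m (cnorm (D F)) \<le> ennreal (2 powr r) * (1 + C * B) * enr r m (cnorm F)" if F: "M F" for F
  proof -
    have [measurable]: "F \<in> borel_measurable borel" using F by (rule inM_D)
    have "enr r m (cnorm (D F)) \<le> ennreal (2 powr r) * (enr r m (cnorm F) + enr r m (cnorm (synK (neumann_coef F))))"
      using r by (intro enr_add_le)
        (auto simp: D_def ennreal_plus[symmetric] norm_triangle_ineq4 simp del: ennreal_plus)
    also have "enr r m (cnorm (synK (neumann_coef F))) \<le> C * elw r m (cnorm (neumann_coef F))"
      by (intro C neumann_coef_finite F)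
    also have "\<dots> \<le> C * (B * enr r m (cnorm F))" by (intro mult_left_mono B F) simp
    finally show ?thesis by (simp add: distrib_right mult.assoc mult_left_mono add_left_mono)
  qed
  obtain q where q: "0 < q" "q < 1"
    and R: "\<And>F n. M F \<Longrightarrow> enr r m (cnorm ((resid ^^ n) F)) \<le> ennreal (q ^ n) * enr r m (cnorm F)"
    using resid_contraction by blast
  define A where "A = ennreal (2 powr r) * (1 + C * B) * enr r m (cnorm F)"
  have A: "A < top" using B C inM_D(2)[OF F] by (simp add: A_def ennreal_mult_less_top)
  have le: "enr r m (cnorm (D F)) \<le> A * ennreal (q ^ n)" for n
  proof -
    have "enr r m (cnorm (D F)) \<le> ennreal (2 powr r) * (1 + C * B) * enr r m (cnorm ((resid ^^ n) F))"
      using bnd[OF inM_resid_funpow[OF r m rc F, of n]] iter[of n] by simp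
    also have "\<dots> \<le> ennreal (2 powr r) * (1 + C * B) * (ennreal (q ^ n) * enr r m (cnorm F))"
      by (intro mult_left_mono R F) simp
    finally show ?thesis by (simp add: A_def mult_ac)
  qed
  have "(\<lambda>n. q ^ n) \<longlonglongrightarrow> 0" using q by (intro LIMSEQ_realpow_zero) auto
  then have "(\<lambda>n. ennreal (q ^ n)) \<longlonglongrightarrow> ennreal 0" by (rule tendsto_ennrealI)
  then have "(\<lambda>n. A * ennreal (q ^ n)) \<longlonglongrightarrow> A * ennreal 0" by (intro ennreal_tendsto_cmult A)
  then have "enr r m (cnorm (D F)) \<le> A * ennreal 0"
    by (rule LIMSEQ_le_const) (use le in blast)
  then have zero: "enr r m (cnorm (D F)) = 0" by simp
  have [measurable]: "D F \<in> borel_measurable borel" using inM_D(1)[OF inM_defect[OF F]] .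
  have "AE x in \<mu>. epow r (ennreal (m x) * cnorm (D F) x) = 0"
    using zero unfolding enr_def by (subst (asm) nn_integral_0_iff_AE) auto
  then have "AE x in \<mu>. synK (neumann_coef F) x = F x"
  proof eventually_elim
    case (elim x)
    then show ?case using moderate_pos[OF m, of x] by (auto simp: D_def ennreal_eq_0_iff)
  qed
  \<comment> \<open>Both sides are reproduced by K, so equality almost everywhere is
    equality.\<close>
  then show ?thesis
    by (intro inM_AE_eq[OF r m rc] synK_inM[OF r m rc] neumann_coef_finite F)
qed

end

section \<open>Synthesis in the coorbit space\<close>

text \<open>The pairing of the synthesized function against \<open>V v\<close> defines the functional
  \<open>\<Sum> c i \<pi>(X i) u\<close>.\<close>

definition dualfun :: "('i \<Rightarrow> complex) \<Rightarrow> 'h \<Rightarrow> complex" where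
  "dualfun c v = (if v \<in> S then \<integral>y. synK c y * cnj (V v y) \<partial>\<mu> else 0)"

lemma lw_iff:
  assumes "moderate w m"
  shows "c \<in> lw r (\<lambda>i. m (X i)) \<longleftrightarrow> elw r m (cnorm c) < top"
    and lw_norm_eq: "c \<in> lw r (\<lambda>i. m (X i)) \<Longrightarrow>
      lw_norm r (\<lambda>i. m (X i)) c = enn2real (elw r m (cnorm c)) powr (1 / r)"
proof -
  have eq: "elw r m (cnorm c) = (\<integral>\<^sup>+i. ennreal ((m (X i) * cmod (c i)) powr r) \<partial>cs)"
    using moderate_nonneg[OF assms] by (simp add: elw_def epow_ennreal ennreal_mult[symmetric])
  show iff: "c \<in> lw r (\<lambda>i. m (X i)) \<longleftrightarrow> elw r m (cnorm c) < top"
    unfolding eq lw_def mem_Collect_eq by (rule summable_on_iff_nn_integral) simp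
  assume "c \<in> lw r (\<lambda>i. m (X i))"
  then have "elw r m (cnorm c) = ennreal (\<Sum>\<^sub>\<infinity>i. (m (X i) * cmod (c i)) powr r)"
    unfolding eq lw_def mem_Collect_eq by (intro nn_integral_eq_infsum) auto
  then show "lw_norm r (\<lambda>i. m (X i)) c = enn2real (elw r m (cnorm c)) powr (1 / r)"
    by (simp add: lw_norm_def infsum_nonneg)
qed

text \<open>The total is split additively over A and its complement, which turns convergence of the
  finite partial sums into smallness of the tail without subtracting in
  \<open>ennreal\<close>.\<close>

lemma elw_tail:
  assumes m: "moderate w m" and c: "elw r m (cnorm c) < top" and e: "0 < e"
  obtains F where "finite F"
    "\<And>A. finite A \<Longrightarrow> F \<subseteq> A \<Longrightarrow> elw r m (cnorm (\<lambda>i. if i \<in> A then 0 else c i)) \<le> ennreal e"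
proof -
  define f where "f i = (m (X i) * cmod (c i)) powr r" for i
  have ef: "epow r (ennreal (m (X i)) * cnorm c i) = ennreal (f i)" for i
    using moderate_nonneg[OF m] by (simp add: f_def epow_ennreal ennreal_mult[symmetric])
  have f0: "0 \<le> f i" for i by (simp add: f_def)
  have s: "f summable_on UNIV"
    using c f0 by (subst summable_on_iff_nn_integral) (auto simp: elw_def ef)
  have tot: "elw r m (cnorm c) = ennreal (infsum f UNIV)"
    using nn_integral_eq_infsum[OF f0 s] by (simp add: elw_def ef)
  have "(sum f \<longlongrightarrow> infsum f UNIV) (finite_subsets_at_top UNIV)"
    using has_sum_infsum[OF s] by (simp add: has_sum_def)
  then have "eventually (\<lambda>A. dist (sum f A) (infsum f UNIV) < e) (finite_subsets_at_top UNIV)"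
    using e by (rule tendstoD)
  then obtain F where F: "finite F" "\<And>A. finite A \<Longrightarrow> F \<subseteq> A \<Longrightarrow> dist (sum f A) (infsum f UNIV) < e"
    unfolding eventually_finite_subsets_at_top by auto
  have "elw r m (cnorm (\<lambda>i. if i \<in> A then 0 else c i)) \<le> ennreal e" if A: "finite A" "F \<subseteq> A" for A
  proof -
    let ?R = "elw r m (cnorm (\<lambda>i. if i \<in> A then 0 else c i))"
    have "ennreal (infsum f UNIV) = (\<integral>\<^sup>+i. ennreal (f i) * indicator A i + epow r (ennreal (m (X i)) * cnorm (\<lambda>i. if i \<in> A then 0 else c i) i) \<partial>cs)"
      unfolding tot[symmetric] elw_def ef by (intro nn_integral_cong) (auto simp: ef indicator_def)
    also have "\<dots> = (\<integral>\<^sup>+i. ennreal (f i) * indicator A i \<partial>cs) + ?R"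
      unfolding elw_def by (rule nn_integral_add) auto
    also have "(\<integral>\<^sup>+i. ennreal (f i) * indicator A i \<partial>cs) = (\<Sum>i\<in>A. ennreal (f i) * indicator A i)"
      using A by (intro nn_integral_count_space') auto
    also have "\<dots> = (\<Sum>i\<in>A. ennreal (f i))" by (intro sum.cong) auto
    also have "\<dots> = ennreal (sum f A)" using f0 by (intro sum_ennreal) auto
    finally have eq: "ennreal (infsum f UNIV) = ennreal (sum f A) + ?R" .
    obtain t where t: "?R = ennreal t" "0 \<le> t"
      using eq by (cases ?R) auto
    have "infsum f UNIV = sum f A + t"
    proof -
      have "0 \<le> sum f A" using f0 by (simp add: sum_nonneg)
      moreover from this have "ennreal (infsum f UNIV) = ennreal (sum f A + t)"
        using eq t by (simp add: ennreal_plus[symmetric] del: ennreal_plus)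
      moreover have "0 \<le> infsum f UNIV" using f0 by (simp add: infsum_nonneg)
      ultimately show ?thesis using t(2) by (metis ennreal_inj add_nonneg_nonneg)
    qed
    with F(2)[OF A] have "t < e" by (simp add: dist_real_def)
    then show ?thesis using t by (simp add: ennreal_leI)
  qed
  with F(1) that show ?thesis by blast
qed

context
  fixes r :: real and m :: "'g \<Rightarrow> real"
  assumes r: "1 < r" and m: "moderate w m" and rc: "rc_bounded \<mu> K r m"
begin

declare measurable_moderate[OF m, measurable] moderate_nonneg[OF m, simp]

lemma synK_V_integrable:
  assumes c: "elw r m (cnorm c) < top" and v: "v \<in> S"
  shows "integrable \<mu> (\<lambda>y. synK c y * cnj (V v y))"
proof -
  have "(\<integral>\<^sup>+y. cnorm (synK c) y * cnorm (V v) y \<partial>\<mu>) < top"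
    using synK_inM[OF r m rc c] v conjugate_exponent[OF r m]
    by (intro pairing_finite[OF r m]) (auto simp: inM_def[OF r m rc] mem_S_iff)
  then show ?thesis by (subst integrable_iff_cnorm) (auto simp: norm_mult ennreal_mult)
qed

text \<open>Hoelder for m |synK c| and (w / m(e)) |V v|, whose product dominates the integrand
  because m(e) \<le> m(y) w(y). A single seminorm, with the conjugate exponent of r, therefore
  bounds the functional.\<close>

lemma dualfun_bound:
  assumes c: "elw r m (cnorm c) < top"
  shows "\<exists>B. \<forall>v\<in>S. cmod (dualfun c v) \<le> B * Lpw_norm \<mu> (r / (r - 1)) w (V v)"
proof -
  define q where "q = r / (r - 1)"
  have q: "1 < q" "(r - 1) / r = 1 / q" using r by (auto simp: q_def field_simps)
  define E where "E = enr r m (cnorm (synK c))"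
  have E: "E < top" using synK_inM[OF r m rc c] by (simp add: inM_def[OF r m rc] E_def)
  note m0 = moderate_pos[OF m]
  have "cmod (dualfun c v) \<le> (enn2real E powr (1 / r) / m 0) * Lpw_norm \<mu> q w (V v)" if v: "v \<in> S" for v
  proof -
    let ?f = "\<lambda>y. m y * cmod (synK c y)" and ?g = "\<lambda>y. w y / m 0 * cmod (V v y)"
    have vfin: "enr q w (cnorm (V v)) < top" using v q by (simp add: mem_S_iff)
    have gint: "(\<integral>\<^sup>+y. ennreal (?g y powr q) \<partial>\<mu>) = ennreal ((1 / m 0) powr q) * enr q w (cnorm (V v))"
    proof -
      have "ennreal (?g y powr q) = ennreal ((1 / m 0) powr q) * epow q (ennreal (w y) * cnorm (V v) y)" for y
      proof -
        have "?g y powr q = (1 / m 0) powr q * (w y * cmod (V v y)) powr q"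
          using m0[of 0] by (subst powr_mult[symmetric]) auto
        then show ?thesis by (simp add: epow_ennreal ennreal_mult[symmetric])
      qed
      then show ?thesis unfolding enr_def by (simp add: nn_integral_cmult)
    qed
    have fint: "(\<integral>\<^sup>+y. ennreal (?f y powr r) \<partial>\<mu>) = E"
      unfolding E_def enr_def by (simp add: epow_ennreal ennreal_mult[symmetric])
    have "cnorm (dualfun c) v \<le> (\<integral>\<^sup>+y. ennreal (?f y * ?g y) \<partial>\<mu>)"
    proof -
      have "cnorm (dualfun c) v \<le> (\<integral>\<^sup>+y. cnorm (\<lambda>y. synK c y * cnj (V v y)) y \<partial>\<mu>)"
        using ennreal_norm_integral_le[of \<mu> "\<lambda>y. synK c y * cnj (V v y)"] v by (simp add: dualfun_def)
      also have "\<dots> \<le> (\<integral>\<^sup>+y. ennreal (?f y * ?g y) \<partial>\<mu>)"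
      proof (intro nn_integral_mono ennreal_leI)
        fix y
        have "m 0 \<le> m y * w y" using moderate_le_right[OF m, of y "- y"] by simp
        then have "1 \<le> m y * (w y / m 0)" using m0[of 0] by simp
        then have "1 * (cmod (synK c y) * cmod (V v y)) \<le> m y * (w y / m 0) * (cmod (synK c y) * cmod (V v y))"
          by (intro mult_right_mono) auto
        then show "cmod (synK c y * cnj (V v y)) \<le> ?f y * ?g y" by (simp add: norm_mult mult_ac)
      qed
      finally show ?thesis .
    qed
    then have "epow r (cnorm (dualfun c) v) \<le> epow r (\<integral>\<^sup>+y. ennreal (?f y * ?g y) \<partial>\<mu>)"
      using r by (intro epow_mono) auto
    also have "\<dots> \<le> epow (r - 1) (\<integral>\<^sup>+y. ennreal (?g y powr q) \<partial>\<mu>) * (\<integral>\<^sup>+y. ennreal (?f y powr r) \<partial>\<mu>)"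
      unfolding q_def using m0[of 0] by (intro nn_integral_holder[OF r]) auto
    finally have "epow r (cnorm (dualfun c) v)
        \<le> epow (r - 1) (ennreal ((1 / m 0) powr q) * enr q w (cnorm (V v))) * E"
      unfolding gint fint .
    \<comment> \<open>Taking r-th roots: (r-1)/r = 1/q makes the seminorm enter to the first
      power.\<close>
    then have "epow (1 / r) (epow r (cnorm (dualfun c) v))
        \<le> epow (1 / r) (epow (r - 1) (ennreal ((1 / m 0) powr q) * enr q w (cnorm (V v))) * E)"
      using r by (intro epow_mono) auto
    then have "cnorm (dualfun c) v \<le> epow (1 / q) (ennreal ((1 / m 0) powr q) * enr q w (cnorm (V v))) * epow (1 / r) E"
      using r q by (simp add: epow_mult epow_epow)
    also have "\<dots> = ennreal ((1 / m 0) * enn2real (enr q w (cnorm (V v))) powr (1 / q) * enn2real E powr (1 / r))"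
    proof -
      have "epow (1 / q) (enr q w (cnorm (V v))) = ennreal (enn2real (enr q w (cnorm (V v))) powr (1 / q))"
        using vfin by (simp add: epow_def)
      moreover have "epow (1 / r) E = ennreal (enn2real E powr (1 / r))"
        using E by (simp add: epow_def)
      moreover have "epow (1 / q) (ennreal ((1 / m 0) powr q)) = ennreal (1 / m 0)"
        using q m0[of 0] by (simp add: epow_ennreal powr_powr)
      ultimately show ?thesis using m0[of 0]
        by (simp add: epow_mult ennreal_mult[symmetric])
    qed
    finally show ?thesis
      using m0[of 0] by (simp add: Lpw_norm_eq mult_ac)
  qed
  then show ?thesis unfolding q_def by blast
qed

lemma dualfun_antidual:
  assumes c: "elw r m (cnorm c) < top"
  shows "dualfun c \<in> antidual \<mu> sc ip \<pi> u w"
proof -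
  obtain B where B: "\<And>v. v \<in> S \<Longrightarrow> cmod (dualfun c v) \<le> B * Lpw_norm \<mu> (r / (r - 1)) w (V v)"
    using dualfun_bound[OF c] by blast
  have add: "dualfun c (v + v') = dualfun c v + dualfun c v'" if "v \<in> S" "v' \<in> S" for v v'
    using that S_add[OF that] Bochner_Integration.integral_add[OF synK_V_integrable[OF c that(1)] synK_V_integrable[OF c that(2)]]
    by (simp add: dualfun_def V_add distrib_left)
  have scl: "dualfun c (sc a v) = cnj a * dualfun c v" if "v \<in> S" for a v
  proof -
    have "dualfun c (sc a v) = (\<integral>y. cnj a * (synK c y * cnj (V v y)) \<partial>\<mu>)"
      using S_sc[OF that] by (simp add: dualfun_def V_sc mult_ac)
    then show ?thesis using that by (simp add: dualfun_def)
  qed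
  have "finite {r / (r - 1)} \<and> {r / (r - 1)} \<subseteq> {1<..} \<and>
     (\<forall>v\<in>S. cmod (dualfun c v) \<le> B * (\<Sum>p\<in>{r / (r - 1)}. Lpw_norm \<mu> p w (V v)))"
    using B conjugate_exponent[OF r m] by simp
  then have "\<exists>P C. finite P \<and> P \<subseteq> {1<..} \<and>
     (\<forall>v\<in>S. cmod (dualfun c v) \<le> C * (\<Sum>p\<in>P. Lpw_norm \<mu> p w (V v)))" by blast
  then show ?thesis
    unfolding antidual_def mem_Collect_eq using add scl by (auto simp: dualfun_def)
qed

text \<open>Testing at \<pi>(x)u turns the pairing into convolution with K, since the conjugate of
  the transform of \<pi>(x)u at y is K(y^{-1} x); \<open>synK c\<close> is reproduced by it.\<close>

lemma Ve_dualfun: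
  assumes c: "elw r m (cnorm c) < top"
  shows "Ve \<pi> u (dualfun c) = synK c"
proof
  fix x
  have "Ve \<pi> u (dualfun c) x = conv \<mu> (synK c) K x"
    unfolding Ve_def dualfun_def conv_def
    using S_pi[of x] by (simp add: V_pi K_reflect[symmetric])
  also have "\<dots> = synK c x" using synK_inM[OF r m rc c] by (simp add: inM_def[OF r m rc])
  finally show "Ve \<pi> u (dualfun c) x = synK c x" .
qed

text \<open>\<open>reproducing_formula\<close> supplies F * K = F for F = V_e T. Norms and series in
  the coorbit space can then be handled through F alone.\<close>

lemma Co_iff: "T \<in> Co \<mu> sc ip \<pi> u w r m \<longleftrightarrow> T \<in> antidual \<mu> sc ip \<pi> u w \<and> inM r m (Ve \<pi> u T)"
  using reproducing_formula[OF r m] by (auto simp: Co_def Lpw_iff inM_def[OF r m rc])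

lemma partial_sum_eq:
  assumes "finite A"
  shows "Lpw_enorm_p \<mu> r m (\<lambda>x. cmod (T (\<pi> x u) - (\<Sum>i\<in>A. ip (sc (c i) (\<pi> (X i) u)) (\<pi> x u))))
    = enr r m (cnorm (\<lambda>x. Ve \<pi> u T x - synK (\<lambda>i. if i \<in> A then c i else 0) x))"
  using assms by (simp add: Lpw_enorm_p_eq Ve_def synK_finite ip_sc ip_pi_pi)

text \<open>The transform of T minus a partial sum is \<open>synK\<close> of the coefficients
  outside A, hence controlled by the tail in the sequence space.\<close>

lemma synth_conv_if:
  assumes c: "elw r m (cnorm c) < top" and T: "T \<in> Co \<mu> sc ip \<pi> u w r m" and eq: "Ve \<pi> u T = synK c"
  shows "synth_conv \<mu> sc ip \<pi> u w r m X c T"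
  unfolding synth_conv_def
proof (intro conjI allI impI)
  fix e :: real assume e: "0 < e"
  obtain B where B: "B < top" "\<And>c. elw r m (cnorm c) < top \<Longrightarrow> enr r m (cnorm (synK c)) \<le> B * elw r m (cnorm c)"
    using synK_bound[OF r m rc] by blast
  then obtain b where b: "B = ennreal b" "0 \<le> b" by (cases B) auto
  \<comment> \<open>Dividing by b + 1 instead of b covers b = 0; halving e makes the final
    inequality strict.\<close>
  define e' where "e' = e / 2 / (b + 1)"
  have e': "0 < e'" using e b by (simp add: e'_def)
  have "b + 1 \<noteq> 0" using b by linarith
  then have e'2: "(b + 1) * e' = e / 2" by (metis e'_def nonzero_eq_divide_eq mult.commute)
  obtain F where F: "finite F"
    "\<And>A. finite A \<Longrightarrow> F \<subseteq> A \<Longrightarrow> elw r m (cnorm (\<lambda>i. if i \<in> A then 0 else c i)) \<le> ennreal e'"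
    using elw_tail[OF m c e'] by blast
  have "enr r m (cnorm (\<lambda>x. Ve \<pi> u T x - synK (\<lambda>i. if i \<in> A then c i else 0) x)) < ennreal e"
    if A: "finite A" "F \<subseteq> A" for A
  proof -
    let ?d = "\<lambda>i. if i \<in> A then 0 else c i" and ?c = "\<lambda>i. if i \<in> A then c i else 0"
    have d: "elw r m (cnorm ?d) < top" using F(2)[OF A] ennreal_less_top order.strict_trans1 by blast
    have c': "elw r m (cnorm ?c) < top"
      using r by (intro le_less_trans[OF elw_mono c]) auto
    have "(\<lambda>i. ?d i + ?c i) = c" by auto
    then have "synK c = (\<lambda>x. synK ?d x + synK ?c x)"
      using synK_add[OF r m rc d c'] by simp
    then have "enr r m (cnorm (\<lambda>x. Ve \<pi> u T x - synK ?c x)) = enr r m (cnorm (synK ?d))"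
      by (simp add: eq)
    also have "\<dots> \<le> B * elw r m (cnorm ?d)" by (rule B(2)[OF d])
    also have "\<dots> \<le> ennreal b * ennreal e'" unfolding b(1) by (intro mult_left_mono F(2)[OF A]) auto
    also have "\<dots> = ennreal (b * e')" using b e' by (simp add: ennreal_mult)
    also have "\<dots> < ennreal e"
    proof (rule ennreal_lessI[OF e])
      have "b * e' \<le> (b + 1) * e'" using e' by (intro mult_right_mono) auto
      also have "\<dots> = e / 2" by (rule e'2)
      finally show "b * e' < e" using e by simp
    qed
    finally show ?thesis .
  qed
  with F(1) show "\<exists>F. finite F \<and> (\<forall>G. finite G \<and> F \<subseteq> G \<longrightarrow>
        Lpw_enorm_p \<mu> r m (\<lambda>x. cmod (T (\<pi> x u) - (\<Sum>i\<in>G. ip (sc (c i) (\<pi> (X i) u)) (\<pi> x u)))) < ennreal e)"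
    by (intro exI[of _ F]) (auto simp: partial_sum_eq)
qed (rule T)

lemma synth_conv_exists:
  assumes c: "elw r m (cnorm c) < top"
  shows "synth_conv \<mu> sc ip \<pi> u w r m X c (dualfun c)"
  by (intro synth_conv_if c Ve_dualfun)
     (simp add: Co_iff dualfun_antidual[OF c] Ve_dualfun[OF c] synK_inM[OF r m rc c])

text \<open>The estimate concerns every limit T of the series, so T is compared with one close
  partial sum rather than identified with \<open>dualfun c\<close>. Partial sums are bounded by
  \<open>synK_bound\<close>, and the error e is arbitrary.\<close>

lemma synth_conv_bound:
  "\<exists>b\<ge>0. \<forall>c T. elw r m (cnorm c) < top \<longrightarrow> synth_conv \<mu> sc ip \<pi> u w r m X c T \<longrightarrow>
     enr r m (cnorm (Ve \<pi> u T)) \<le> ennreal b * elw r m (cnorm c)"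
proof -
  obtain B where B: "B < top" "\<And>c. elw r m (cnorm c) < top \<Longrightarrow> enr r m (cnorm (synK c)) \<le> B * elw r m (cnorm c)"
    using synK_bound[OF r m rc] by blast
  then obtain b where b: "B = ennreal b" "0 \<le> b" by (cases B) auto
  have "enr r m (cnorm (Ve \<pi> u T)) \<le> ennreal (2 powr r * b) * elw r m (cnorm c)"
    if c: "elw r m (cnorm c) < top" and s: "synth_conv \<mu> sc ip \<pi> u w r m X c T" for c T
  proof (rule ennreal_le_epsilon)
    fix e :: real assume e: "0 < e"
    \<comment> \<open>Absorbs the factor 2^r of the crude triangle inequality for r-th
      powers.\<close>
    define e' where "e' = e / 2 powr r"
    have e': "0 < e'" "2 powr r * e' = e" using e by (simp_all add: e'_def)
    have TM: "inM r m (Ve \<pi> u T)" using s by (simp add: synth_conv_def Co_iff)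
    then have [measurable]: "Ve \<pi> u T \<in> borel_measurable borel" by (simp add: inM_def[OF r m rc])
    obtain A where A: "finite A"
      "Lpw_enorm_p \<mu> r m (\<lambda>x. cmod (T (\<pi> x u) - (\<Sum>i\<in>A. ip (sc (c i) (\<pi> (X i) u)) (\<pi> x u)))) < ennreal e'"
      using s e'(1) unfolding synth_conv_def by blast
    let ?c = "\<lambda>i. if i \<in> A then c i else 0"
    have cc: "elw r m (cnorm ?c) \<le> elw r m (cnorm c)" using r by (intro elw_mono) auto
    then have c': "elw r m (cnorm ?c) < top" using c by (rule le_less_trans)
    have small: "enr r m (cnorm (\<lambda>x. Ve \<pi> u T x - synK ?c x)) \<le> ennreal e'"
      using A by (simp add: partial_sum_eq less_imp_le)
    have "enr r m (cnorm (Ve \<pi> u T)) \<le> ennreal (2 powr r) * (enr r m (cnorm (\<lambda>x. Ve \<pi> u T x - synK ?c x)) + enr r m (cnorm (synK ?c)))"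
    proof (rule enr_add_le)
      show "AE x in \<mu>. cnorm (Ve \<pi> u T) x \<le> cnorm (\<lambda>x. Ve \<pi> u T x - synK ?c x) x + cnorm (synK ?c) x"
      proof (rule AE_I2)
        fix x
        have "cmod (Ve \<pi> u T x) \<le> cmod (Ve \<pi> u T x - synK ?c x) + cmod (synK ?c x)"
          using norm_triangle_ineq[of "Ve \<pi> u T x - synK ?c x" "synK ?c x"] by simp
        then show "cnorm (Ve \<pi> u T) x \<le> cnorm (\<lambda>x. Ve \<pi> u T x - synK ?c x) x + cnorm (synK ?c) x"
          by (simp add: ennreal_plus[symmetric] del: ennreal_plus)
      qed
    qed (use r in auto)
    also have "\<dots> \<le> ennreal (2 powr r) * (ennreal e' + B * elw r m (cnorm c))"
      by (intro mult_left_mono add_mono small order_trans[OF B(2)[OF c']] cc) auto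
    also have "\<dots> = ennreal (2 powr r * b) * elw r m (cnorm c) + ennreal e"
    proof -
      have "ennreal (2 powr r) * ennreal e' = ennreal e" "ennreal (2 powr r) * B = ennreal (2 powr r * b)"
        using b e' by (simp_all add: ennreal_mult[symmetric])
      then show ?thesis by (simp add: distrib_left mult.assoc[symmetric] add.commute)
    qed
    finally show "enr r m (cnorm (Ve \<pi> u T)) \<le> ennreal (2 powr r * b) * elw r m (cnorm c) + ennreal e" .
  qed
  then show ?thesis using b by (intro exI[of _ "2 powr r * b"]) auto
qed

end

end

theorem mainTheorem4:
  fixes \<mu> :: "'g::{group_add, topological_space, t2_space, second_countable_topology} measure"
    and sc :: "complex \<Rightarrow> 'h::ab_group_add \<Rightarrow> 'h"
    and ip :: "'h \<Rightarrow> 'h \<Rightarrow> complex"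
    and \<pi> :: "'g \<Rightarrow> 'h \<Rightarrow> 'h"
    and u :: 'h
    and w :: "'g \<Rightarrow> real"
    and W :: "'g \<Rightarrow> complex"
    and U :: "'g set"
    and X :: "'i \<Rightarrow> 'g"
    and \<psi> :: "'i \<Rightarrow> 'g \<Rightarrow> real"
  assumes G: "lc_group TYPE('g)"
    and haar: "left_haar \<mu>"
    and H: "hilbert sc ip"
    and rep: "unitary_rep sc ip \<pi>"
    and adm: "admissible \<mu> ip \<pi> u"
    and wt: "weight w"
    and K_int: "\<forall>p>1. Kf ip \<pi> u \<in> Lpw \<mu> p w"
    and W_cont: "continuous_on UNIV W"
    and W_repr: "conv \<mu> W (Kf ip \<pi> u) = Kf ip \<pi> u"
    and W_max: "\<exists>Q. unit_nbhd Q \<and> maxfun \<mu> Q W \<in> Lpw \<mu> 1 w \<and>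
                    maxfun \<mu> Q W \<in> Lpw \<mu> 1 (\<lambda>x. w x / modular \<mu> x)"
    and U: "unit_nbhd U"
    and bupu: "bupu U X \<psi>"
  shows "\<exists>Cop :: ('h \<Rightarrow> complex) \<Rightarrow> 'i \<Rightarrow> complex.
    \<forall>(r::real) (m::'g \<Rightarrow> real).
      r > 1 \<and> moderate w m \<and> rc_bounded \<mu> (Kf ip \<pi> u) r m \<and>
      max (Lpw_enorm_p \<mu> 1 w (osc U W)) (Lpw_enorm_p \<mu> 1 (\<lambda>x. w x / modular \<mu> x) (osc U W))
        * ennreal (rc_norm \<mu> (Kf ip \<pi> u) r m) < 1
      \<longrightarrow>
      (\<forall>c\<in>lw r (\<lambda>i. m (X i)). \<exists>T. synth_conv \<mu> sc ip \<pi> u w r m X c T) \<and>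
      (\<exists>B. \<forall>c\<in>lw r (\<lambda>i. m (X i)). \<forall>T. synth_conv \<mu> sc ip \<pi> u w r m X c T \<longrightarrow>
            Co_norm \<mu> \<pi> u r m T \<le> B * lw_norm r (\<lambda>i. m (X i)) c) \<and>
      (\<forall>T\<in>Co \<mu> sc ip \<pi> u w r m. Cop T \<in> lw r (\<lambda>i. m (X i))) \<and>
      (\<forall>T\<in>Co \<mu> sc ip \<pi> u w r m. \<forall>T'\<in>Co \<mu> sc ip \<pi> u w r m.
            Cop (\<lambda>v. T v + T' v) = (\<lambda>i. Cop T i + Cop T' i)) \<and>
      (\<forall>a. \<forall>T\<in>Co \<mu> sc ip \<pi> u w r m. Cop (\<lambda>v. a * T v) = (\<lambda>i. a * Cop T i)) \<and>
      (\<exists>B. \<forall>T\<in>Co \<mu> sc ip \<pi> u w r m.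
            lw_norm r (\<lambda>i. m (X i)) (Cop T) \<le> B * Co_norm \<mu> \<pi> u r m T) \<and>
      (\<forall>T\<in>Co \<mu> sc ip \<pi> u w r m. synth_conv \<mu> sc ip \<pi> u w r m X (Cop T) T)"
proof -
  interpret sampled_coorbit \<mu> w sc ip \<pi> u W U X \<psi>
    using assms by unfold_locales
  \<comment> \<open>Fixed before r and m are introduced, and built from V_e T and the fixed data
    only; consistency across different (r, m) is contained in the order of the quantifiers.\<close>
  define Cop where "Cop T = neumann_coef (Ve \<pi> u T)" for T :: "'h \<Rightarrow> complex"
  show ?thesis
  proof (rule exI[of _ Cop], intro allI impI, elim conjE)
    fix r :: real and m :: "'g \<Rightarrow> real"
    assume r: "1 < r" and m: "moderate w m" and rc: "rc_bounded \<mu> K r m"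
      and small: "max (Lpw_enorm_p \<mu> 1 w (osc U W)) (Lpw_enorm_p \<mu> 1 (\<lambda>x. w x / modular \<mu> x) (osc U W))
        * ennreal (rc_norm \<mu> K r m) < 1"
    note facts = r m rc
    note [measurable] = measurable_moderate[OF m] and [simp] = moderate_nonneg[OF m]
    let ?Co = "Co \<mu> sc ip \<pi> u w r m" and ?lw = "lw r (\<lambda>i. m (X i))"
    have CoM: "inM r m (Ve \<pi> u T)" if "T \<in> ?Co" for T using that by (simp add: Co_iff[OF facts])
    have Co_norm: "Co_norm \<mu> \<pi> u r m T = enn2real (enr r m (cnorm (Ve \<pi> u T))) powr (1 / r)"
      if "T \<in> ?Co" for T
      using CoM[OF that] by (simp add: Co_norm_def Lpw_norm_eq inM_def[OF facts])
    have 1: "\<forall>c\<in>?lw. \<exists>T. synth_conv \<mu> sc ip \<pi> u w r m X c T"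
    proof (intro ballI exI)
      fix c assume "c \<in> ?lw"
      then show "synth_conv \<mu> sc ip \<pi> u w r m X c (dualfun c)"
        by (intro synth_conv_exists[OF facts]) (simp add: lw_iff[OF m])
    qed
    obtain b where b: "0 \<le> b" "\<And>c T. elw r m (cnorm c) < top \<Longrightarrow> synth_conv \<mu> sc ip \<pi> u w r m X c T \<Longrightarrow>
       enr r m (cnorm (Ve \<pi> u T)) \<le> ennreal b * elw r m (cnorm c)"
      using synth_conv_bound[OF facts] by blast
    have 2: "\<forall>c\<in>?lw. \<forall>T. synth_conv \<mu> sc ip \<pi> u w r m X c T \<longrightarrow>
            Co_norm \<mu> \<pi> u r m T \<le> b powr (1 / r) * lw_norm r (\<lambda>i. m (X i)) c"
    proof (intro ballI allI impI)
      fix c T assume c: "c \<in> ?lw" and s: "synth_conv \<mu> sc ip \<pi> u w r m X c T"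
      then have T: "T \<in> ?Co" and c': "elw r m (cnorm c) < top" by (auto simp: synth_conv_def lw_iff[OF m])
      show "Co_norm \<mu> \<pi> u r m T \<le> b powr (1 / r) * lw_norm r (\<lambda>i. m (X i)) c"
        unfolding Co_norm[OF T] lw_norm_eq[OF m c]
        using r by (intro enn2real_powr_le b(2)[OF c' s] c' b(1)) auto
    qed
    have 3: "\<forall>T\<in>?Co. Cop T \<in> ?lw"
      using neumann_coef_finite[OF facts small CoM] by (simp add: Cop_def lw_iff[OF m])
    have 4: "\<forall>T\<in>?Co. \<forall>T'\<in>?Co. Cop (\<lambda>v. T v + T' v) = (\<lambda>i. Cop T i + Cop T' i)"
      using neumann_coef_add[OF facts small CoM CoM] by (simp add: Cop_def Ve_def)
    have 5: "\<forall>a. \<forall>T\<in>?Co. Cop (\<lambda>v. a * T v) = (\<lambda>i. a * Cop T i)"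
      using neumann_coef_cmult[OF facts small CoM] by (simp add: Cop_def Ve_def)
    obtain B where B: "B < top" "\<And>F. inM r m F \<Longrightarrow> elw r m (cnorm (neumann_coef F)) \<le> B * enr r m (cnorm F)"
      using neumann_coef_bound[OF facts small] by blast
    then obtain b' where b': "B = ennreal b'" "0 \<le> b'" by (cases B) auto
    have 6: "\<forall>T\<in>?Co. lw_norm r (\<lambda>i. m (X i)) (Cop T) \<le> b' powr (1 / r) * Co_norm \<mu> \<pi> u r m T"
    proof
      fix T assume T: "T \<in> ?Co"
      have "Cop T \<in> ?lw" using 3 T by blast
      then show "lw_norm r (\<lambda>i. m (X i)) (Cop T) \<le> b' powr (1 / r) * Co_norm \<mu> \<pi> u r m T"
        unfolding Co_norm[OF T] lw_norm_eq[OF m \<open>Cop T \<in> ?lw\<close>]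
        using r b' B(2)[OF CoM[OF T]] CoM[OF T]
        by (intro enn2real_powr_le) (auto simp: Cop_def inM_def[OF facts])
    qed
    have 7: "\<forall>T\<in>?Co. synth_conv \<mu> sc ip \<pi> u w r m X (Cop T) T"
    proof
      fix T assume T: "T \<in> ?Co"
      show "synth_conv \<mu> sc ip \<pi> u w r m X (Cop T) T"
        unfolding Cop_def
        by (intro synth_conv_if[OF facts] neumann_coef_finite[OF facts small] CoM T
            synK_neumann_coef[OF facts small, symmetric])
    qed
    show "(\<forall>c\<in>?lw. \<exists>T. synth_conv \<mu> sc ip \<pi> u w r m X c T) \<and>
      (\<exists>B. \<forall>c\<in>?lw. \<forall>T. synth_conv \<mu> sc ip \<pi> u w r m X c T \<longrightarrow>
            Co_norm \<mu> \<pi> u r m T \<le> B * lw_norm r (\<lambda>i. m (X i)) c) \<and>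
      (\<forall>T\<in>?Co. Cop T \<in> ?lw) \<and>
      (\<forall>T\<in>?Co. \<forall>T'\<in>?Co. Cop (\<lambda>v. T v + T' v) = (\<lambda>i. Cop T i + Cop T' i)) \<and>
      (\<forall>a. \<forall>T\<in>?Co. Cop (\<lambda>v. a * T v) = (\<lambda>i. a * Cop T i)) \<and>
      (\<exists>B. \<forall>T\<in>?Co. lw_norm r (\<lambda>i. m (X i)) (Cop T) \<le> B * Co_norm \<mu> \<pi> u r m T) \<and>
      (\<forall>T\<in>?Co. synth_conv \<mu> sc ip \<pi> u w r m X (Cop T) T)"
      using 1 2 3 4 5 6 7 by blast
  qed
qed

end
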